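(* Let $\Omega\subset\mathbb C^n$ be a bounded domain. (1) For any $p>1$ and any open set $U\subset\subset\Omega$, there exists a constant $C>0$ such that $$|m_p(z,w)-m_p(z,w')|\le C|w-w'|^{\frac12},\qquad \forall\, z,w,w'\in U.$$ (2) For every open set $U\subset\subset\Omega$, there exists a constant $C>0$ such that $$|m_1(z,w)-m_1(z,w')|\le C|w-w'|^{\frac1{2(n+2)}},\qquad \forall\, z,w,w'\in U.$$ Moreover, for $w\in\Omega$ and every open set $U$ with $w\in U\subset\subset\Omega\setminus S_w$, where $S_w:=\{\zeta\in\Omega: m_1(\zeta,w)=0\}$, there exists a constant $C>0$ such that $$|m_1(z,w)-m_1(z,w')|\le C|w-w'|^{\frac12},\qquad\forall\, z,w'\in U.$$ The same conclusions also hold with the off-diagonal kernel $K_p(\cdot,\cdot)$ in place of $m_p(\cdot,\cdot)$ (with $p>1$ in (1) and $p=1$ in (2)).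
   Context: For a bounded domain $\Omega\subset\mathbb C^n$ and $p\ge1$, $A^p(\Omega)$ is the space of holomorphic functions $f$ on $\Omega$ with $\|f\|_p^p:=\int_\Omega|f|^p<\infty$ (Lebesgue measure). Put $m_p(z):=\inf\{\|f\|_p: f\in A^p(\Omega),\ f(z)=1\}$. For $p\ge1$ the infimum is attained by exactly one function, denoted $m_p(\cdot,z)$ (so $m_p(\zeta,z)$ is its value at $\zeta$). Set $K_p(z):=m_p(z)^{-p}$ and $K_p(z,w):=m_p(z,w)K_p(w)$. $U\subset\subset V$ means that $\overline U$ is a compact subset of $V$. *)

theory Defs
  imports "HOL-Analysis.Analysis"
begin

text \<open>
  A function of several complex variables is holomorphic if it is complex differentiable at every
  point, i.e. its real Frechet derivative is complex linear (additivity is part of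
  \<^const>\<open>has_derivative\<close>). This is meant for open sets.
\<close>

definition holomorphic_several ::
    "(complex ^ 'n) set \<Rightarrow> (complex ^ 'n \<Rightarrow> complex) \<Rightarrow> bool" where
  "holomorphic_several \<Omega> f \<longleftrightarrow>
     (\<forall>z\<in>\<Omega>. \<exists>D. (f has_derivative D) (at z) \<and> (\<forall>c v. D (c *s v) = c * D v))"

text \<open>
  Functions on \<open>\<Omega>\<close> are represented by total functions in \<^term>\<open>extensional \<Omega>\<close>, so that two elements
  of the space are equal as soon as they agree on \<open>\<Omega>\<close>.
\<close>

definition p_bergman_space ::
    "real \<Rightarrow> (complex ^ 'n) set \<Rightarrow> (complex ^ 'n \<Rightarrow> complex) set" where
  "p_bergman_space p \<Omega> =
     {f \<in> extensional \<Omega>. holomorphic_several \<Omega> f \<and>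
        set_integrable lborel \<Omega> (\<lambda>\<zeta>. norm (f \<zeta>) powr p)}"

definition p_norm :: "real \<Rightarrow> (complex ^ 'n) set \<Rightarrow> (complex ^ 'n \<Rightarrow> complex) \<Rightarrow> real" where
  "p_norm p \<Omega> f = (LINT \<zeta>:\<Omega>|lborel. norm (f \<zeta>) powr p) powr (1 / p)"

definition m_diag :: "real \<Rightarrow> (complex ^ 'n) set \<Rightarrow> complex ^ 'n \<Rightarrow> real" where
  "m_diag p \<Omega> z = Inf {p_norm p \<Omega> f | f. f \<in> p_bergman_space p \<Omega> \<and> f z = 1}"

text \<open>The description below is proper for bounded domains, \<open>p \<ge> 1\<close> and \<open>z \<in> \<Omega>\<close>.\<close>

definition m_minimizer ::
    "real \<Rightarrow> (complex ^ 'n) set \<Rightarrow> complex ^ 'n \<Rightarrow> complex ^ 'n \<Rightarrow> complex" where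
  "m_minimizer p \<Omega> z =
     (THE f. f \<in> p_bergman_space p \<Omega> \<and> f z = 1 \<and> p_norm p \<Omega> f = m_diag p \<Omega> z)"

definition m_off :: "real \<Rightarrow> (complex ^ 'n) set \<Rightarrow> complex ^ 'n \<Rightarrow> complex ^ 'n \<Rightarrow> complex" where
  "m_off p \<Omega> \<zeta> z = m_minimizer p \<Omega> z \<zeta>"

definition K_diag :: "real \<Rightarrow> (complex ^ 'n) set \<Rightarrow> complex ^ 'n \<Rightarrow> real" where
  "K_diag p \<Omega> z = m_diag p \<Omega> z powr (- p)"

definition K_off :: "real \<Rightarrow> (complex ^ 'n) set \<Rightarrow> complex ^ 'n \<Rightarrow> complex ^ 'n \<Rightarrow> complex" where
  "K_off p \<Omega> z w = m_off p \<Omega> z w * of_real (K_diag p \<Omega> w)"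

definition zero_set :: "(complex ^ 'n) set \<Rightarrow> complex ^ 'n \<Rightarrow> (complex ^ 'n) set" where
  "zero_set \<Omega> w = {\<zeta> \<in> \<Omega>. m_off 1 \<Omega> \<zeta> w = 0}"

definition relatively_compact_in :: "'a::topological_space set \<Rightarrow> 'a set \<Rightarrow> bool"
    (infix "\<subset>\<subset>" 50) where
  "U \<subset>\<subset> V \<longleftrightarrow> compact (closure U) \<and> closure U \<subseteq> V"

end

theory Submission
  imports Defs "HOL-Complex_Analysis.Complex_Analysis"
begin

text \<open>
  Both parts follow from one estimate, valid for every \<open>p \<ge> 1\<close>: on a compact subset of \<open>\<Omega>\<close> the
  minimizers satisfy \<open>\<bar>m\<^sub>p(z,w) - m\<^sub>p(z,w')\<bar> \<le> C \<bar>w - w'\<bar>\<^sup>1\<^sup>/\<^sup>2\<close> (\<open>m_off_Hoelder\<close>). Smaller exponents follow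
  because distances in a bounded set are bounded, a set that is relatively compact in \<open>\<Omega> - S\<^sub>w\<close> is
  relatively compact in \<open>\<Omega>\<close>, and the kernel \<open>K\<^sub>p\<close> is the minimizer divided by its energy
  \<open>\<integral> \<bar>f\<bar>\<^sup>p\<close>, which depends on \<open>w\<close> in a Lipschitz way.

  Let \<open>f\<close> and \<open>h\<close> be the minimizers at \<open>w\<close> and \<open>w'\<close>, and let \<open>\<delta> = \<bar>w - w'\<bar>\<close>. Since \<open>h(w)\<close> and \<open>f(w')\<close>
  differ from \<open>1\<close> by \<open>O(\<delta>)\<close>, the functions \<open>(f + h) / 2\<close> and \<open>f\<close> are almost admissible at \<open>w\<close> and \<open>w'\<close>,
  and minimality shows that the integral of the deficit
  \<open>(\<bar>f\<bar>\<^sup>p + \<bar>h\<bar>\<^sup>p) / 2 - \<bar>(f + h) / 2\<bar>\<^sup>p\<close> is \<open>O(\<delta>)\<close> (\<open>p_minimizers_deficit\<close>).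

  For \<open>p = 1\<close> the integrand is not strictly convex, and the deficit says nothing about the moduli of
  \<open>f\<close> and \<open>h\<close>. But for every \<open>p \<ge> 1\<close> it controls the angle between the two values: wherever \<open>f\<close> is
  bounded away from \<open>0\<close>, the square of \<open>Im (h / f)\<close> is at most a constant times the deficit
  (\<open>Im_quotient_le_midpoint_deficit\<close>). As \<open>h / f\<close> is holomorphic there, a mean value inequality and
  the Borel-Caratheodory inequality improve this to: \<open>h / f\<close> varies by \<open>O(\<delta>\<^sup>1\<^sup>/\<^sup>2)\<close> locally
  (\<open>quotient_oscillation_bound\<close>). At \<open>w\<close> the quotient is \<open>1 + O(\<delta>)\<close>. The zero set of \<open>f\<close> does not
  disconnect \<open>\<Omega>\<close>, so \<open>h / f = 1 + O(\<delta>\<^sup>1\<^sup>/\<^sup>2)\<close> spreads over its complement, and near zeros of \<open>f\<close> the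
  maximum principle on small circles gives \<open>h - f = O(\<delta>\<^sup>1\<^sup>/\<^sup>2)\<close>
  (\<open>locally_uniform_bound_propagates\<close>).

  The constants must not depend on \<open>w\<close> and \<open>w'\<close>. The argument is therefore run along sequences of
  hypothetical counterexamples, where a Montel theorem for functions of bounded energy provides a
  limit of the minimizers, and lower bounds for the limit hold for the sequence as well
  (\<open>p_bergman_stability\<close>). The same statement, applied to constant sequences, yields uniqueness of
  minimizers; existence follows from Montel's theorem and Fatou's lemma.
\<close>

section \<open>Holomorphic functions of several variables and their complex lines\<close>

lemma norm_vector_scalar_mult: "norm (c *s v) = norm c * norm (v :: complex ^ 'n)"
  by (simp add: norm_vec_def L2_set_right_distrib norm_mult)

lemma bounded_linear_vector_scalar_mult_left: "bounded_linear (\<lambda>c. c *s (v :: complex ^ 'n))"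
  by (rule bounded_linear_intro[where K = "norm v"])
     (auto simp: norm_vector_scalar_mult vec_eq_iff algebra_simps)

lemma bounded_linear_vector_scalar_mult_right: "bounded_linear (\<lambda>v. c *s (v :: complex ^ 'n))"
  by (rule bounded_linear_intro[where K = "norm c"])
     (auto simp: norm_vector_scalar_mult vec_eq_iff algebra_simps)

lemma holomorphic_several_subset:
  "holomorphic_several \<Omega> f \<Longrightarrow> \<Omega>' \<subseteq> \<Omega> \<Longrightarrow> holomorphic_several \<Omega>' f"
  unfolding holomorphic_several_def by blast

lemma holomorphic_several_cong:
  assumes "open \<Omega>" "\<And>x. x \<in> \<Omega> \<Longrightarrow> f x = g x" "holomorphic_several \<Omega> f"
  shows "holomorphic_several \<Omega> g"
  using assms unfolding holomorphic_several_def
  by (metis has_derivative_transform_within_open)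

lemma holomorphic_several_continuous_on:
  "holomorphic_several \<Omega> f \<Longrightarrow> continuous_on \<Omega> f"
  unfolding holomorphic_several_def
  by (meson continuous_at_imp_continuous_on has_derivative_continuous)

lemma holomorphic_several_const: "holomorphic_several \<Omega> (\<lambda>_. c)"
  unfolding holomorphic_several_def by (auto intro!: exI[of _ "\<lambda>_. 0"])

lemma holomorphic_several_add:
  assumes "holomorphic_several \<Omega> f" "holomorphic_several \<Omega> g"
  shows "holomorphic_several \<Omega> (\<lambda>x. f x + g x)"
  unfolding holomorphic_several_def
proof
  fix z assume "z \<in> \<Omega>"
  with assms obtain D E where "(f has_derivative D) (at z)" "\<forall>c v. D (c *s v) = c * D v"
    "(g has_derivative E) (at z)" "\<forall>c v. E (c *s v) = c * E v"
    unfolding holomorphic_several_def by metis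
  then show "\<exists>D. ((\<lambda>x. f x + g x) has_derivative D) (at z) \<and> (\<forall>c v. D (c *s v) = c * D v)"
    by (intro exI[of _ "\<lambda>x. D x + E x"]) (auto intro: has_derivative_add simp: algebra_simps)
qed

lemma holomorphic_several_mult:
  assumes "holomorphic_several \<Omega> f" "holomorphic_several \<Omega> g"
  shows "holomorphic_several \<Omega> (\<lambda>x. f x * g x)"
  unfolding holomorphic_several_def
proof
  fix z assume "z \<in> \<Omega>"
  with assms obtain D E where "(f has_derivative D) (at z)" "\<forall>c v. D (c *s v) = c * D v"
    "(g has_derivative E) (at z)" "\<forall>c v. E (c *s v) = c * E v"
    unfolding holomorphic_several_def by metis
  then show "\<exists>D. ((\<lambda>x. f x * g x) has_derivative D) (at z) \<and> (\<forall>c v. D (c *s v) = c * D v)"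
    by (intro exI[of _ "\<lambda>x. f z * E x + D x * g z"] conjI has_derivative_mult)
       (auto simp: algebra_simps)
qed

lemma holomorphic_several_inverse:
  assumes "holomorphic_several \<Omega> f" "\<And>x. x \<in> \<Omega> \<Longrightarrow> f x \<noteq> 0"
  shows "holomorphic_several \<Omega> (\<lambda>x. inverse (f x))"
  unfolding holomorphic_several_def
proof
  fix z assume z: "z \<in> \<Omega>"
  with assms obtain D where "(f has_derivative D) (at z)" "\<forall>c v. D (c *s v) = c * D v"
    unfolding holomorphic_several_def by metis
  with assms z show "\<exists>D. ((\<lambda>x. inverse (f x)) has_derivative D) (at z) \<and> (\<forall>c v. D (c *s v) = c * D v)"
    by (intro exI[of _ "\<lambda>x. - (inverse (f z) * D x * inverse (f z))"])
       (auto intro: has_derivative_inverse)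
qed

lemma holomorphic_several_divide:
  assumes "holomorphic_several \<Omega> f" "holomorphic_several \<Omega> g" "\<And>x. x \<in> \<Omega> \<Longrightarrow> g x \<noteq> 0"
  shows "holomorphic_several \<Omega> (\<lambda>x. f x / g x)"
  using holomorphic_several_mult[OF assms(1) holomorphic_several_inverse[OF assms(2,3)]]
  by (simp add: divide_inverse)

lemma holomorphic_several_diff:
  assumes "holomorphic_several \<Omega> f" "holomorphic_several \<Omega> g"
  shows "holomorphic_several \<Omega> (\<lambda>x. f x - g x)"
  using holomorphic_several_add[OF assms(1)
      holomorphic_several_mult[OF holomorphic_several_const[of _ "-1"] assms(2)]] by simp

lemma holomorphic_on_complex_line:
  assumes "holomorphic_several \<Omega> f"
  shows "(\<lambda>\<zeta>. f (z + \<zeta> *s v)) holomorphic_on {\<zeta>. z + \<zeta> *s v \<in> \<Omega>}"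
  unfolding holomorphic_on_def
proof
  fix \<zeta> assume "\<zeta> \<in> {\<zeta>. z + \<zeta> *s v \<in> \<Omega>}"
  with assms obtain D where D: "(f has_derivative D) (at (z + \<zeta> *s v))" "\<forall>c v. D (c *s v) = c * D v"
    unfolding holomorphic_several_def by blast
  have "((\<lambda>\<zeta>. z + \<zeta> *s v) has_derivative (\<lambda>\<zeta>. 0 + \<zeta> *s v)) (at \<zeta>)"
    by (intro has_derivative_add has_derivative_const
        bounded_linear.has_derivative[OF bounded_linear_vector_scalar_mult_left] has_derivative_ident)
  from has_derivative_compose[OF this D(1)] have "((\<lambda>\<zeta>. f (z + \<zeta> *s v)) has_derivative (\<lambda>\<zeta>. D v * \<zeta>)) (at \<zeta>)"
    unfolding add_0_left D(2)[rule_format] by (subst mult.commute)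
  then show "(\<lambda>\<zeta>. f (z + \<zeta> *s v)) field_differentiable at \<zeta> within {\<zeta>. z + \<zeta> *s v \<in> \<Omega>}"
    by (metis field_differentiable_at_within field_differentiable_def has_field_derivative_def)
qed

section \<open>Holomorphic functions with small imaginary part\<close>

text \<open>
  A form of the Borel-Caratheodory inequality: with \<open>W = -\<i>(g - g(0))\<close>, the Moebius transform
  \<open>W / (5A - W)\<close> maps the disc into the unit disc and fixes \<open>0\<close>, so the Schwarz lemma applies.
  Only the imaginary part of \<open>g\<close> is controlled, which is exactly the information that the midpoint
  deficit of two functions gives about their quotient.
\<close>

lemma Im_bounded_holomorphic_increment_disc:
  assumes hol: "g holomorphic_on ball 0 R" and "0 < A"
    and bd: "\<And>\<zeta>. \<zeta> \<in> ball 0 R \<Longrightarrow> \<bar>Im (g \<zeta>)\<bar> \<le> A" and \<zeta>: "norm \<zeta> < R"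
  shows "norm (g \<zeta> - g 0) \<le> 5 * A * norm \<zeta> / (R - norm \<zeta>)"
proof -
  have R: "0 < R" using \<zeta> norm_ge_zero[of \<zeta>] by linarith
  define W where "W \<xi> = - \<i> * (g (of_real R * \<xi>) - g 0)" for \<xi>
  define F where "F \<xi> = W \<xi> / (of_real (5 * A) - W \<xi>)" for \<xi>
  have in_ball: "of_real R * \<xi> \<in> ball 0 R" if "\<xi> \<in> ball 0 1" for \<xi> :: complex
    using that R by (simp add: norm_mult)
  have ReW: "Re (W \<xi>) \<le> 2 * A" if "\<xi> \<in> ball 0 1" for \<xi>
    using bd[OF in_ball[OF that]] bd[of 0] R unfolding W_def by simp
  have W0: "W 0 = 0" by (simp add: W_def)
  have lt: "norm (W \<xi>) < norm (of_real (5 * A) - W \<xi>)" if "\<xi> \<in> ball 0 1" for \<xi>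
  proof -
    have "(norm (of_real (5 * A) - W \<xi>))\<^sup>2 = (norm (W \<xi>))\<^sup>2 + 5 * A * (5 * A - 2 * Re (W \<xi>))"
      unfolding cmod_power2 minus_complex.sel Re_complex_of_real Im_complex_of_real
      by (simp add: power2_eq_square algebra_simps)
    moreover have "5 * A * (5 * A - 2 * Re (W \<xi>)) > 0"
    proof (rule mult_pos_pos)
      show "0 < 5 * A - 2 * Re (W \<xi>)" using ReW[OF that] \<open>0 < A\<close> by linarith
    qed (use \<open>0 < A\<close> in simp)
    ultimately have "(norm (W \<xi>))\<^sup>2 < (norm (of_real (5 * A) - W \<xi>))\<^sup>2" by linarith
    then show ?thesis by (rule power2_less_imp_less) (rule norm_ge_zero)
  qed
  have nz: "of_real (5 * A) - W \<xi> \<noteq> 0" if "\<xi> \<in> ball 0 1" for \<xi>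
    using order_le_less_trans[OF norm_ge_zero lt[OF that]] by (simp only: zero_less_norm_iff not_False_eq_True)
  have "(\<lambda>\<xi>. g (of_real R * \<xi>)) holomorphic_on ball 0 1"
    by (rule holomorphic_on_compose_gen[OF _ hol, unfolded o_def])
       (auto intro!: holomorphic_intros in_ball simp del: mem_ball)
  then have "W holomorphic_on ball 0 1"
    unfolding W_def by (intro holomorphic_intros)
  then have holF: "F holomorphic_on ball 0 1"
    unfolding F_def using nz by (intro holomorphic_intros) auto
  have F1: "norm (F \<xi>) < 1" if "norm \<xi> < 1" for \<xi>
    using lt[of \<xi>] nz[of \<xi>] that by (simp add: F_def norm_divide)
  define s where "s = norm \<zeta> / R"
  have s: "0 \<le> s" "s < 1" using \<zeta> R by (auto simp: s_def)
  define \<xi> where "\<xi> = \<zeta> / of_real R"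
  have \<xi>: "norm \<xi> = s" "of_real R * \<xi> = \<zeta>" using R by (auto simp: \<xi>_def s_def norm_divide)
  have Fle: "norm (F \<xi>) \<le> s"
    using Schwarz_Lemma(1)[OF holF _ F1, of \<xi>] s \<xi> by (simp add: F_def W0)
  have "W \<xi> * (1 + F \<xi>) = of_real (5 * A) * F \<xi>"
    using nz[of \<xi>] s \<xi> by (simp add: F_def field_simps)
  then have "norm (W \<xi>) * norm (1 + F \<xi>) = 5 * A * norm (F \<xi>)"
    using \<open>0 < A\<close> by (metis abs_of_pos mult_pos_pos norm_mult norm_of_real zero_less_numeral)
  moreover have "norm (1 + F \<xi>) \<ge> 1 - s"
    using norm_triangle_ineq2[of 1 "- F \<xi>"] Fle by simp
  ultimately have "norm (W \<xi>) * (1 - s) \<le> 5 * A * norm (F \<xi>)"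
    by (metis mult_left_mono norm_ge_zero)
  also have "\<dots> \<le> 5 * A * s"
    using Fle \<open>0 < A\<close> by (intro mult_left_mono) auto
  finally have "norm (W \<xi>) * (1 - s) \<le> 5 * A * s" .
  then have "norm (W \<xi>) \<le> 5 * A * s / (1 - s)"
    using s by (simp add: pos_le_divide_eq)
  moreover have "5 * A * s / (1 - s) = 5 * A * norm \<zeta> / (R - norm \<zeta>)"
    using R \<zeta> by (simp add: s_def field_simps)
  ultimately show ?thesis by (simp add: W_def \<xi> norm_mult)
qed

text \<open>
  The disc estimate on the complex line through \<open>z\<close> and \<open>x\<close>. Besides controlling quotients, it
  serves as the Cauchy estimate, as \<open>\<bar>Im q\<bar> \<le> \<bar>q\<bar>\<close>.
\<close>

lemma Im_bounded_holomorphic_several_increment: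
  assumes hol: "holomorphic_several (ball z R) q" and "0 < A"
    and bd: "\<And>x. x \<in> ball z R \<Longrightarrow> \<bar>Im (q x)\<bar> \<le> A" and x: "x \<in> ball z (R / 2)"
  shows "norm (q x - q z) \<le> 10 * A / R * norm (x - z)"
proof (cases "x = z")
  case False
  define d where "d = norm (x - z)"
  have d: "0 < d" "d < R / 2" using False x by (auto simp: d_def dist_norm norm_minus_commute)
  define g where "g \<zeta> = q (z + \<zeta> *s (x - z))" for \<zeta>
  have sub: "z + \<zeta> *s (x - z) \<in> ball z R" if "\<zeta> \<in> ball 0 (R / d)" for \<zeta>
  proof -
    have "dist z (z + \<zeta> *s (x - z)) = norm \<zeta> * d"
      by (simp add: dist_norm norm_vector_scalar_mult d_def del: vector_ssub_ldistrib)
    with that d show ?thesis by (simp add: field_simps)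
  qed
  have "g holomorphic_on ball 0 (R / d)"
    unfolding g_def by (rule holomorphic_on_subset[OF holomorphic_on_complex_line[OF hol]]) (use sub in auto)
  then have "norm (g 1 - g 0) \<le> 5 * A * norm (1::complex) / (R / d - norm (1::complex))"
    by (rule Im_bounded_holomorphic_increment_disc[OF _ \<open>0 < A\<close>])
       (use d bd sub in \<open>auto simp: g_def field_simps\<close>)
  also have "\<dots> = 5 * A * d / (R - d)" using d by (simp add: field_simps)
  also have "\<dots> \<le> 5 * A * d / (R / 2)"
    using d \<open>0 < A\<close> by (intro divide_left_mono mult_pos_pos) auto
  finally have "norm (q x - q z) \<le> 5 * A * d / (R / 2)" by (simp add: g_def)
  also have "\<dots> = 10 * A / R * norm (x - z)" using d by (simp add: d_def[symmetric])
  finally show ?thesis .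
qed simp

section \<open>Invariance of Lebesgue measure under linear isometries\<close>

lemma nn_integral_lborel_translate:
  fixes c :: "'a :: euclidean_space"
  assumes [measurable]: "a \<in> borel_measurable borel"
  shows "(\<integral>\<^sup>+x. a (c + x) \<partial>lborel) = (\<integral>\<^sup>+x. a x \<partial>lborel)"
proof -
  have "(\<integral>\<^sup>+x. a x \<partial>lborel) = (\<integral>\<^sup>+x. a x \<partial>(distr lborel borel ((+) c)))"
    by (simp add: lborel_distr_plus)
  also have "\<dots> = (\<integral>\<^sup>+x. a (c + x) \<partial>lborel)"
    by (subst nn_integral_distr) auto
  finally show ?thesis by simp
qed

text \<open>
  Tonelli's theorem proves this by the usual uniqueness argument for Haar measure: the double
  integral of \<open>b(y) a(T x)\<close>, with \<open>b\<close> the indicator of the unit ball, is transformed by the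
  translations \<open>x \<mapsto> S y + x\<close> (where \<open>S\<close> inverts \<open>T\<close>) and \<open>y \<mapsto> y - T x\<close> into the double integral of
  \<open>b(y - T x) a(y)\<close>. Since \<open>T\<close> preserves norms, the inner integral of the latter is the volume of a
  unit ball again, and that volume cancels.
\<close>

lemma nn_integral_lborel_isometry:
  fixes T :: "'a :: euclidean_space \<Rightarrow> 'a"
  assumes "linear T" and iso: "\<And>x. norm (T x) = norm x"
    and meas [measurable]: "a \<in> borel_measurable borel"
  shows "(\<integral>\<^sup>+x. a (T x) \<partial>lborel) = (\<integral>\<^sup>+x. a x \<partial>lborel)"
proof -
  interpret T: linear T by fact
  have [measurable]: "T \<in> borel_measurable borel"
    using \<open>linear T\<close> by (intro borel_measurable_continuous_onI linear_continuous_on)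
      (simp add: linear_conv_bounded_linear)
  have "inj T" using iso by (simp add: T.inj_iff_eq_0) (metis norm_eq_zero)
  then have "surj T" using \<open>linear T\<close> linear_injective_imp_surjective by blast
  then obtain S where S: "\<And>y. T (S y) = y" by (metis surjD)
  have normS: "norm (S y) = norm y" for y by (metis S iso)
  define B where "B = emeasure lborel (ball (0::'a) 1)"
  define b :: "'a \<Rightarrow> ennreal" where "b = indicator (ball 0 1)"
  have [measurable]: "b \<in> borel_measurable borel" unfolding b_def by (intro borel_measurable_indicator) auto
  have vol: "emeasure lborel (ball x 1) = B" for x :: 'a
  proof -
    have "emeasure lborel (ball x 1) = (\<integral>\<^sup>+y. indicator (ball x 1) y \<partial>lborel)" by simp
    also have "\<dots> = (\<integral>\<^sup>+y. indicator (ball x 1) (x + y) \<partial>lborel)"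
      by (rule nn_integral_lborel_translate[symmetric]) (auto intro!: borel_measurable_indicator)
    also have "\<dots> = (\<integral>\<^sup>+y. indicator (ball 0 1) (y::'a) \<partial>lborel)"
      by (intro nn_integral_cong) (auto simp: indicator_def dist_norm)
    finally show ?thesis by (simp add: B_def)
  qed
  have bT: "(\<integral>\<^sup>+x. b (y - T x) \<partial>lborel) = B" for y
  proof -
    have "b (y - T x) = indicator (ball (S y) 1) x" for x :: 'a
    proof -
      have "norm (T x - y) = norm (S y - x)" by (metis S T.diff iso norm_minus_commute)
      then show ?thesis by (simp add: b_def indicator_def dist_norm)
    qed
    then show ?thesis using vol by simp
  qed
  have bint: "(\<integral>\<^sup>+y. b y \<partial>lborel) = B" by (simp add: b_def B_def)
  have "B * (\<integral>\<^sup>+x. a (T x) \<partial>lborel) = (\<integral>\<^sup>+y. b y * (\<integral>\<^sup>+x. a (T x) \<partial>lborel) \<partial>lborel)"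
    by (simp add: nn_integral_multc bint)
  also have "\<dots> = (\<integral>\<^sup>+y. b y * (\<integral>\<^sup>+x. a (T (S y + x)) \<partial>lborel) \<partial>lborel)"
    by (subst nn_integral_lborel_translate[where a = "\<lambda>x. a (T x)"]) auto
  also have "\<dots> = (\<integral>\<^sup>+y. (\<integral>\<^sup>+x. b y * a (T x + y) \<partial>lborel) \<partial>lborel)"
    by (subst nn_integral_cmult[symmetric]) (auto simp: T.add S add.commute)
  also have "\<dots> = (\<integral>\<^sup>+x. (\<integral>\<^sup>+y. b y * a (T x + y) \<partial>lborel) \<partial>lborel)"
    by (rule lborel_pair.Fubini') measurable
  also have "\<dots> = (\<integral>\<^sup>+x. (\<integral>\<^sup>+y. b (y - T x) * a y \<partial>lborel) \<partial>lborel)"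
  proof (rule nn_integral_cong)
    fix x
    show "(\<integral>\<^sup>+y. b y * a (T x + y) \<partial>lborel) = (\<integral>\<^sup>+y. b (y - T x) * a y \<partial>lborel)"
      using nn_integral_lborel_translate[of "\<lambda>y. b (y - T x) * a y" "T x"] by simp
  qed
  also have "\<dots> = (\<integral>\<^sup>+y. (\<integral>\<^sup>+x. b (y - T x) * a y \<partial>lborel) \<partial>lborel)"
    by (rule lborel_pair.Fubini') measurable
  also have "\<dots> = (\<integral>\<^sup>+y. B * a y \<partial>lborel)"
    by (subst nn_integral_multc) (auto simp: bT)
  also have "\<dots> = B * (\<integral>\<^sup>+y. a y \<partial>lborel)"
    by (rule nn_integral_cmult) auto
  finally have eq: "B * (\<integral>\<^sup>+x. a (T x) \<partial>lborel) = B * (\<integral>\<^sup>+y. a y \<partial>lborel)" .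
  have "B \<noteq> 0" "B \<noteq> \<infinity>"
    unfolding B_def using emeasure_lborel_ball_finite[of "0::'a" 1]
      open_not_negligible[of "ball (0::'a) 1"]
    by (auto simp: negligible_iff_null_sets null_sets_def)
  with eq show ?thesis by (simp add: ennreal_mult_cancel_left)
qed

section \<open>The mean value inequality on balls\<close>

lemma circle_mean_value:
  fixes g :: "complex \<Rightarrow> complex"
  assumes hol: "g holomorphic_on U" "open U" "cball 0 1 \<subseteq> U"
  shows "((\<lambda>t. g (cis t)) has_integral 2 * pi * g 0) {0..2*pi}"
proof -
  have "((\<lambda>u. g u / (u - 0)) has_contour_integral (2 * of_real pi * \<i> * g 0)) (circlepath 0 1)"
    by (rule Cauchy_integral_circlepath)
       (use holomorphic_on_subset[OF hol(1) assms(3)] holomorphic_on_subset[OF hol(1), of "ball 0 1"] assms(3)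
          ball_subset_cball[of "0::complex" 1] in \<open>auto intro!: holomorphic_on_imp_continuous_on\<close>)
  then have "((\<lambda>t. g (cis t) * \<i>) has_integral 2 * of_real pi * \<i> * g 0) {0..2*pi}"
    unfolding circlepath_def by (subst (asm) has_contour_integral_part_circlepath_iff) (auto simp: field_simps)
  from has_integral_mult_left[OF this, of "- \<i>"] show ?thesis by (simp add: field_simps)
qed

lemma abs_Im_circle_submean:
  assumes hol: "g holomorphic_on U" "open U" "cball 0 1 \<subseteq> U"
  shows "ennreal (2 * pi * \<bar>Im (g 0)\<bar>) \<le> (\<integral>\<^sup>+t. ennreal \<bar>Im (g (cis t))\<bar> * indicator {0..2*pi} t \<partial>lborel)"
proof -
  have "((\<lambda>t. Im (g (cis t))) has_integral 2 * pi * Im (g 0)) {0..2*pi}"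
    using has_integral_linear[OF circle_mean_value[OF assms] bounded_linear_Im] by (simp add: o_def)
  have cont: "continuous_on {0..2*pi} (\<lambda>t. \<bar>Im (g (cis t))\<bar>)"
    using assms(3)
    by (intro continuous_intros continuous_on_compose2[OF holomorphic_on_imp_continuous_on[OF hol(1)]]) auto
  then have int: "(\<lambda>t. \<bar>Im (g (cis t))\<bar>) integrable_on {0..2*pi}"
    by (rule integrable_continuous_real)
  have "\<bar>2 * pi * Im (g 0)\<bar> \<le> integral {0..2*pi} (\<lambda>t. \<bar>Im (g (cis t))\<bar>)"
    using integral_norm_bound_integral[OF _ int, of "\<lambda>t. Im (g (cis t))"]
      \<open>(_ has_integral _) _\<close> by (auto simp: integral_unique has_integral_integrable)
  then have "ennreal (2 * pi * \<bar>Im (g 0)\<bar>) \<le> ennreal (integral {0..2*pi} (\<lambda>t. \<bar>Im (g (cis t))\<bar>))"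
    by (intro ennreal_leI) (simp add: abs_mult)
  also have "\<dots> = (\<integral>\<^sup>+t. ennreal (indicator {0..2*pi} t * \<bar>Im (g (cis t))\<bar>) \<partial>lborel)"
  proof (rule nn_integral_has_integral_lborel[symmetric])
    show "((\<lambda>t. indicator {0..2 * pi} t * \<bar>Im (g (cis t))\<bar>) has_integral
       integral {0..2*pi} (\<lambda>t. \<bar>Im (g (cis t))\<bar>)) UNIV"
    proof -
      have "(\<lambda>t. indicator {0..2 * pi} t * \<bar>Im (g (cis t))\<bar>)
          = (\<lambda>t. if t \<in> {0..2*pi} then \<bar>Im (g (cis t))\<bar> else 0)" by auto
      then show ?thesis using integrable_integral[OF int] by (simp only: has_integral_restrict_UNIV)
    qed
    show "(\<lambda>t. indicator {0..2 * pi} t * \<bar>Im (g (cis t))\<bar>) \<in> borel_measurable borel"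
      using borel_measurable_continuous_on_indicator[OF _ cont] by simp
  qed auto
  also have "\<dots> = (\<integral>\<^sup>+t. ennreal \<bar>Im (g (cis t))\<bar> * indicator {0..2*pi} t \<partial>lborel)"
    by (intro nn_integral_cong) (auto simp: indicator_def)
  finally show ?thesis .
qed

lemma emeasure_lborel_ball_translate:
  fixes z :: "'a :: euclidean_space"
  shows "emeasure lborel (ball z r) = emeasure lborel (ball (0::'a) r)"
proof -
  have "emeasure lborel (ball z r) = (\<integral>\<^sup>+y. indicator (ball z r) y \<partial>lborel)" by simp
  also have "\<dots> = (\<integral>\<^sup>+y. indicator (ball z r) (z + y) \<partial>lborel)"
    by (rule nn_integral_lborel_translate[symmetric]) (auto intro!: borel_measurable_indicator)
  also have "\<dots> = (\<integral>\<^sup>+y. indicator (ball 0 r) (y::'a) \<partial>lborel)"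
    by (intro nn_integral_cong) (auto simp: indicator_def dist_norm)
  finally show ?thesis by simp
qed

text \<open>
  Averaging over the rotations \<open>v \<mapsto> e\<^sup>i\<^sup>t v\<close> replaces polar coordinates: for each \<open>v\<close> the mean value
  property on the circle \<open>t \<mapsto> z + e\<^sup>i\<^sup>t v\<close> bounds \<open>\<bar>Im q(z)\<bar>\<close>; integrating over \<open>v\<close> in the ball and
  interchanging the integrals, each rotation leaves the integral over the ball unchanged.
\<close>

lemma abs_Im_ball_submean:
  fixes z :: "complex ^ 'n"
  assumes hol: "holomorphic_several (ball z r) q"
  shows "ennreal \<bar>Im (q z)\<bar> * emeasure lborel (ball z r) \<le> (\<integral>\<^sup>+x\<in>ball z r. ennreal \<bar>Im (q x)\<bar> \<partial>lborel)"
proof -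
  define G where "G x = ennreal \<bar>Im (q x)\<bar> * indicator (ball z r) x" for x
  have "(\<lambda>x. indicator (ball z r) x *\<^sub>R \<bar>Im (q x)\<bar>) \<in> borel_measurable borel"
    using holomorphic_several_continuous_on[OF hol]
    by (intro borel_measurable_continuous_on_indicator continuous_intros) auto
  then have "(\<lambda>x. ennreal (indicator (ball z r) x *\<^sub>R \<bar>Im (q x)\<bar>)) \<in> borel_measurable borel"
    by measurable
  also have "(\<lambda>x. ennreal (indicator (ball z r) x *\<^sub>R \<bar>Im (q x)\<bar>)) = G"
    by (auto simp: G_def fun_eq_iff indicator_def)
  finally have [measurable]: "G \<in> borel_measurable borel" .
  have scal [measurable]: "(\<lambda>(v, t). z + cis t *s v) \<in> borel_measurable (borel \<Otimes>\<^sub>M borel)"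
  proof -
    have "continuous_on UNIV (\<lambda>p. z + cis (snd p) *s (fst p))"
      unfolding vector_scalar_mult_def by (intro continuous_intros continuous_on_vec_lambda)
    then show ?thesis by (simp add: borel_prod borel_measurable_continuous_onI case_prod_unfold)
  qed
  have rot: "(\<integral>\<^sup>+v. G (z + cis t *s v) \<partial>lborel) = (\<integral>\<^sup>+x. G x \<partial>lborel)" for t
  proof -
    have "(\<integral>\<^sup>+v. G (z + cis t *s v) \<partial>lborel) = (\<integral>\<^sup>+v. G (z + v) \<partial>lborel)"
      by (rule nn_integral_lborel_isometry[where a = "\<lambda>v. G (z + v)"])
         (auto simp: norm_vector_scalar_mult bounded_linear.linear bounded_linear_vector_scalar_mult_right)
    then show ?thesis by (simp add: nn_integral_lborel_translate)
  qed
  have circ: "ennreal (2 * pi * \<bar>Im (q z)\<bar>) * indicator (ball 0 r) v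
      \<le> (\<integral>\<^sup>+t. G (z + cis t *s v) * indicator {0..2*pi} t \<partial>lborel)" for v
  proof (cases "v \<in> ball 0 r")
    case True
    define U where "U = {\<zeta>. z + \<zeta> *s v \<in> ball z r}"
    have "continuous_on UNIV (\<lambda>\<zeta>. z + \<zeta> *s v)"
      by (intro continuous_intros linear_continuous_on bounded_linear_vector_scalar_mult_left)
    from continuous_on_open_vimage[THEN iffD1, rule_format, OF _ this open_ball]
    have "open U" by (simp add: U_def vimage_def)
    have in_ball: "z + \<zeta> *s v \<in> ball z r" if "norm \<zeta> \<le> 1" for \<zeta>
      using True that mult_right_mono[OF that, of "norm v"] by (simp add: dist_norm norm_vector_scalar_mult)
    have "(\<lambda>\<zeta>. q (z + \<zeta> *s v)) holomorphic_on U"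
      unfolding U_def by (rule holomorphic_on_complex_line[OF hol])
    from abs_Im_circle_submean[OF this \<open>open U\<close>]
    have "ennreal (2 * pi * \<bar>Im (q (z + 0 *s v))\<bar>)
       \<le> (\<integral>\<^sup>+t. ennreal \<bar>Im (q (z + cis t *s v))\<bar> * indicator {0..2*pi} t \<partial>lborel)"
      using in_ball by (simp add: U_def subset_eq del: mem_ball)
    also have "\<dots> = (\<integral>\<^sup>+t. G (z + cis t *s v) * indicator {0..2*pi} t \<partial>lborel)"
      using in_ball[of "cis _"] by (simp add: G_def del: mem_ball)
    finally show ?thesis using True by simp
  qed simp
  have "ennreal (2 * pi) * (ennreal \<bar>Im (q z)\<bar> * emeasure lborel (ball z r))
     = ennreal (2 * pi * \<bar>Im (q z)\<bar>) * emeasure lborel (ball (0::complex^'n) r)"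
    by (simp add: ennreal_mult emeasure_lborel_ball_translate[of z] mult.assoc)
  also have "\<dots> = (\<integral>\<^sup>+v. ennreal (2 * pi * \<bar>Im (q z)\<bar>) * indicator (ball 0 r) v \<partial>(lborel :: (complex^'n) measure))"
    by (rule nn_integral_cmult_indicator[symmetric]) simp
  also have "\<dots> \<le> (\<integral>\<^sup>+v. (\<integral>\<^sup>+t. G (z + cis t *s v) * indicator {0..2*pi} t \<partial>lborel) \<partial>lborel)"
    by (intro nn_integral_mono circ)
  also have "\<dots> = (\<integral>\<^sup>+t. (\<integral>\<^sup>+v. G (z + cis t *s v) * indicator {0..2*pi} t \<partial>lborel) \<partial>lborel)"
    by (rule lborel_pair.Fubini') measurable
  also have "\<dots> = (\<integral>\<^sup>+t. (\<integral>\<^sup>+x. G x \<partial>lborel) * indicator {0..2*pi} t \<partial>lborel)"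
    by (subst nn_integral_multc) (auto simp: rot)
  also have "\<dots> = ennreal (2 * pi) * (\<integral>\<^sup>+x. G x \<partial>lborel)"
    by (simp add: nn_integral_cmult mult.commute)
  finally show ?thesis by (simp add: G_def ennreal_mult_le_mult_iff)
qed

section \<open>Locally uniform limits\<close>

text \<open>
  Turns Lipschitz bounds for the differences of a uniformly Cauchy sequence into bounds for the
  differences of the derivatives.
\<close>

lemma has_derivative_norm_le_of_local_Lipschitz:
  fixes u :: "'a :: real_normed_vector \<Rightarrow> 'b :: real_normed_vector"
  assumes der: "(u has_derivative D) (at x)" and "0 < r"
    and lip: "\<And>y. y \<in> ball x r \<Longrightarrow> norm (u y - u x) \<le> L * norm (y - x)"
  shows "norm (D h) \<le> L * norm h"
proof (cases "h = 0")
  case True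
  then show ?thesis using has_derivative_bounded_linear[OF der] by (simp add: linear_simps)
next
  case False
  show ?thesis
  proof (rule field_le_epsilon)
    fix e :: real assume "0 < e"
    define e' where "e' = e / norm h"
    have "0 < e'" using \<open>0 < e\<close> False by (simp add: e'_def)
    with der obtain d where d: "d > 0"
      "\<And>y. norm (y - x) < d \<Longrightarrow> norm (u y - u x - D (y - x)) \<le> e' * norm (y - x)"
      unfolding has_derivative_at_alt by blast
    define t where "t = min d r / 2 / norm h"
    have t: "t > 0" "norm (t *\<^sub>R h) < d" "norm (t *\<^sub>R h) < r"
      using d \<open>0 < r\<close> False by (auto simp: t_def)
    have "t * norm (D h) = norm (D (t *\<^sub>R h))"
      using has_derivative_bounded_linear[OF der] t by (simp add: linear_simps)
    also have "\<dots> \<le> norm (u (x + t *\<^sub>R h) - u x) + norm (u (x + t *\<^sub>R h) - u x - D (t *\<^sub>R h))"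
      by (metis norm_triangle_sub norm_minus_commute)
    also have "\<dots> \<le> L * norm (t *\<^sub>R h) + e' * norm (t *\<^sub>R h)"
      using lip[of "x + t *\<^sub>R h"] d(2)[of "x + t *\<^sub>R h"] t by (intro add_mono) (auto simp: dist_norm)
    also have "\<dots> = t * (L * norm h + e)"
      using False t by (simp add: e'_def field_simps)
    finally show "norm (D h) \<le> L * norm h + e" using t by simp
  qed
qed

text \<open>
  The Weierstrass convergence theorem at a point. Cauchy estimates make the derivatives uniformly
  Cauchy on a smaller ball, so that the derivative of the limit is the limit of the derivatives,
  and complex linearity passes to the limit.
\<close>

lemma complex_linear_derivative_of_uniform_limit:
  assumes "0 < s" and hol: "\<And>k. holomorphic_several (ball z s) (f k)"
    and lim: "uniform_limit (ball z s) f g sequentially"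
  shows "\<exists>D. (g has_derivative D) (at z) \<and> (\<forall>c v. D (c *s v) = c * D v)"
proof -
  obtain D where D: "\<And>k x. x \<in> ball z s \<Longrightarrow> (f k has_derivative D k x) (at x)"
    "\<And>k x c v. x \<in> ball z s \<Longrightarrow> D k x (c *s v) = c * D k x v"
    using hol unfolding holomorphic_several_def by metis
  define S where "S = ball z (s / 2)"
  have S: "x \<in> S \<Longrightarrow> x \<in> ball z s" for x using \<open>0 < s\<close> by (auto simp: S_def)
  have bound: "norm (D k x h - D l x h) \<le> 20 * A / s * norm h"
    if "0 < A" and A: "\<And>y. y \<in> ball z s \<Longrightarrow> norm (f k y - f l y) \<le> A" and x: "x \<in> S" for A k l x h
  proof -
    have sub: "ball x (s / 2) \<subseteq> ball z s" using x by (simp add: S_def ball_subset_ball_iff dist_commute)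
    have "((\<lambda>y. f k y - f l y) has_derivative (\<lambda>h. D k x h - D l x h)) (at x)"
      using D(1) S[OF x] by (intro has_derivative_diff) auto
    moreover have "norm ((f k y - f l y) - (f k x - f l x)) \<le> 20 * A / s * norm (y - x)"
      if "y \<in> ball x (s / 4)" for y
    proof -
      have "holomorphic_several (ball x (s / 2)) (\<lambda>y. f k y - f l y)"
        using hol sub by (intro holomorphic_several_diff) (blast intro: holomorphic_several_subset)+
      moreover have "\<bar>Im (f k y - f l y)\<bar> \<le> A" if "y \<in> ball x (s / 2)" for y
        using A[of y] abs_Im_le_cmod[of "f k y - f l y"] that sub by auto
      ultimately have "norm ((f k y - f l y) - (f k x - f l x)) \<le> 10 * A / (s / 2) * norm (y - x)"
        by (rule Im_bounded_holomorphic_several_increment[OF _ \<open>0 < A\<close>]) (use that in auto)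
      then show ?thesis by simp
    qed
    ultimately show ?thesis using \<open>0 < s\<close>
      by (intro has_derivative_norm_le_of_local_Lipschitz[where r = "s / 4"]) auto
  qed
  have Cauchy: "\<exists>N. \<forall>k\<ge>N. \<forall>l\<ge>N. \<forall>x\<in>S. \<forall>h. norm (D k x h - D l x h) \<le> e * norm h" if "0 < e" for e
  proof -
    define A where "A = e * s / 20"
    have "0 < A" using that \<open>0 < s\<close> by (simp add: A_def)
    then have "\<forall>\<^sub>F k in sequentially. \<forall>x\<in>ball z s. dist (f k x) (g x) < A / 2"
      using lim by (intro uniform_limitD) auto
    then obtain N where N: "\<And>k x. k \<ge> N \<Longrightarrow> x \<in> ball z s \<Longrightarrow> dist (f k x) (g x) < A / 2"
      unfolding eventually_sequentially by blast
    have "norm (D k x h - D l x h) \<le> 20 * A / s * norm h" if "k \<ge> N" "l \<ge> N" "x \<in> S" for k l x h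
    proof (rule bound[OF \<open>0 < A\<close> _ that(3)])
      fix y assume "y \<in> ball z s"
      then have "dist (f k y) (f l y) < A" using N that dist_triangle_half_l by blast
      then show "norm (f k y - f l y) \<le> A" by (simp add: dist_norm)
    qed
    then show ?thesis using \<open>0 < s\<close> by (intro exI[of _ N]) (simp add: A_def)
  qed
  define g' where "g' x h = lim (\<lambda>k. D k x h)" for x h
  have lim': "(\<lambda>k. D k x h) \<longlonglongrightarrow> g' x h" if x: "x \<in> S" for x h
  proof -
    have "Cauchy (\<lambda>k. D k x h)"
    proof (rule metric_CauchyI)
      fix e :: real assume "0 < e"
      define e' where "e' = e / (norm h + 1)"
      have "0 < e'" using \<open>0 < e\<close> by (simp add: e'_def add_nonneg_pos)
      have "e' * norm h < e"
        using \<open>0 < e\<close> by (simp add: e'_def divide_less_eq add_nonneg_pos)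
      with Cauchy[OF \<open>0 < e'\<close>] x
      show "\<exists>M. \<forall>m\<ge>M. \<forall>n\<ge>M. dist (D m x h) (D n x h) < e" unfolding dist_norm by (meson order_le_less_trans)
    qed
    then show ?thesis by (simp add: g'_def Cauchy_convergent_iff convergent_LIMSEQ_iff)
  qed
  have "\<exists>G. \<forall>x\<in>S. (\<lambda>n. f n x) \<longlonglongrightarrow> G x \<and> (G has_derivative g' x) (at x within S)"
  proof (rule has_derivative_sequence[of S "f" D g' z "g z"])
    show "convex S" "z \<in> S" using \<open>0 < s\<close> by (auto simp: S_def)
    show "(f n has_derivative D n x) (at x within S)" if "x \<in> S" for n x
      using D(1) S[OF that] has_derivative_at_withinI by blast
    show "(\<lambda>n. f n z) \<longlonglongrightarrow> g z"
      using lim \<open>0 < s\<close> tendsto_uniform_limitI by fastforce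
    fix e :: real assume "0 < e"
    from Cauchy[OF this] obtain N
      where N: "\<And>k l x h. k \<ge> N \<Longrightarrow> l \<ge> N \<Longrightarrow> x \<in> S \<Longrightarrow> norm (D k x h - D l x h) \<le> e * norm h" by blast
    have "norm (D n x h - g' x h) \<le> e * norm h" if "n \<ge> N" "x \<in> S" for n x h
    proof (rule Lim_norm_ubound)
      show "(\<lambda>l. D n x h - D l x h) \<longlonglongrightarrow> D n x h - g' x h"
        using lim'[OF that(2)] by (intro tendsto_intros)
      show "\<forall>\<^sub>F l in sequentially. norm (D n x h - D l x h) \<le> e * norm h"
        unfolding eventually_sequentially using N[OF that(1) _ that(2)] by blast
    qed simp
    then show "\<forall>\<^sub>F n in sequentially. \<forall>x\<in>S. \<forall>h. norm (D n x h - g' x h) \<le> e * norm h"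
      unfolding eventually_sequentially by blast
  qed
  moreover have "z \<in> S" using \<open>0 < s\<close> by (simp add: S_def)
  ultimately obtain G where G: "\<And>x. x \<in> S \<Longrightarrow> (\<lambda>n. f n x) \<longlonglongrightarrow> G x" "(G has_derivative g' z) (at z within S)"
    by blast
  have "G x = g x" if "x \<in> S" for x
    using G(1)[OF that] tendsto_uniform_limitI[OF lim S[OF that]] LIMSEQ_unique by blast
  moreover have "(G has_derivative g' z) (at z)"
    using G(2) \<open>0 < s\<close> by (simp add: S_def at_within_open[of z "ball z (s/2)"])
  ultimately have "(g has_derivative g' z) (at z)"
    using has_derivative_transform_within_open[of G "g' z" z UNIV S g] \<open>0 < s\<close> by (simp add: S_def)
  moreover have "g' z (c *s v) = c * g' z v" for c v
  proof -
    have z: "z \<in> S" "z \<in> ball z s" using \<open>0 < s\<close> by (auto simp: S_def)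
    have "(\<lambda>k. c * D k z v) \<longlonglongrightarrow> c * g' z v"
      by (intro tendsto_intros lim' z)
    moreover have "(\<lambda>k. c * D k z v) \<longlonglongrightarrow> g' z (c *s v)"
      using lim'[OF z(1), of "c *s v"] D(2)[OF z(2)] by simp
    ultimately show ?thesis using LIMSEQ_unique by blast
  qed
  ultimately show ?thesis by blast
qed

lemma uniform_limit_of_pointwise_equi_Lipschitz:
  fixes f :: "nat \<Rightarrow> 'a :: metric_space \<Rightarrow> 'b :: metric_space"
  assumes "compact S" and lip: "\<And>k x y. x \<in> S \<Longrightarrow> y \<in> S \<Longrightarrow> dist (f k x) (f k y) \<le> L * dist x y"
    and lim: "\<And>x. x \<in> S \<Longrightarrow> (\<lambda>k. f k x) \<longlonglongrightarrow> g x"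
  shows "uniform_limit S f g sequentially"
proof (rule uniform_limitI)
  fix e :: real assume "0 < e"
  define L' where "L' = max L 0 + 1"
  have "L' > 0" by (simp add: L'_def)
  have lip': "dist (f k x) (f k y) \<le> L' * dist x y" if "x \<in> S" "y \<in> S" for k x y
  proof -
    have "L * dist x y \<le> L' * dist x y" by (intro mult_right_mono) (auto simp: L'_def)
    with lip[OF that, of k] show ?thesis by linarith
  qed
  have glip: "dist (g x) (g y) \<le> L' * dist x y" if "x \<in> S" "y \<in> S" for x y
    using tendsto_dist[OF lim[OF that(1)] lim[OF that(2)]] lip'[OF that]
    by (rule_tac LIMSEQ_le_const2) auto
  define d where "d = e / (4 * L')"
  have "d > 0" using \<open>0 < e\<close> \<open>0 < L'\<close> by (simp add: d_def)
  then obtain T where T: "finite T" "T \<subseteq> S" "S \<subseteq> (\<Union>x\<in>T. ball x d)"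
    using compact_imp_seq_compact[OF \<open>compact S\<close>] seq_compact_imp_totally_bounded by metis
  have "\<forall>\<^sub>F k in sequentially. \<forall>t\<in>T. dist (f k t) (g t) < e / 2"
    using T lim \<open>0 < e\<close> by (intro eventually_ball_finite ballI tendstoD) auto
  then show "\<forall>\<^sub>F k in sequentially. \<forall>x\<in>S. dist (f k x) (g x) < e"
  proof eventually_elim
    case (elim k)
    show ?case
    proof
      fix x assume x: "x \<in> S"
      then obtain t where t: "t \<in> T" "x \<in> ball t d" using T(3) by blast
      then have t: "t \<in> T" "dist t x < d" "t \<in> S" using T(2) by auto
      have "L' * dist t x < e / 4" using t(2) \<open>0 < L'\<close> by (simp add: d_def field_simps)
      moreover have "dist (f k x) (g x) \<le> dist (f k x) (f k t) + dist (f k t) (g t) + dist (g t) (g x)"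
        by (meson dist_triangle dist_triangle_le order_trans add_mono order_refl)
      ultimately show "dist (f k x) (g x) < e"
        using lip'[OF x t(3), of k] glip[OF t(3) x] elim t(1) by (force simp: dist_commute)
    qed
  qed
qed

section \<open>Local estimates, normal families and lower semicontinuity in the p-Bergman space\<close>

text \<open>
  The \<open>p\<close>-th power of the norm. It has the same minimizers, and as an integral it inherits
  pointwise inequalities.
\<close>

definition p_energy :: "real \<Rightarrow> (complex ^ 'n) set \<Rightarrow> (complex ^ 'n \<Rightarrow> complex) \<Rightarrow> real" where
  "p_energy p \<Omega> f = (LINT \<zeta>:\<Omega>|lborel. norm (f \<zeta>) powr p)"

lemma p_norm_eq: "p_norm p \<Omega> f = p_energy p \<Omega> f powr (1 / p)"
  by (simp add: p_norm_def p_energy_def)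

lemma p_energy_nonneg: "0 \<le> p_energy p \<Omega> f"
  unfolding p_energy_def set_lebesgue_integral_def by (intro integral_nonneg_AE) (auto simp: indicator_def)

lemma p_bergman_spaceD:
  assumes "f \<in> p_bergman_space p \<Omega>"
  shows "holomorphic_several \<Omega> f" "f \<in> extensional \<Omega>"
    "set_integrable lborel \<Omega> (\<lambda>\<zeta>. norm (f \<zeta>) powr p)"
  using assms by (auto simp: p_bergman_space_def)

lemma nn_p_energy:
  assumes "f \<in> p_bergman_space p \<Omega>"
  shows "(\<integral>\<^sup>+\<zeta>\<in>\<Omega>. ennreal (norm (f \<zeta>) powr p) \<partial>lborel) = ennreal (p_energy p \<Omega> f)"
proof -
  have "(\<integral>\<^sup>+\<zeta>\<in>\<Omega>. ennreal (norm (f \<zeta>) powr p) \<partial>lborel)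
      = (\<integral>\<^sup>+\<zeta>. ennreal (indicator \<Omega> \<zeta> *\<^sub>R norm (f \<zeta>) powr p) \<partial>lborel)"
    by (intro nn_integral_cong) (auto simp: indicator_def)
  also have "\<dots> = ennreal (p_energy p \<Omega> f)"
    unfolding p_energy_def set_lebesgue_integral_def
    using p_bergman_spaceD(3)[OF assms] unfolding set_integrable_def
    by (intro nn_integral_eq_integral) auto
  finally show ?thesis .
qed

text \<open>
  Replaces Hoelder's inequality when a mean value inequality in \<open>L\<^sup>1\<close> is turned into one in
  \<open>L\<^sup>p\<close>. The choice \<open>t = 1\<close> gives upper bounds, \<open>t = 1/2\<close> a lower bound for the energy of a
  function that takes the value \<open>1\<close>.
\<close>

lemma le_threshold_plus_powr:
  fixes a t p :: real
  assumes "0 \<le> a" "0 < t" "1 \<le> p"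
  shows "a \<le> t + t powr (1 - p) * a powr p"
proof (cases "a \<le> t")
  case False
  have "a = t powr (1 - p) * t powr (p - 1) * a" using assms by (simp flip: powr_add)
  also have "\<dots> \<le> t powr (1 - p) * a powr (p - 1) * a"
    using assms False by (intro mult_right_mono mult_left_mono powr_mono2) auto
  also have "\<dots> = t powr (1 - p) * a powr p"
    using assms False powr_add[of a "p - 1" 1] by simp
  finally show ?thesis using assms by linarith
qed (use assms in \<open>simp add: add_increasing2\<close>)

lemma p_mean_value_inequality:
  fixes z :: "complex ^ 'n"
  assumes f: "f \<in> p_bergman_space p \<Omega>" and sub: "ball z r \<subseteq> \<Omega>" and "1 \<le> p" "0 < t"
  defines "V \<equiv> measure lborel (ball (0 :: complex ^ 'n) r)"
  shows "norm (f z) * V \<le> t * V + t powr (1 - p) * p_energy p \<Omega> f"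
proof -
  have V: "emeasure lborel (ball z r) = ennreal V"
    unfolding V_def emeasure_lborel_ball_translate[of z]
    using emeasure_lborel_ball_finite[of "0 :: complex ^ 'n" r] by (intro emeasure_eq_ennreal_measure) auto
  have "V \<ge> 0" by (simp add: V_def)
  obtain c where c: "norm c = 1" "Im (c * f z) = norm (f z)"
  proof (cases "f z = 0")
    case False
    then show ?thesis
      by (intro that[of "\<i> * of_real (norm (f z)) / f z"]) (auto simp: norm_divide norm_mult)
  qed (auto intro: that[of 1])
  have meas: "(\<lambda>x. ennreal (norm (f x) powr p) * indicator \<Omega> x) \<in> borel_measurable lborel"
  proof -
    have "(\<lambda>x. indicator \<Omega> x *\<^sub>R norm (f x) powr p) \<in> borel_measurable lborel"
      using p_bergman_spaceD(3)[OF f] unfolding set_integrable_def by (rule borel_measurable_integrable)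
    then have "(\<lambda>x. ennreal (indicator \<Omega> x *\<^sub>R norm (f x) powr p)) \<in> borel_measurable lborel" by measurable
    then show ?thesis by (rule measurable_cong[THEN iffD1, rotated]) (auto simp: indicator_def)
  qed
  have [measurable]: "ball z r \<in> sets borel" by simp
  have measball: "(\<lambda>x. ennreal t * indicator (ball z r) x) \<in> borel_measurable borel" by measurable
  have "holomorphic_several (ball z r) (\<lambda>x. c * f x)"
    by (intro holomorphic_several_mult holomorphic_several_const
        holomorphic_several_subset[OF p_bergman_spaceD(1)[OF f] sub])
  from abs_Im_ball_submean[OF this]
  have "ennreal (norm (f z)) * ennreal V \<le> (\<integral>\<^sup>+x\<in>ball z r. ennreal \<bar>Im (c * f x)\<bar> \<partial>lborel)"
    using V c by simp
  also have "\<dots> \<le> (\<integral>\<^sup>+x. ennreal t * indicator (ball z r) x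
      + ennreal (t powr (1 - p)) * (ennreal (norm (f x) powr p) * indicator \<Omega> x) \<partial>lborel)"
  proof (rule nn_integral_mono)
    fix x
    have "\<bar>Im (c * f x)\<bar> \<le> norm (f x)"
      using abs_Im_le_cmod[of "c * f x"] c by (simp add: norm_mult)
    also have "\<dots> \<le> t + t powr (1 - p) * norm (f x) powr p"
      using le_threshold_plus_powr[OF norm_ge_zero \<open>0 < t\<close> \<open>1 \<le> p\<close>] .
    finally have "ennreal \<bar>Im (c * f x)\<bar> \<le> ennreal t + ennreal (t powr (1 - p)) * ennreal (norm (f x) powr p)"
      using \<open>0 < t\<close> by (simp add: ennreal_leI flip: ennreal_mult ennreal_plus)
    then show "ennreal \<bar>Im (c * f x)\<bar> * indicator (ball z r) x \<le> ennreal t * indicator (ball z r) x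
      + ennreal (t powr (1 - p)) * (ennreal (norm (f x) powr p) * indicator \<Omega> x)"
      using sub by (cases "x \<in> ball z r") auto
  qed
  also have "\<dots> = ennreal t * ennreal V + ennreal (t powr (1 - p)) * ennreal (p_energy p \<Omega> f)"
    using meas V nn_p_energy[OF f]
    by (subst nn_integral_add)
       (auto simp: nn_integral_cmult nn_integral_cmult_indicator intro: measball)
  finally have "ennreal (norm (f z) * V) \<le> ennreal (t * V + t powr (1 - p) * p_energy p \<Omega> f)"
    using \<open>0 < t\<close> \<open>V \<ge> 0\<close> p_energy_nonneg[of p \<Omega> f] by (simp add: ennreal_mult)
  then show ?thesis
    using \<open>0 < t\<close> \<open>V \<ge> 0\<close> p_energy_nonneg[of p \<Omega> f] by (subst (asm) ennreal_le_iff) auto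
qed

lemma measure_ball_0_pos: "0 < r \<Longrightarrow> 0 < measure lborel (ball (0 :: 'a :: euclidean_space) r)"
  using content_ball_pos[of r "0::'a"] by simp

lemma p_bergman_bounded:
  fixes z :: "complex ^ 'n"
  assumes "f \<in> p_bergman_space p \<Omega>" "ball z r \<subseteq> \<Omega>" "1 \<le> p" "0 < r" "p_energy p \<Omega> f \<le> B"
  shows "norm (f z) \<le> 1 + B / measure lborel (ball (0 :: complex ^ 'n) r)"
proof -
  define V where "V = measure lborel (ball (0 :: complex ^ 'n) r)"
  have "V > 0" using measure_ball_0_pos[OF \<open>0 < r\<close>] by (simp add: V_def)
  have "norm (f z) * V \<le> V + B"
    using p_mean_value_inequality[OF assms(1,2,3), of 1] assms(5) by (simp add: V_def)
  with \<open>V > 0\<close> show ?thesis by (simp add: V_def[symmetric] field_simps)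
qed

lemma p_energy_lower_bound:
  fixes w :: "complex ^ 'n"
  assumes "f \<in> p_bergman_space p \<Omega>" "ball w r \<subseteq> \<Omega>" "1 \<le> p" "f w = 1"
  shows "measure lborel (ball (0 :: complex ^ 'n) r) / 2 powr p \<le> p_energy p \<Omega> f"
proof -
  define V where "V = measure lborel (ball (0 :: complex ^ 'n) r)"
  have "V \<le> V / 2 + (1 / 2) powr (1 - p) * p_energy p \<Omega> f"
    using p_mean_value_inequality[OF assms(1,2,3), of "1 / 2"] assms(4) by (simp add: V_def)
  moreover have "(1 / 2) powr (1 - p) = 2 powr p / 2"
    by (simp add: powr_divide powr_diff)
  ultimately show ?thesis by (simp add: V_def[symmetric] field_simps)
qed

lemma p_bergman_Lipschitz:
  fixes z :: "complex ^ 'n"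
  assumes f: "f \<in> p_bergman_space p \<Omega>" and sub: "ball z r \<subseteq> \<Omega>" and "1 \<le> p" "0 < r"
    and B: "p_energy p \<Omega> f \<le> B" and x: "x \<in> ball z (r / 4)"
  shows "norm (f x - f z) \<le> 20 * (1 + B / measure lborel (ball (0 :: complex ^ 'n) (r / 2))) / r * norm (x - z)"
proof -
  define V where "V = measure lborel (ball (0 :: complex ^ 'n) (r / 2))"
  have "V > 0" using measure_ball_0_pos[of "r / 2"] \<open>0 < r\<close> by (simp add: V_def)
  define A where "A = 1 + B / V"
  have "B \<ge> 0" using B p_energy_nonneg[of p \<Omega> f] by linarith
  then have "A > 0" using \<open>V > 0\<close> by (simp add: A_def add_pos_nonneg)
  have "ball z (r / 2) \<subseteq> \<Omega>" using sub \<open>0 < r\<close> subset_ball[of "r / 2" r z] by simp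
  then have hol: "holomorphic_several (ball z (r / 2)) f"
    using p_bergman_spaceD(1)[OF f] holomorphic_several_subset by blast
  have "\<bar>Im (f y)\<bar> \<le> A" if "y \<in> ball z (r / 2)" for y
  proof -
    have "ball y (r / 2) \<subseteq> ball z r" using that by (simp add: ball_subset_ball_iff dist_commute)
    then have "norm (f y) \<le> A"
      using p_bergman_bounded[OF f _ \<open>1 \<le> p\<close> _ B, of y "r / 2"] sub \<open>0 < r\<close> by (simp add: A_def V_def)
    then show ?thesis using abs_Im_le_cmod[of "f y"] by linarith
  qed
  from Im_bounded_holomorphic_several_increment[OF hol \<open>A > 0\<close> this, of x]
  show ?thesis using x by (simp add: A_def V_def)
qed

lemma p_bergman_local_Lipschitz:
  fixes z :: "complex ^ 'n"
  assumes f: "f \<in> p_bergman_space p \<Omega>" and sub: "ball z r \<subseteq> \<Omega>" and "1 \<le> p" "0 < r"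
    and B: "p_energy p \<Omega> f \<le> B" and x: "x \<in> ball z (r / 16)" and y: "y \<in> ball z (r / 16)"
  shows "norm (f x - f y) \<le> 40 * (1 + B / measure lborel (ball (0 :: complex ^ 'n) (r / 4))) / r * norm (x - y)"
proof -
  have "ball y (r / 2) \<subseteq> ball z r" using y \<open>0 < r\<close> by (simp add: ball_subset_ball_iff dist_commute)
  moreover have "dist y x < r / 8"
    using dist_triangle_less_add[of y z "r/16" x "r/16"] x y by (simp add: dist_commute)
  ultimately show ?thesis
    using p_bergman_Lipschitz[OF f _ \<open>1 \<le> p\<close> _ B, of y "r / 2" x] sub \<open>0 < r\<close> by simp
qed

text \<open>
  Bounded energy gives bounds at each point and Lipschitz bounds near each point. A diagonal
  subsequence converges on a countable dense set; by the Lipschitz bounds it converges everywhere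
  and locally uniformly.
\<close>

lemma p_bergman_Montel:
  fixes \<Omega> :: "(complex ^ 'n) set"
  assumes "open \<Omega>" "1 \<le> p" and f: "\<And>k. f k \<in> p_bergman_space p \<Omega>" and B: "\<And>k. p_energy p \<Omega> (f k) \<le> B"
  obtains r g where "strict_mono (r :: nat \<Rightarrow> nat)" "holomorphic_several \<Omega> g"
    "\<And>z. z \<in> \<Omega> \<Longrightarrow> \<exists>s>0. cball z s \<subseteq> \<Omega> \<and> uniform_limit (cball z s) (\<lambda>k. f (r k)) g sequentially"
proof -
  obtain D :: "(complex ^ 'n) set" where D: "countable D" "\<And>U. open U \<Longrightarrow> U \<noteq> {} \<Longrightarrow> \<exists>d\<in>D. d \<in> U"
    using countable_dense_exists[where 'a = "complex ^ 'n"] by blast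
  have "\<exists>b>0. \<forall>k. norm (f k x) \<le> b" if "x \<in> \<Omega>" for x
  proof -
    obtain s where s: "s > 0" "ball x s \<subseteq> \<Omega>" by (rule openE[OF \<open>open \<Omega>\<close> \<open>_ \<in> \<Omega>\<close>])
    have "norm (f k x) \<le> max 1 (1 + B / measure lborel (ball (0 :: complex ^ 'n) s))" for k
      using p_bergman_bounded[OF f s(2) \<open>1 \<le> p\<close> s(1) B, of k] by simp
    then show ?thesis by (intro exI[of _ "max 1 (1 + B / measure lborel (ball (0 :: complex ^ 'n) s))"]) auto
  qed
  then obtain b where b: "\<And>x. x \<in> \<Omega> \<Longrightarrow> b x > 0" "\<And>x k. x \<in> \<Omega> \<Longrightarrow> norm (f k x) \<le> b x" by metis
  \<comment> \<open>dividing by the bound \<open>b x\<close> makes the family uniformly bounded on the dense set\<close>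
  have "\<exists>r. strict_mono (r :: nat \<Rightarrow> nat) \<and> (\<forall>x\<in>D \<inter> \<Omega>. \<exists>l. (\<lambda>k. f (r k) x / of_real (b x)) \<longlonglongrightarrow> l)"
  proof (rule function_convergent_subsequence[of "D \<inter> \<Omega>" "\<lambda>k x. f k x / of_real (b x)" 1])
    show "countable (D \<inter> \<Omega>)" using D by blast
    show "norm (f n x / of_real (b x)) \<le> 1" if "x \<in> D \<inter> \<Omega>" for n x
      using b[of x] that by (simp add: norm_divide)
  qed auto
  then obtain r where r: "strict_mono r"
    and "\<forall>x\<in>D \<inter> \<Omega>. \<exists>l. (\<lambda>k. f (r k) x / of_real (b x)) \<longlonglongrightarrow> l" by blast
  have convD: "Cauchy (\<lambda>k. f (r k) x)" if x: "x \<in> D \<inter> \<Omega>" for x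
  proof -
    obtain l where "(\<lambda>k. f (r k) x / of_real (b x)) \<longlonglongrightarrow> l"
      using x \<open>\<forall>x\<in>D \<inter> \<Omega>. _ x\<close> by blast
    then have "(\<lambda>k. f (r k) x / of_real (b x) * of_real (b x)) \<longlonglongrightarrow> l * of_real (b x)"
      by (intro tendsto_intros)
    then have "(\<lambda>k. f (r k) x) \<longlonglongrightarrow> l * of_real (b x)" using b(1)[of x] x by simp
    then show ?thesis by (simp add: LIMSEQ_imp_Cauchy)
  qed
  have "\<exists>s L. s > 0 \<and> ball z s \<subseteq> \<Omega> \<and> L > 0 \<and> (\<forall>k. \<forall>x\<in>ball z s. \<forall>y\<in>ball z s. norm (f k x - f k y) \<le> L * norm (x - y))"
    if "z \<in> \<Omega>" for z
  proof -
    obtain s where s: "s > 0" "ball z s \<subseteq> \<Omega>" by (rule openE[OF \<open>open \<Omega>\<close> \<open>_ \<in> \<Omega>\<close>])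
    define L where "L = 40 * (1 + B / measure lborel (ball (0 :: complex ^ 'n) (s / 4))) / s"
    have "B \<ge> 0" using B[of 0] p_energy_nonneg[of p \<Omega> "f 0"] by linarith
    then have "L > 0" using s measure_ball_0_pos[of "s / 4", where 'a = "complex ^ 'n"]
      by (simp add: L_def add_pos_nonneg)
    moreover have "ball z (s / 16) \<subseteq> \<Omega>" using s by auto
    ultimately show ?thesis
      using p_bergman_local_Lipschitz[OF f s(2) \<open>1 \<le> p\<close> s(1) B] s(1)
      by (intro exI[of _ "s / 16"] exI[of _ L]) (auto simp: L_def)
  qed
  then obtain s L where s: "\<And>z. z \<in> \<Omega> \<Longrightarrow> s z > 0" "\<And>z. z \<in> \<Omega> \<Longrightarrow> ball z (s z) \<subseteq> \<Omega>"
    "\<And>z. z \<in> \<Omega> \<Longrightarrow> L z > 0"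
    and L: "\<And>z k x y. z \<in> \<Omega> \<Longrightarrow> x \<in> ball z (s z) \<Longrightarrow> y \<in> ball z (s z) \<Longrightarrow> norm (f k x - f k y) \<le> L z * norm (x - y)"
    by metis
  have "convergent (\<lambda>k. f (r k) z)" if z: "z \<in> \<Omega>" for z
  proof (rule Cauchy_convergent, rule metric_CauchyI)
    fix e :: real assume "0 < e"
    define d where "d = min (s z) (e / (4 * L z))"
    have "d > 0" using s[OF z] \<open>0 < e\<close> by (simp add: d_def)
    then obtain x where x: "x \<in> D" "x \<in> ball z d" using D(2)[of "ball z d"] by auto
    then have "x \<in> ball z (s z)" by (simp add: d_def)
    then have "x \<in> D \<inter> \<Omega>" using x s[OF z] by blast
    from metric_CauchyD[OF convD[OF this], of "e / 2"] obtain M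
      where M: "\<And>m n. m \<ge> M \<Longrightarrow> n \<ge> M \<Longrightarrow> dist (f (r m) x) (f (r n) x) < e / 2" using \<open>0 < e\<close> by auto
    have near: "dist (f k z) (f k x) < e / 4" for k
    proof -
      have "dist (f k z) (f k x) \<le> L z * dist z x"
        using L[OF z _ \<open>x \<in> ball z (s z)\<close>, of z k] s(1)[OF z] by (simp add: dist_norm)
      also have "\<dots> < L z * (e / (4 * L z))"
        using x(2) s(3)[OF z] by (intro mult_strict_left_mono) (auto simp: d_def)
      finally show ?thesis using s(3)[OF z] by simp
    qed
    have "dist (f (r m) z) (f (r n) z) < e" if "m \<ge> M" "n \<ge> M" for m n
      using M[OF that] near[of "r m"] near[of "r n"]
        dist_triangle[of "f (r m) z" "f (r n) z" "f (r m) x"] dist_triangle[of "f (r m) x" "f (r n) z" "f (r n) x"]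
      by (simp add: dist_commute)
    then show "\<exists>M. \<forall>m\<ge>M. \<forall>n\<ge>M. dist (f (r m) z) (f (r n) z) < e" by blast
  qed
  define g where "g z = lim (\<lambda>k. f (r k) z)" for z
  have lim: "(\<lambda>k. f (r k) z) \<longlonglongrightarrow> g z" if "z \<in> \<Omega>" for z
    using \<open>z \<in> \<Omega> \<Longrightarrow> convergent _\<close>[OF that] by (simp add: g_def convergent_LIMSEQ_iff)
  have unif: "uniform_limit (cball z (s z / 2)) (\<lambda>k. f (r k)) g sequentially" if z: "z \<in> \<Omega>" for z
  proof (rule uniform_limit_of_pointwise_equi_Lipschitz)
    have in_ball: "x \<in> ball z (s z)" if "x \<in> cball z (s z / 2)" for x
      using that s(1)[OF z] by simp
    show "dist (f (r k) x) (f (r k) y) \<le> L z * dist x y"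
      if "x \<in> cball z (s z / 2)" "y \<in> cball z (s z / 2)" for k x y
      using L[OF z in_ball[OF that(1)] in_ball[OF that(2)]] by (simp add: dist_norm)
    show "(\<lambda>k. f (r k) x) \<longlonglongrightarrow> g x" if "x \<in> cball z (s z / 2)" for x
      using lim in_ball[OF that] s(2)[OF z] by blast
  qed simp
  have "holomorphic_several \<Omega> g"
    unfolding holomorphic_several_def
  proof
    fix z assume z: "z \<in> \<Omega>"
    have sub: "ball z (s z / 2) \<subseteq> ball z (s z)" using s(1)[OF z] by auto
    show "\<exists>D. (g has_derivative D) (at z) \<and> (\<forall>c v. D (c *s v) = c * D v)"
    proof (rule complex_linear_derivative_of_uniform_limit)
      show "holomorphic_several (ball z (s z / 2)) (f (r k))" for k
        using p_bergman_spaceD(1)[OF f] sub s(2)[OF z] by (meson holomorphic_several_subset order_trans)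
      show "uniform_limit (ball z (s z / 2)) (\<lambda>k. f (r k)) g sequentially"
        using unif[OF z] by (rule uniform_limit_on_subset) auto
    qed (use s(1)[OF z] in simp)
  qed
  moreover have "\<exists>s>0. cball z s \<subseteq> \<Omega> \<and> uniform_limit (cball z s) (\<lambda>k. f (r k)) g sequentially" if z: "z \<in> \<Omega>" for z
  proof -
    have "cball z (s z / 2) \<subseteq> ball z (s z)" using s(1)[OF z] by auto
    then show ?thesis using s(1,2)[OF z] unif[OF z] by (intro exI[of _ "s z / 2"]) auto
  qed
  ultimately show ?thesis using r that by blast
qed

lemma p_bergman_Fatou:
  fixes \<Omega> :: "(complex ^ 'n) set"
  assumes "open \<Omega>" "1 \<le> p" and f: "\<And>k. f k \<in> p_bergman_space p \<Omega>" and J: "(\<lambda>k. p_energy p \<Omega> (f k)) \<longlonglongrightarrow> J"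
    and g: "holomorphic_several \<Omega> g" and lim: "\<And>x. x \<in> \<Omega> \<Longrightarrow> (\<lambda>k. f k x) \<longlonglongrightarrow> g x"
  shows "restrict g \<Omega> \<in> p_bergman_space p \<Omega>" "p_energy p \<Omega> (restrict g \<Omega>) \<le> J"
proof -
  define u where "u = (\<lambda>x. indicator \<Omega> x *\<^sub>R norm (g x) powr p)"
  have meas: "(\<lambda>x. indicator \<Omega> x *\<^sub>R norm (h x) powr p) \<in> borel_measurable lborel"
    if "holomorphic_several \<Omega> h" for h
  proof -
    have "continuous_on \<Omega> (\<lambda>x. norm (h x) powr p)"
      using \<open>1 \<le> p\<close> holomorphic_several_continuous_on[OF that]
      by (intro continuous_on_powr' continuous_intros) auto
    then show ?thesis
      using borel_measurable_continuous_on_indicator[of \<Omega> "\<lambda>x. norm (h x) powr p"] \<open>open \<Omega>\<close> by simp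
  qed
  have [measurable]: "u \<in> borel_measurable lborel" unfolding u_def by (rule meas[OF g])
  have [measurable]: "(\<lambda>x. indicator \<Omega> x *\<^sub>R norm (f k x) powr p) \<in> borel_measurable lborel" for k
    by (rule meas[OF p_bergman_spaceD(1)[OF f]])
  have J0: "J \<ge> 0" using J p_energy_nonneg by (metis LIMSEQ_le_const)
  have "(\<integral>\<^sup>+x. ennreal (u x) \<partial>lborel)
      = (\<integral>\<^sup>+x. liminf (\<lambda>k. ennreal (indicator \<Omega> x *\<^sub>R norm (f k x) powr p)) \<partial>lborel)"
  proof (rule nn_integral_cong)
    fix x
    have "(\<lambda>k. ennreal (indicator \<Omega> x *\<^sub>R norm (f k x) powr p)) \<longlonglongrightarrow> ennreal (u x)"
      unfolding u_def using lim[of x] \<open>1 \<le> p\<close>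
      by (cases "x \<in> \<Omega>") (auto intro!: tendsto_intros tendsto_powr')
    then show "ennreal (u x) = liminf (\<lambda>k. ennreal (indicator \<Omega> x *\<^sub>R norm (f k x) powr p))"
      by (intro lim_imp_Liminf[symmetric]) auto
  qed
  also have "\<dots> \<le> liminf (\<lambda>k. \<integral>\<^sup>+x. ennreal (indicator \<Omega> x *\<^sub>R norm (f k x) powr p) \<partial>lborel)"
    by (rule nn_integral_liminf) measurable
  also have "\<dots> = liminf (\<lambda>k. ennreal (p_energy p \<Omega> (f k)))"
  proof -
    have "(\<integral>\<^sup>+x. ennreal (indicator \<Omega> x *\<^sub>R norm (f k x) powr p) \<partial>lborel) = ennreal (p_energy p \<Omega> (f k))" for k
      unfolding nn_p_energy[OF f, symmetric] by (intro nn_integral_cong) (auto simp: indicator_def)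
    then show ?thesis by simp
  qed
  also have "\<dots> = ennreal J"
    using J by (intro lim_imp_Liminf tendsto_ennrealI) auto
  finally have le: "(\<integral>\<^sup>+x. ennreal (u x) \<partial>lborel) \<le> ennreal J" .
  have u0: "u x \<ge> 0" for x by (simp add: u_def)
  have int: "integrable lborel u"
    using u0 order_le_less_trans[OF le] by (intro integrableI_nonneg) auto
  have eq: "(\<lambda>x. indicator \<Omega> x *\<^sub>R norm (restrict g \<Omega> x) powr p) = u"
    by (auto simp: u_def fun_eq_iff indicator_def)
  have "holomorphic_several \<Omega> (restrict g \<Omega>)"
    by (rule holomorphic_several_cong[OF \<open>open \<Omega>\<close> _ g]) simp
  moreover have "set_integrable lborel \<Omega> (\<lambda>x. norm (restrict g \<Omega> x) powr p)"
    unfolding set_integrable_def eq by (rule int)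
  ultimately show "restrict g \<Omega> \<in> p_bergman_space p \<Omega>"
    unfolding p_bergman_space_def by blast
  have "ennreal (integral\<^sup>L lborel u) \<le> ennreal J"
    using le nn_integral_eq_integral[OF int] u0 by simp
  then show "p_energy p \<Omega> (restrict g \<Omega>) \<le> J"
    using J0 unfolding p_energy_def set_lebesgue_integral_def eq by (subst (asm) ennreal_le_iff)
qed

(* Left undistributed, the norm of a scaled difference can be computed as a product. *)
declare vector_ssub_ldistrib [simp del]

section \<open>Propagation along complex lines\<close>

definition locally_uniform_limit ::
    "(complex ^ 'n) set \<Rightarrow> (nat \<Rightarrow> complex ^ 'n \<Rightarrow> complex) \<Rightarrow> (complex ^ 'n \<Rightarrow> complex) \<Rightarrow> bool" where
  "locally_uniform_limit \<Omega> F f \<longleftrightarrow>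
     (\<forall>z\<in>\<Omega>. \<exists>s>0. cball z s \<subseteq> \<Omega> \<and> uniform_limit (cball z s) F f sequentially)"

lemma locally_uniform_limit_nonzero:
  assumes lim: "locally_uniform_limit \<Omega> F f" and cont: "continuous_on \<Omega> f" and y: "y \<in> \<Omega>" "f y \<noteq> 0"
  obtains s where "s > 0" "ball y s \<subseteq> \<Omega>"
    "\<forall>\<^sub>F k in sequentially. \<forall>x\<in>ball y s. norm (f y) / 4 \<le> norm (F k x) \<and> norm (F k x) \<le> 2 * norm (f y)"
proof -
  obtain r where r: "r > 0" "cball y r \<subseteq> \<Omega>" "uniform_limit (cball y r) F f sequentially"
    using lim y unfolding locally_uniform_limit_def by blast
  define c where "c = norm (f y) / 4"
  have "c > 0" using y by (simp add: c_def)
  obtain d where d: "d > 0" "\<And>x. x \<in> \<Omega> \<Longrightarrow> dist x y < d \<Longrightarrow> dist (f x) (f y) < c"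
    using cont[unfolded continuous_on_iff, rule_format, OF y(1) \<open>c > 0\<close>] by blast
  define s where "s = min r d"
  have "\<forall>\<^sub>F k in sequentially. \<forall>x\<in>cball y r. dist (F k x) (f x) < c"
    using r(3) \<open>c > 0\<close> by (rule uniform_limitD)
  then have "\<forall>\<^sub>F k in sequentially. \<forall>x\<in>ball y s. norm (f y) / 4 \<le> norm (F k x) \<and> norm (F k x) \<le> 2 * norm (f y)"
  proof eventually_elim
    case (elim k)
    show ?case
    proof
      fix x assume x: "x \<in> ball y s"
      then have "x \<in> cball y r" "dist x y < d" by (auto simp: s_def dist_commute)
      with elim d r have "dist (F k x) (f x) < c" "dist (f x) (f y) < c" by auto
      then have "dist (F k x) (f y) < 2 * c" using dist_triangle[of "F k x" "f y" "f x"] by linarith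
      then have "norm (F k x - f y) < norm (f y) / 2" by (simp add: dist_norm c_def)
      with norm_triangle_ineq2[of "F k x" "f y"] norm_triangle_ineq2[of "f y" "F k x"]
        norm_minus_commute[of "F k x" "f y"]
      show "norm (f y) / 4 \<le> norm (F k x) \<and> norm (F k x) \<le> 2 * norm (f y)"
        using norm_ge_zero[of "f y"] by arith
    qed
  qed
  moreover have "ball y s \<subseteq> cball y r" by (auto simp: s_def)
  ultimately show ?thesis using r d that[of s] by (simp add: s_def)
qed

lemma countable_zeros_on_complex_disc:
  assumes f: "holomorphic_several \<Omega> f" and sub: "\<And>\<zeta>. \<zeta> \<in> ball 0 R \<Longrightarrow> a + \<zeta> *s v \<in> \<Omega>"
    and nz: "\<zeta>\<^sub>0 \<in> ball 0 R" "f (a + \<zeta>\<^sub>0 *s v) \<noteq> 0"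
  shows "countable {\<zeta> \<in> ball 0 R. f (a + \<zeta> *s v) = 0}"
proof (cases "(\<lambda>\<zeta>. f (a + \<zeta> *s v)) constant_on ball 0 R")
  case True
  then have "{\<zeta> \<in> ball 0 R. f (a + \<zeta> *s v) = 0} = {}"
    using nz unfolding constant_on_def by force
  then show ?thesis by (simp only: countable_empty)
next
  case False
  have "(\<lambda>\<zeta>. f (a + \<zeta> *s v)) holomorphic_on ball 0 R"
    by (rule holomorphic_on_subset[OF holomorphic_on_complex_line[OF f]]) (use sub in auto)
  moreover have "fsigma (ball (0::complex) R)"
  proof -
    obtain C :: "nat \<Rightarrow> complex set" where "\<And>n. compact (C n)" "\<Union>(range C) = ball 0 R"
      by (rule open_Union_compact_subsets[OF open_ball]) blast
    then show ?thesis unfolding fsigma_Union_compact by blast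
  qed
  ultimately show ?thesis
    using False by (intro holomorphic_countable_zeros) auto
qed

text \<open>
  The moduli of the countably many zeros cannot exhaust an interval of radii.
\<close>

lemma nonzero_on_small_circle:
  fixes a v :: "complex ^ 'n"
  assumes f: "holomorphic_several \<Omega> f" and sub: "\<And>\<zeta>. \<zeta> \<in> ball 0 R \<Longrightarrow> a + \<zeta> *s v \<in> \<Omega>"
    and nz: "1 < R" "f (a + v) \<noteq> 0" and "0 < \<delta>" "\<delta> \<le> R"
  obtains r where "0 < r" "r < \<delta>" "\<And>\<zeta>. norm \<zeta> = r \<Longrightarrow> f (a + \<zeta> *s v) \<noteq> 0"
proof -
  have "countable (norm ` {\<zeta> \<in> ball 0 R. f (a + \<zeta> *s v) = 0})"
    using countable_zeros_on_complex_disc[OF f sub, of R 1] nz by simp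
  then have "\<not> {0<..<\<delta>} \<subseteq> norm ` {\<zeta> \<in> ball 0 R. f (a + \<zeta> *s v) = 0}"
    using \<open>0 < \<delta>\<close> uncountable_open_interval[of 0 \<delta>] countable_subset by blast
  then obtain r where r: "r \<in> {0<..<\<delta>}" "r \<notin> norm ` {\<zeta> \<in> ball 0 R. f (a + \<zeta> *s v) = 0}"
    by blast
  show ?thesis
  proof (rule that[of r])
    fix \<zeta> :: complex assume "norm \<zeta> = r"
    moreover have "norm \<zeta> < R" using calculation r(1) \<open>\<delta> \<le> R\<close> by simp
    ultimately show "f (a + \<zeta> *s v) \<noteq> 0" using r(2) by (auto simp: image_iff)
  qed (use r in auto)
qed

text \<open>
  Let \<open>H\<^sub>k\<close> and \<open>F\<^sub>k\<close> be close in ratio at one point \<open>w\<close>, and let the ratio have small oscillation near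
  every point where the limit \<open>f\<close> of \<open>F\<^sub>k\<close> does not vanish. Call a point good if the ratio is
  \<open>1 + O(\<epsilon>\<^sub>k)\<close> there. Goodness is locally constant off the zero set of \<open>f\<close>, and the zeros of \<open>f\<close> on a
  disc in a complex line, unless they fill the disc, are countable and do not disconnect it;
  therefore the set \<open>N\<close> of accumulation points of good points is open and closed in \<open>\<Omega>\<close>, which
  makes it all of \<open>\<Omega>\<close>. Finally, near a zero of \<open>f\<close> the estimate is carried inwards by the maximum
  principle from a small circle on which \<open>f\<close> does not vanish. No power of \<open>\<epsilon>\<^sub>k\<close> is lost on the way.
\<close>

lemma locally_uniform_bound_propagates:
  fixes \<Omega> :: "(complex ^ 'n) set" and \<epsilon> :: "nat \<Rightarrow> real"
  assumes "open \<Omega>" "connected \<Omega>"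
    and F: "\<And>k. holomorphic_several \<Omega> (F k)" and H: "\<And>k. holomorphic_several \<Omega> (H k)"
    and lim: "locally_uniform_limit \<Omega> F f" and f: "holomorphic_several \<Omega> f"
    and osc: "\<And>y. y \<in> \<Omega> \<Longrightarrow> f y \<noteq> 0 \<Longrightarrow> \<exists>s>0. \<exists>C. \<forall>\<^sub>F k in sequentially. \<forall>x\<in>ball y s.
                norm (H k x / F k x - H k y / F k y) \<le> C * \<epsilon> k"
    and w: "w \<in> \<Omega>" "f w \<noteq> 0" and base: "\<forall>\<^sub>F k in sequentially. norm (H k w / F k w - 1) \<le> C\<^sub>0 * \<epsilon> k"
    and \<epsilon>: "\<And>k. 0 < \<epsilon> k" and z: "z \<in> \<Omega>"
  shows "\<exists>s>0. \<exists>C. \<forall>\<^sub>F k in sequentially. \<forall>x\<in>ball z s. norm (F k x - H k x) \<le> C * \<epsilon> k"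
proof -
  define good where "good y \<longleftrightarrow> (\<exists>C. \<forall>\<^sub>F k in sequentially. norm (H k y / F k y - 1) \<le> C * \<epsilon> k)" for y
  have "good w" using base by (auto simp: good_def)
  have cont: "continuous_on \<Omega> f" using f by (rule holomorphic_several_continuous_on)
  have good_locally_const: "\<exists>s>0. \<forall>x\<in>ball y s. good x = good y" if y: "y \<in> \<Omega>" "f y \<noteq> 0" for y
  proof -
    obtain s C where s: "s > 0" and ev: "\<forall>\<^sub>F k in sequentially. \<forall>x\<in>ball y s.
        norm (H k x / F k x - H k y / F k y) \<le> C * \<epsilon> k" using osc[OF y] by blast
    have "good x = good y" if x: "x \<in> ball y s" for x
    proof
      assume "good x"
      then obtain C' where "\<forall>\<^sub>F k in sequentially. norm (H k x / F k x - 1) \<le> C' * \<epsilon> k"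
        unfolding good_def by blast
      with ev have "\<forall>\<^sub>F k in sequentially. norm (H k y / F k y - 1) \<le> (C + C') * \<epsilon> k"
      proof eventually_elim
        case (elim k)
        have "norm (H k y / F k y - 1) \<le> norm (H k x / F k x - H k y / F k y) + norm (H k x / F k x - 1)"
          using norm_triangle_ineq4[of "H k x / F k x - 1" "H k x / F k x - H k y / F k y"] by simp
        also have "\<dots> \<le> C * \<epsilon> k + C' * \<epsilon> k" using elim x by (intro add_mono) auto
        finally show ?case by (simp add: distrib_right)
      qed
      then show "good y" unfolding good_def by blast
    next
      assume "good y"
      then obtain C' where "\<forall>\<^sub>F k in sequentially. norm (H k y / F k y - 1) \<le> C' * \<epsilon> k"
        unfolding good_def by blast
      with ev have "\<forall>\<^sub>F k in sequentially. norm (H k x / F k x - 1) \<le> (C + C') * \<epsilon> k"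
      proof eventually_elim
        case (elim k)
        have "norm (H k x / F k x - 1) \<le> norm (H k x / F k x - H k y / F k y) + norm (H k y / F k y - 1)"
          using norm_triangle_ineq[of "H k x / F k x - H k y / F k y" "H k y / F k y - 1"] by simp
        also have "\<dots> \<le> C * \<epsilon> k + C' * \<epsilon> k" using elim x by (intro add_mono) auto
        finally show ?case by (simp add: distrib_right)
      qed
      then show "good x" unfolding good_def by blast
    qed
    with s show ?thesis by blast
  qed
  have good_on_disc: "good (a + \<zeta>\<^sub>1 *s v)"
    if sub: "\<And>\<zeta>. \<zeta> \<in> ball 0 R \<Longrightarrow> a + \<zeta> *s v \<in> \<Omega>"
      and 0: "\<zeta>\<^sub>0 \<in> ball 0 R" "f (a + \<zeta>\<^sub>0 *s v) \<noteq> 0" "good (a + \<zeta>\<^sub>0 *s v)"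
      and 1: "\<zeta>\<^sub>1 \<in> ball 0 R" "f (a + \<zeta>\<^sub>1 *s v) \<noteq> 0" for a v R \<zeta>\<^sub>0 \<zeta>\<^sub>1
  proof -
    define T where "T = ball 0 R - {\<zeta> \<in> ball 0 R. f (a + \<zeta> *s v) = 0}"
    have "connected T"
      unfolding T_def using countable_zeros_on_complex_disc[OF f sub 0(1,2)]
      by (intro connected_open_diff_countable) auto
    moreover have "\<zeta>\<^sub>0 \<in> T" "\<zeta>\<^sub>1 \<in> T" using 0 1 by (auto simp: T_def)
    moreover have "\<forall>\<zeta>\<in>T. \<forall>\<^sub>F \<xi> in at \<zeta> within T. good (a + \<zeta> *s v) = good (a + \<xi> *s v)"
    proof
      fix \<zeta> assume "\<zeta> \<in> T"
      then have "a + \<zeta> *s v \<in> \<Omega>" "f (a + \<zeta> *s v) \<noteq> 0" using sub by (auto simp: T_def)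
      from good_locally_const[OF this] obtain s where s: "s > 0"
        "\<And>x. x \<in> ball (a + \<zeta> *s v) s \<Longrightarrow> good x = good (a + \<zeta> *s v)" by blast
      have "((\<lambda>\<xi>. a + \<xi> *s v) \<longlongrightarrow> a + \<zeta> *s v) (at \<zeta> within T)"
        by (intro tendsto_intros bounded_linear.tendsto[OF bounded_linear_vector_scalar_mult_left])
      from tendstoD[OF this s(1)]
      show "\<forall>\<^sub>F \<xi> in at \<zeta> within T. good (a + \<zeta> *s v) = good (a + \<xi> *s v)"
        by eventually_elim (use s(2) in \<open>auto simp: dist_commute\<close>)
    qed
    ultimately have "good (a + \<zeta>\<^sub>0 *s v) = good (a + \<zeta>\<^sub>1 *s v)"
      by (rule connected_local_const)
    with 0 show ?thesis by simp
  qed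
  define N where "N = {x \<in> \<Omega>. \<forall>\<rho>>0. \<exists>y\<in>ball x \<rho>. y \<in> \<Omega> \<and> f y \<noteq> 0 \<and> good y}"
  \<comment> \<open>a nearby good point and \<open>x'\<close> lie on a common disc, where goodness is constant off the zeros\<close>
  have near_N: "good x'"
    if x: "x \<in> N" and "ball x \<rho> \<subseteq> \<Omega>" "\<rho> > 0" "x' \<in> ball x (\<rho> / 4)" "f x' \<noteq> 0" for x x' \<rho>
  proof -
    have "\<rho> / 4 > 0" using that by simp
    then obtain y where y: "y \<in> ball x (\<rho> / 4)" "f y \<noteq> 0" "good y" using x unfolding N_def by blast
    have sub: "y + \<zeta> *s (x' - y) \<in> \<Omega>" if \<zeta>: "\<zeta> \<in> ball 0 (3 / 2)" for \<zeta>
    proof -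
      have "dist y x' < \<rho> / 2" using y(1) \<open>x' \<in> _\<close> dist_triangle[of y x' x] by (simp add: dist_commute)
      then have "norm \<zeta> * norm (x' - y) \<le> 3 / 2 * (\<rho> / 2)"
        using \<zeta> by (intro mult_mono) (auto simp: dist_norm norm_minus_commute)
      moreover have "dist x (y + \<zeta> *s (x' - y)) \<le> dist x y + norm (\<zeta> *s (x' - y))"
        using norm_triangle_ineq4[of "x - y" "\<zeta> *s (x' - y)"] by (simp add: dist_norm algebra_simps)
      ultimately have "dist x (y + \<zeta> *s (x' - y)) < \<rho>"
        using y(1) by (simp add: norm_vector_scalar_mult)
      then show ?thesis using \<open>ball x \<rho> \<subseteq> \<Omega>\<close> by (simp add: subset_eq)
    qed
    have "good (y + 1 *s (x' - y))"
      by (rule good_on_disc[where R = "3 / 2" and \<zeta>\<^sub>0 = 0]) (use sub y that in auto)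
    then show ?thesis by simp
  qed
  have N_open: "\<exists>r>0. ball x r \<subseteq> N" if x: "x \<in> N" for x
  proof -
    have "x \<in> \<Omega>" using x by (simp add: N_def)
    then obtain \<rho> where \<rho>: "\<rho> > 0" "ball x \<rho> \<subseteq> \<Omega>" using \<open>open \<Omega>\<close> openE by blast
    have "x' \<in> N" if x': "x' \<in> ball x (\<rho> / 4)" for x'
    proof -
      have "\<exists>y\<in>ball x' \<tau>. y \<in> \<Omega> \<and> f y \<noteq> 0 \<and> good y" if "\<tau> > 0" for \<tau>
      proof -
        have "\<rho> / 4 > 0" using \<rho> by simp
        then obtain y where y: "y \<in> ball x (\<rho> / 4)" "f y \<noteq> 0" "good y" using x unfolding N_def by blast
        define d where "d = norm (y - x')"
        have d: "d < \<rho> / 2" using y(1) x' dist_triangle[of y x' x] by (simp add: d_def dist_commute flip: dist_norm)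
        have sub: "x' + \<zeta> *s (y - x') \<in> \<Omega>" if \<zeta>: "\<zeta> \<in> ball 0 (3 / 2)" for \<zeta>
        proof -
          have "norm \<zeta> * d \<le> 3 / 2 * (\<rho> / 2)"
            using \<zeta> d by (intro mult_mono) (auto simp: d_def)
          moreover have "dist x (x' + \<zeta> *s (y - x')) \<le> dist x x' + norm (\<zeta> *s (y - x'))"
            using norm_triangle_ineq4[of "x - x'" "\<zeta> *s (y - x')"] by (simp add: dist_norm algebra_simps)
          ultimately have "dist x (x' + \<zeta> *s (y - x')) < \<rho>"
            using x' by (simp add: norm_vector_scalar_mult d_def)
          then show ?thesis using \<open>ball x \<rho> \<subseteq> \<Omega>\<close> by (simp add: subset_eq)
        qed
        \<comment> \<open>\<open>\<delta>\<close> is so small that points at parameter less than \<open>\<delta>\<close> stay \<open>\<tau>\<close>-close to \<open>x'\<close> and \<open>\<rho>/4\<close>-close to \<open>x\<close>\<close>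
        define \<delta> where "\<delta> = min 1 (min \<tau> (\<rho> / 4 - dist x x') / (d + 1))"
        have "d \<ge> 0" by (simp add: d_def)
        then have "\<delta> > 0" using \<open>\<tau> > 0\<close> x' by (auto simp: \<delta>_def)
        moreover have "\<delta> \<le> 1" unfolding \<delta>_def by (rule min.cobounded1)
        ultimately have \<delta>: "\<delta> > 0" "\<delta> \<le> 3 / 2" by auto
        have "f (x' + (y - x')) \<noteq> 0" using y by simp
        from nonzero_on_small_circle[OF f sub _ this \<delta>]
        obtain r where r: "0 < r" "r < \<delta>" "\<And>\<zeta>. norm \<zeta> = r \<Longrightarrow> f (x' + \<zeta> *s (y - x')) \<noteq> 0" by auto
        define x'' where "x'' = x' + complex_of_real r *s (y - x')"
        have "f x'' \<noteq> 0" using r unfolding x''_def by simp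
        have "dist x' x'' = r * d"
          using r(1) by (simp add: x''_def dist_norm norm_vector_scalar_mult d_def)
        also have "\<dots> \<le> r * (d + 1)" using r(1) by simp
        also have "\<dots> < \<delta> * (d + 1)" using r(2) \<open>d \<ge> 0\<close> by (intro mult_strict_right_mono) auto
        also have "\<dots> \<le> min \<tau> (\<rho> / 4 - dist x x') / (d + 1) * (d + 1)"
          using \<open>d \<ge> 0\<close> by (intro mult_right_mono) (auto simp: \<delta>_def)
        also have "\<dots> = min \<tau> (\<rho> / 4 - dist x x')" using \<open>d \<ge> 0\<close> by simp
        finally have x'': "x'' \<in> ball x' \<tau>" "x'' \<in> ball x (\<rho> / 4)"
          using dist_triangle[of x x'' x'] by auto
        moreover have "x'' \<in> \<Omega>" using x''(2) \<rho> by (auto simp: subset_eq)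
        ultimately show ?thesis
          using near_N[OF x \<rho>(2,1) x''(2) \<open>f x'' \<noteq> 0\<close>] \<open>f x'' \<noteq> 0\<close> by blast
      qed
      then show ?thesis using x' \<rho> by (auto simp: N_def subset_eq)
    qed
    then show ?thesis using \<rho> by (intro exI[of _ "\<rho> / 4"]) auto
  qed
  have "openin (top_of_set \<Omega>) N"
  proof (rule open_subset)
    show "open N" using N_open by (auto simp: open_contains_ball)
    show "N \<subseteq> \<Omega>" by (auto simp: N_def)
  qed
  moreover have "closedin (top_of_set \<Omega>) N"
  proof -
    define S where "S = {y \<in> \<Omega>. f y \<noteq> 0 \<and> good y}"
    have "x \<in> N \<longleftrightarrow> x \<in> \<Omega> \<and> (\<forall>\<rho>>0. \<exists>y\<in>S. dist y x < \<rho>)" for x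
      unfolding N_def S_def Bex_def mem_ball mem_Collect_eq dist_commute[of x] by metis
    then have "N = \<Omega> \<inter> closure S"
      unfolding set_eq_iff Int_iff closure_approachable by blast
    then show ?thesis unfolding closedin_closed using closed_closure by blast
  qed
  moreover have "w \<in> N" using w \<open>good w\<close> by (auto simp: N_def)
  ultimately have "N = \<Omega>" using \<open>connected \<Omega>\<close>[unfolded connected_clopen] by (metis empty_iff)
  then have "z \<in> N" using z by simp
  have good_bound: "\<exists>s>0. \<exists>C. \<forall>\<^sub>F k in sequentially. \<forall>x'\<in>ball x s. norm (F k x' - H k x') \<le> C * \<epsilon> k"
    if x: "x \<in> \<Omega>" "f x \<noteq> 0" and "good x" for x
  proof -
    obtain s1 C1 where 1: "s1 > 0" "\<forall>\<^sub>F k in sequentially. \<forall>x'\<in>ball x s1.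
        norm (H k x' / F k x' - H k x / F k x) \<le> C1 * \<epsilon> k" using osc[OF x] by blast
    obtain C2 where 2: "\<forall>\<^sub>F k in sequentially. norm (H k x / F k x - 1) \<le> C2 * \<epsilon> k"
      using \<open>good x\<close> unfolding good_def by blast
    obtain s3 where 3: "s3 > 0" "\<forall>\<^sub>F k in sequentially. \<forall>x'\<in>ball x s3.
        norm (f x) / 4 \<le> norm (F k x') \<and> norm (F k x') \<le> 2 * norm (f x)"
      by (rule locally_uniform_limit_nonzero[OF lim cont x]) blast
    have "\<forall>\<^sub>F k in sequentially. \<forall>x'\<in>ball x (min s1 s3).
        norm (F k x' - H k x') \<le> (2 * norm (f x) * (C1 + C2)) * \<epsilon> k"
      using 1(2) 2 3(2)
    proof eventually_elim
      case (elim k)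
      show ?case
      proof
        fix x' assume x': "x' \<in> ball x (min s1 s3)"
        then have "x' \<in> ball x s3" by simp
        with elim(3) have Fx': "norm (f x) / 4 \<le> norm (F k x')" "norm (F k x') \<le> 2 * norm (f x)"
          by blast+
        have "norm (H k x' / F k x' - 1) \<le> norm (H k x' / F k x' - H k x / F k x) + norm (H k x / F k x - 1)"
          using norm_triangle_ineq[of "H k x' / F k x' - H k x / F k x" "H k x / F k x - 1"] by simp
        also have "\<dots> \<le> C1 * \<epsilon> k + C2 * \<epsilon> k"
          by (rule add_mono[OF bspec[OF elim(1)] elim(2)]) (use x' in simp)
        also have "\<dots> = (C1 + C2) * \<epsilon> k" by (simp add: distrib_right)
        finally have q: "norm (H k x' / F k x' - 1) \<le> (C1 + C2) * \<epsilon> k" .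
        have "F k x' \<noteq> 0" using Fx'(1) x(2) by auto
        then have "F k x' - H k x' = - (F k x' * (H k x' / F k x' - 1))"
          by (simp add: right_diff_distrib)
        then have "norm (F k x' - H k x') = norm (F k x') * norm (H k x' / F k x' - 1)"
          by (simp only: norm_minus_cancel norm_mult)
        also have "\<dots> \<le> (2 * norm (f x)) * ((C1 + C2) * \<epsilon> k)"
          using Fx'(2) q by (intro mult_mono) auto
        finally show "norm (F k x' - H k x') \<le> (2 * norm (f x) * (C1 + C2)) * \<epsilon> k"
          by (simp add: mult.assoc)
      qed
    qed
    moreover have "min s1 s3 > 0" using 1(1) 3(1) by simp
    ultimately show ?thesis by blast
  qed
  obtain \<rho> where \<rho>: "\<rho> > 0" "ball z \<rho> \<subseteq> \<Omega>" using openE[OF \<open>open \<Omega>\<close> z] by blast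
  then have "\<rho> / 4 > 0" by simp
  then obtain y where y: "y \<in> ball z (\<rho> / 4)" "f y \<noteq> 0" using \<open>z \<in> N\<close> unfolding N_def by blast
  define v where "v = y - z"
  have v: "norm v < \<rho> / 4" using y by (simp add: v_def dist_norm norm_minus_commute)
  have line: "norm (\<zeta> *s v) < \<rho> / 2" if "norm \<zeta> < 2" for \<zeta>
    using mult_mono[of "norm \<zeta>" 2 "norm v" "norm v"] that v by (simp add: norm_vector_scalar_mult)
  have sub: "z + \<zeta> *s v \<in> \<Omega>" if "\<zeta> \<in> ball 0 2" for \<zeta>
    using line[of \<zeta>] that \<rho> by (auto simp: subset_eq dist_norm)
  have "f (z + v) \<noteq> 0" using y by (simp add: v_def)
  \<comment> \<open>for \<open>v = 0\<close> the circle degenerates to the point \<open>z\<close>, which is then good itself\<close>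
  obtain r where r: "0 < r" "r < 1" "\<And>\<zeta>. norm \<zeta> = r \<Longrightarrow> f (z + \<zeta> *s v) \<noteq> 0"
    by (rule nonzero_on_small_circle[where \<delta> = 1, OF f sub _ \<open>f (z + v) \<noteq> 0\<close>]) auto
  define K where "K = (\<lambda>\<zeta>. z + \<zeta> *s v) ` sphere 0 r"
  have "compact K" unfolding K_def
    by (intro compact_continuous_image continuous_intros linear_continuous_on
        bounded_linear_vector_scalar_mult_left) auto
  have K: "x \<in> \<Omega>" "f x \<noteq> 0" "good x" if "x \<in> K" for x
  proof -
    obtain \<zeta> where \<zeta>: "norm \<zeta> = r" "x = z + \<zeta> *s v" using \<open>x \<in> K\<close> by (auto simp: K_def)
    show "x \<in> \<Omega>" using sub[of \<zeta>] r(1,2) \<zeta> by simp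
    show "f x \<noteq> 0" using r(3)[OF \<zeta>(1)] \<zeta>(2) by simp
    have "norm (\<zeta> *s v) \<le> norm v" using \<zeta> r by (simp add: norm_vector_scalar_mult mult_left_le_one_le)
    then have "x \<in> ball z (\<rho> / 4)" using v \<zeta> by (simp add: dist_norm)
    then show "good x" by (rule near_N[OF \<open>z \<in> N\<close> \<rho>(2,1) _ \<open>f x \<noteq> 0\<close>])
  qed
  have "\<forall>x\<in>K. \<exists>s. s > 0 \<and> (\<exists>C. \<forall>\<^sub>F k in sequentially. \<forall>x'\<in>ball x s. norm (F k x' - H k x') \<le> C * \<epsilon> k)"
    using good_bound[OF K] by blast
  from bchoice[OF this] obtain s where s: "\<And>x. x \<in> K \<Longrightarrow> s x > 0" and
    "\<forall>x\<in>K. \<exists>C. \<forall>\<^sub>F k in sequentially. \<forall>x'\<in>ball x (s x). norm (F k x' - H k x') \<le> C * \<epsilon> k"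
    by blast
  from bchoice[OF this(2)] obtain C where C: "\<And>x. x \<in> K \<Longrightarrow>
      \<forall>\<^sub>F k in sequentially. \<forall>x'\<in>ball x (s x). norm (F k x' - H k x') \<le> C x * \<epsilon> k"
    by blast
  have "K \<subseteq> (\<Union>x\<in>K. ball x (s x))"
  proof
    fix x assume "x \<in> K"
    with s show "x \<in> (\<Union>x\<in>K. ball x (s x))" by (intro UN_I[of x]) simp_all
  qed
  then obtain T where T: "T \<subseteq> K" "finite T" "K \<subseteq> (\<Union>x\<in>T. ball x (s x))"
    by (rule compactE_image[where f = "\<lambda>x. ball x (s x)" and C = K, OF \<open>compact K\<close> open_ball])
  obtain e where e: "e > 0" "\<And>x. x \<in> K \<Longrightarrow> \<exists>G\<in>(\<lambda>x. ball x (s x)) ` T. ball x e \<subseteq> G"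
  proof (rule Heine_Borel_lemma[OF \<open>compact K\<close> T(3)])
    show "open G" if "G \<in> (\<lambda>x. ball x (s x)) ` T" for G
      using that by (elim imageE) (simp only: open_ball)
  qed blast
  define e' where "e' = min e (\<rho> / 2)"
  define C' where "C' = (\<Sum>x\<in>T. \<bar>C x\<bar>)"
  have "\<forall>\<^sub>F k in sequentially. \<forall>x\<in>T. \<forall>x'\<in>ball x (s x). norm (F k x' - H k x') \<le> C x * \<epsilon> k"
    using T C by (intro eventually_ball_finite) auto
  then have "\<forall>\<^sub>F k in sequentially. \<forall>x\<in>ball z e'. norm (F k x - H k x) \<le> C' * \<epsilon> k"
  proof eventually_elim
    case (elim k)
    show ?case
    proof
      fix x assume x: "x \<in> ball z e'"
      have circ: "norm (F k (x + \<zeta> *s v) - H k (x + \<zeta> *s v)) \<le> C' * \<epsilon> k" if "norm \<zeta> = r" for \<zeta>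
      proof -
        have "z + \<zeta> *s v \<in> K" using that by (auto simp: K_def)
        from e(2)[OF this] obtain t where t: "t \<in> T" "ball (z + \<zeta> *s v) e \<subseteq> ball t (s t)" by blast
        have "x + \<zeta> *s v \<in> ball (z + \<zeta> *s v) e" using x by (simp add: e'_def dist_norm)
        then have "norm (F k (x + \<zeta> *s v) - H k (x + \<zeta> *s v)) \<le> C t * \<epsilon> k" using elim t by blast
        also have "\<dots> \<le> C' * \<epsilon> k"
        proof (rule mult_right_mono)
          have "\<bar>C t\<bar> \<le> C'" unfolding C'_def by (rule member_le_sum) (use t T in auto)
          then show "C t \<le> C'" by linarith
        qed (use \<epsilon>[of k] in simp)
        finally show ?thesis .
      qed
      have in_\<Omega>: "x + \<zeta> *s v \<in> \<Omega>" if "norm \<zeta> \<le> r" for \<zeta>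
      proof -
        have "dist z (x + \<zeta> *s v) \<le> dist z x + norm (\<zeta> *s v)"
          using norm_triangle_ineq4[of "z - x" "\<zeta> *s v"] by (simp add: dist_norm algebra_simps)
        also have "\<dots> < \<rho>" using x line[of \<zeta>] that r by (simp add: e'_def)
        finally show ?thesis using \<rho> by (simp add: subset_eq)
      qed
      define U where "U = {\<zeta>. x + \<zeta> *s v \<in> \<Omega>}"
      have U: "cball 0 r \<subseteq> U" using in_\<Omega> by (auto simp: U_def)
      have hol: "(\<lambda>\<zeta>. F k (x + \<zeta> *s v) - H k (x + \<zeta> *s v)) holomorphic_on U"
        unfolding U_def by (intro holomorphic_on_diff holomorphic_on_complex_line F H)
      have "norm (F k (x + 0 *s v) - H k (x + 0 *s v)) \<le> C' * \<epsilon> k"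
      proof (rule maximum_modulus_frontier[where S = "cball 0 r" and f = "\<lambda>\<zeta>. F k (x + \<zeta> *s v) - H k (x + \<zeta> *s v)"])
        show "(\<lambda>\<zeta>. F k (x + \<zeta> *s v) - H k (x + \<zeta> *s v)) holomorphic_on interior (cball 0 r)"
          using holomorphic_on_subset[OF hol] U interior_subset by blast
        show "continuous_on (closure (cball 0 r)) (\<lambda>\<zeta>. F k (x + \<zeta> *s v) - H k (x + \<zeta> *s v))"
          using holomorphic_on_imp_continuous_on[OF holomorphic_on_subset[OF hol U]] by simp
        show "norm (F k (x + \<zeta> *s v) - H k (x + \<zeta> *s v)) \<le> C' * \<epsilon> k" if "\<zeta> \<in> frontier (cball 0 r)" for \<zeta>
          using circ that r by (simp add: frontier_cball)
      qed (use r in auto)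
      then show "norm (F k x - H k x) \<le> C' * \<epsilon> k" by simp
    qed
  qed
  moreover have "e' > 0" using e(1) \<rho>(1) by (simp add: e'_def)
  ultimately show ?thesis by blast
qed

section \<open>The midpoint deficit\<close>

text \<open>
  The deficit in the convexity of \<open>\<bar>\<cdot>\<bar>\<^sup>p\<close> at the midpoint. For \<open>p = 1\<close> it vanishes as soon as \<open>a\<close> and
  \<open>b\<close> have the same argument, so that in general it controls only the argument of \<open>b / a\<close>.
\<close>

definition midpoint_deficit :: "real \<Rightarrow> complex \<Rightarrow> complex \<Rightarrow> real" where
  "midpoint_deficit p a b = (norm a powr p + norm b powr p) / 2 - norm ((a + b) / 2) powr p"

lemma powr_midpoint_le:
  fixes x y p :: real
  assumes "0 \<le> x" "0 \<le> y" "1 \<le> p"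
  shows "((x + y) / 2) powr p \<le> (x powr p + y powr p) / 2"
proof -
  have half: "(u / 2) powr p \<le> u powr p / 2" if "0 \<le> u" for u :: real
  proof -
    have "(2::real) powr 1 \<le> 2 powr p" using \<open>1 \<le> p\<close> by (intro powr_mono) auto
    then have "u powr p / 2 powr p \<le> u powr p / 2" by (intro divide_left_mono) auto
    then show ?thesis using that by (simp add: powr_divide)
  qed
  show ?thesis
  proof (cases "x = 0 \<or> y = 0")
    case True
    then show ?thesis using half assms by auto
  next
    case False
    then show ?thesis
      using convex_onD[OF powr_convex[OF \<open>1 \<le> p\<close>], of "1 / 2" x y] assms by (simp add: field_simps)
  qed
qed

text \<open>
  The deficit splits into the convexity gap of \<open>x\<^sup>p\<close> at \<open>s = (\<bar>a\<bar> + \<bar>b\<bar>) / 2\<close>, which is discarded, and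
  \<open>s\<^sup>p - m\<^sup>p\<close> with \<open>m = \<bar>a + b\<bar> / 2 \<le> s\<close>, the gap in the triangle inequality.
\<close>

lemma powr_mean_minus_le_deficit:
  assumes "1 \<le> p"
  shows "((norm a + norm b) / 2) powr (p - 1) * ((norm a + norm b) / 2 - norm ((a + b) / 2)) \<le> midpoint_deficit p a b"
proof -
  define s where "s = (norm a + norm b) / 2"
  define m where "m = norm ((a + b) / 2)"
  have m: "0 \<le> m" "m \<le> s" using norm_triangle_ineq[of a b] by (auto simp: m_def s_def norm_divide)
  have power: "x powr p = x powr (p - 1) * x" if "0 \<le> x" for x :: real
    using that powr_add[of x "p - 1" 1] by simp
  have "s powr (p - 1) * (s - m) = s powr p - s powr (p - 1) * m"
    using m power[of s] by (simp add: algebra_simps)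
  also have "\<dots> \<le> s powr p - m powr (p - 1) * m"
    using m assms by (intro diff_left_mono mult_right_mono powr_mono2) auto
  also have "\<dots> = s powr p - m powr p" using power[OF m(1)] by simp
  also have "\<dots> \<le> midpoint_deficit p a b"
    using powr_midpoint_le[of "norm a" "norm b" p] assms by (simp add: midpoint_deficit_def s_def m_def)
  finally show ?thesis by (simp add: s_def m_def)
qed

lemma midpoint_deficit_nonneg: "1 \<le> p \<Longrightarrow> 0 \<le> midpoint_deficit p a b"
proof (rule order_trans[OF _ powr_mean_minus_le_deficit])
  show "0 \<le> ((norm a + norm b) / 2) powr (p - 1) * ((norm a + norm b) / 2 - norm ((a + b) / 2))"
    using norm_triangle_ineq[of a b] by (intro mult_nonneg_nonneg) (auto simp: norm_divide)
qed

text \<open>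
  With \<open>P = \<bar>a\<bar> \<bar>b\<bar>\<close> and \<open>R = Re (cnj a b)\<close>, the gap in the triangle inequality is
  \<open>s\<^sup>2 - m\<^sup>2 = (P - R) / 2\<close>, while \<open>(Im (cnj a b))\<^sup>2 = (P + R) (P - R) \<le> 2 P (P - R)\<close>. Holding for all
  \<open>p \<ge> 1\<close>, this is a substitute for uniform convexity that does not degenerate at \<open>p = 1\<close>.
\<close>

lemma Im_quotient_le_midpoint_deficit:
  assumes "1 \<le> p" "0 < c" "c \<le> norm a" "norm a \<le> M" "norm b \<le> M"
  shows "(Im (b / a))\<^sup>2 \<le> 8 * M\<^sup>2 / c ^ 3 * (c / 2) powr (1 - p) * midpoint_deficit p a b"
proof -
  define s where "s = (norm a + norm b) / 2"
  define m where "m = norm ((a + b) / 2)"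
  define P where "P = norm a * norm b"
  define R where "R = Re (cnj a * b)"
  have m: "0 \<le> m" "m \<le> s" using norm_triangle_ineq[of a b] by (auto simp: m_def s_def norm_divide)
  have "c \<le> norm a + norm b" using assms(3) norm_ge_zero[of b] by linarith
  then have s: "c / 2 \<le> s" "s \<le> M" using assms(4,5) by (simp_all add: s_def)
  have "a \<noteq> 0" "M > 0" using assms by auto
  have "R \<le> P" using complex_Re_le_cmod[of "cnj a * b"] by (simp add: R_def P_def norm_mult)
  have mR: "m\<^sup>2 = ((norm a)\<^sup>2 + (norm b)\<^sup>2 + 2 * R) / 4"
    unfolding m_def R_def norm_divide power_divide cmod_power2 by (simp add: power2_eq_square algebra_simps)
  have "s\<^sup>2 = ((norm a)\<^sup>2 + (norm b)\<^sup>2 + 2 * P) / 4"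
    by (simp add: s_def P_def power2_eq_square field_simps)
  with mR have PR: "P - R = 2 * (s\<^sup>2 - m\<^sup>2)" by simp
  have "s\<^sup>2 - m\<^sup>2 = (s + m) * (s - m)" by (simp add: power2_eq_square algebra_simps)
  also have "\<dots> \<le> (2 * M) * (s - m)" using m s by (intro mult_right_mono) auto
  also have "\<dots> \<le> (2 * M) * ((c / 2) powr (1 - p) * midpoint_deficit p a b)"
  proof (rule mult_left_mono)
    have "s - m = (c / 2) powr (1 - p) * ((c / 2) powr (p - 1) * (s - m))"
      using \<open>0 < c\<close> by (simp flip: powr_add mult.assoc)
    also have "\<dots> \<le> (c / 2) powr (1 - p) * (s powr (p - 1) * (s - m))"
      using s m assms by (intro mult_left_mono mult_right_mono powr_mono2) auto
    also have "\<dots> \<le> (c / 2) powr (1 - p) * midpoint_deficit p a b"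
      using powr_mean_minus_le_deficit[OF \<open>1 \<le> p\<close>, of a b] by (intro mult_left_mono) (auto simp: s_def m_def)
    finally show "s - m \<le> (c / 2) powr (1 - p) * midpoint_deficit p a b" .
  qed (use \<open>M > 0\<close> in simp)
  finally have sm: "s\<^sup>2 - m\<^sup>2 \<le> (2 * M) * ((c / 2) powr (1 - p) * midpoint_deficit p a b)" .
  have "Im (b / a) = Im (cnj a * b) / (norm a)\<^sup>2"
    by (simp add: Im_divide cmod_power2 algebra_simps)
  then have "(Im (b / a))\<^sup>2 = (Im (cnj a * b))\<^sup>2 / (norm a) ^ 4"
    by (simp add: power_divide flip: power_mult)
  also have "(Im (cnj a * b))\<^sup>2 = P\<^sup>2 - R\<^sup>2"
    using cmod_power2[of "cnj a * b"] by (simp add: P_def R_def norm_mult)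
  also have "P\<^sup>2 - R\<^sup>2 = (P + R) * (P - R)" by (simp add: power2_eq_square algebra_simps)
  also have "\<dots> / norm a ^ 4 \<le> (2 * P) * (P - R) / norm a ^ 4"
    using \<open>R \<le> P\<close> by (intro divide_right_mono mult_right_mono) auto
  also have "\<dots> = 4 * norm b / norm a ^ 3 * (s\<^sup>2 - m\<^sup>2)"
  proof -
    have "2 * (x * y) * (2 * X) / x ^ 4 = 4 * y / x ^ 3 * X" if "x \<noteq> 0" for x y X :: real
      using that by (simp add: field_simps power4_eq_xxxx power3_eq_cube)
    from this[of "norm a" "norm b" "s\<^sup>2 - m\<^sup>2"] show ?thesis
      using \<open>a \<noteq> 0\<close> unfolding PR unfolding P_def by (simp only: norm_eq_zero simp_thms)
  qed
  also have "\<dots> \<le> 4 * M / c ^ 3 * (s\<^sup>2 - m\<^sup>2)"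
  proof (rule mult_right_mono)
    show "4 * norm b / norm a ^ 3 \<le> 4 * M / c ^ 3"
      using assms by (intro frac_le power_mono) auto
    show "0 \<le> s\<^sup>2 - m\<^sup>2" using PR \<open>R \<le> P\<close> by simp
  qed
  also have "\<dots> \<le> 4 * M / c ^ 3 * ((2 * M) * ((c / 2) powr (1 - p) * midpoint_deficit p a b))"
    using sm \<open>M > 0\<close> \<open>0 < c\<close> by (intro mult_left_mono) auto
  also have "\<dots> = 8 * M\<^sup>2 / c ^ 3 * (c / 2) powr (1 - p) * midpoint_deficit p a b"
    by (simp add: power2_eq_square)
  finally show ?thesis .
qed

lemma p_bergman_spaceI:
  assumes "open \<Omega>" "1 \<le> p" "holomorphic_several \<Omega> f"
    and int: "integrable lborel (\<lambda>x. indicator \<Omega> x *\<^sub>R u x)"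
    and le: "\<And>x. x \<in> \<Omega> \<Longrightarrow> norm (f x) powr p \<le> u x"
  shows "restrict f \<Omega> \<in> p_bergman_space p \<Omega>"
proof -
  have hol: "holomorphic_several \<Omega> (restrict f \<Omega>)"
    by (rule holomorphic_several_cong[OF \<open>open \<Omega>\<close> _ assms(3)]) simp
  have "continuous_on \<Omega> (\<lambda>x. norm (restrict f \<Omega> x) powr p)"
    using \<open>1 \<le> p\<close> holomorphic_several_continuous_on[OF hol]
    by (intro continuous_on_powr' continuous_on_norm continuous_on_const) auto
  from borel_measurable_continuous_on_indicator[OF _ this]
  have meas: "(\<lambda>x. indicator \<Omega> x *\<^sub>R norm (restrict f \<Omega> x) powr p) \<in> borel_measurable lborel"
    using \<open>open \<Omega>\<close> by simp
  have "set_integrable lborel \<Omega> (\<lambda>x. norm (restrict f \<Omega> x) powr p)"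
    unfolding set_integrable_def
  proof (rule Bochner_Integration.integrable_bound[OF int meas])
    show "AE x in lborel. norm (indicator \<Omega> x *\<^sub>R norm (restrict f \<Omega> x) powr p) \<le> norm (indicator \<Omega> x *\<^sub>R u x)"
      using le by (intro AE_I2) (force simp: indicator_def)
  qed
  with hol show ?thesis unfolding p_bergman_space_def by blast
qed

definition midpoint_fun ::
    "(complex ^ 'n) set \<Rightarrow> (complex ^ 'n \<Rightarrow> complex) \<Rightarrow> (complex ^ 'n \<Rightarrow> complex) \<Rightarrow> complex ^ 'n \<Rightarrow> complex" where
  "midpoint_fun \<Omega> f h = restrict (\<lambda>x. (f x + h x) / 2) \<Omega>"

lemma midpoint_fun_in_p_bergman_space:
  assumes "open \<Omega>" "1 \<le> p" and f: "f \<in> p_bergman_space p \<Omega>" and h: "h \<in> p_bergman_space p \<Omega>"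
  shows "midpoint_fun \<Omega> f h \<in> p_bergman_space p \<Omega>"
  unfolding midpoint_fun_def
proof (rule p_bergman_spaceI[where u = "\<lambda>x. (norm (f x) powr p + norm (h x) powr p) / 2"])
  show "holomorphic_several \<Omega> (\<lambda>x. (f x + h x) / 2)"
    by (intro holomorphic_several_divide holomorphic_several_add holomorphic_several_const p_bergman_spaceD(1)[OF f]
        p_bergman_spaceD(1)[OF h]) auto
  have "integrable lborel (\<lambda>x. (indicator \<Omega> x *\<^sub>R norm (f x) powr p + indicator \<Omega> x *\<^sub>R norm (h x) powr p) / 2)"
    using p_bergman_spaceD(3)[OF f] p_bergman_spaceD(3)[OF h] unfolding set_integrable_def
    by (intro Bochner_Integration.integrable_divide Bochner_Integration.integrable_add)
  then show "integrable lborel (\<lambda>x. indicator \<Omega> x *\<^sub>R ((norm (f x) powr p + norm (h x) powr p) / 2))"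
    by (rule Bochner_Integration.integrable_cong[THEN iffD1, rotated 2]) (auto simp: field_simps)
  fix x show "norm ((f x + h x) / 2) powr p \<le> (norm (f x) powr p + norm (h x) powr p) / 2"
    using midpoint_deficit_nonneg[OF \<open>1 \<le> p\<close>, of "f x" "h x"] by (simp add: midpoint_deficit_def)
qed (use assms in auto)

lemma nn_integral_midpoint_deficit:
  assumes "open \<Omega>" "1 \<le> p" and f: "f \<in> p_bergman_space p \<Omega>" and h: "h \<in> p_bergman_space p \<Omega>"
  shows "(\<integral>\<^sup>+x\<in>\<Omega>. ennreal (midpoint_deficit p (f x) (h x)) \<partial>lborel)
    = ennreal ((p_energy p \<Omega> f + p_energy p \<Omega> h) / 2 - p_energy p \<Omega> (midpoint_fun \<Omega> f h))"
proof -
  let ?m = "midpoint_fun \<Omega> f h"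
  note int = p_bergman_spaceD(3)[OF f, unfolded set_integrable_def] p_bergman_spaceD(3)[OF h, unfolded set_integrable_def]
    p_bergman_spaceD(3)[OF midpoint_fun_in_p_bergman_space[OF assms], unfolded set_integrable_def]
  define u where "u x = (indicator \<Omega> x *\<^sub>R norm (f x) powr p + indicator \<Omega> x *\<^sub>R norm (h x) powr p) / 2
     - indicator \<Omega> x *\<^sub>R norm (?m x) powr p" for x
  have u: "u x = indicator \<Omega> x * midpoint_deficit p (f x) (h x)" for x
    by (auto simp: u_def midpoint_deficit_def midpoint_fun_def indicator_def)
  have "integrable lborel u" unfolding u_def using int by auto
  have "(\<integral>\<^sup>+x\<in>\<Omega>. ennreal (midpoint_deficit p (f x) (h x)) \<partial>lborel) = (\<integral>\<^sup>+x. ennreal (u x) \<partial>lborel)"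
    by (intro nn_integral_cong) (auto simp: u indicator_def)
  also have "\<dots> = ennreal (\<integral>x. u x \<partial>lborel)"
    by (rule nn_integral_eq_integral[OF \<open>integrable lborel u\<close>])
       (auto simp: u midpoint_deficit_nonneg[OF \<open>1 \<le> p\<close>])
  also have "(\<integral>x. u x \<partial>lborel) = (p_energy p \<Omega> f + p_energy p \<Omega> h) / 2 - p_energy p \<Omega> ?m"
    unfolding u_def p_energy_def set_lebesgue_integral_def using int by simp
  finally show ?thesis .
qed

section \<open>Stability of functions with small midpoint deficit\<close>

text \<open>
  Where \<open>f\<close> is bounded away from \<open>0\<close>, the deficit bounds the square of \<open>Im (h / f)\<close>, hence its mean
  over balls, hence (by the mean value inequality) its supremum, and the Borel-Caratheodory
  inequality turns this into a bound for the oscillation of \<open>h / f\<close>.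
\<close>

lemma quotient_oscillation_bound:
  fixes y :: "complex ^ 'n"
  assumes "open \<Omega>" "1 \<le> p" and f: "f \<in> p_bergman_space p \<Omega>" and h: "h \<in> p_bergman_space p \<Omega>"
    and sub: "ball y (2 * s) \<subseteq> \<Omega>" and "0 < s" "0 < c" "0 < \<epsilon>"
    and bd: "\<And>x. x \<in> ball y (2 * s) \<Longrightarrow> c \<le> norm (f x) \<and> norm (f x) \<le> M \<and> norm (h x) \<le> M"
    and deficit: "(p_energy p \<Omega> f + p_energy p \<Omega> h) / 2 - p_energy p \<Omega> (midpoint_fun \<Omega> f h) \<le> \<epsilon>\<^sup>2"
    and x: "x \<in> ball y (s / 2)"
  defines "K \<equiv> 8 * M\<^sup>2 / c ^ 3 * (c / 2) powr (1 - p)"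
  shows "norm (h x / f x - h y / f y) \<le> 5 * (1 + K / measure lborel (ball (0 :: complex ^ 'n) s)) * \<epsilon>"
proof -
  define V where "V = measure lborel (ball (0 :: complex ^ 'n) s)"
  have "V > 0" using measure_ball_0_pos[OF \<open>0 < s\<close>] by (simp add: V_def)
  have "K \<ge> 0" using \<open>0 < c\<close> by (simp add: K_def)
  define q where "q x = h x / f x" for x
  have f0: "f x \<noteq> 0" if "x \<in> ball y (2 * s)" for x using bd[OF that] \<open>0 < c\<close> by auto
  have holq: "holomorphic_several (ball y (2 * s)) q"
    unfolding q_def
    by (intro holomorphic_several_divide holomorphic_several_subset[OF p_bergman_spaceD(1)[OF f] sub]
        holomorphic_several_subset[OF p_bergman_spaceD(1)[OF h] sub] f0)
  have meas: "(\<lambda>x. ennreal (midpoint_deficit p (f x) (h x)) * indicator \<Omega> x) \<in> borel_measurable borel"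
  proof -
    have "continuous_on \<Omega> (\<lambda>x. midpoint_deficit p (f x) (h x))"
      unfolding midpoint_deficit_def
      using \<open>1 \<le> p\<close> p_bergman_spaceD(1)[OF f] p_bergman_spaceD(1)[OF h]
      by (intro continuous_on_powr' continuous_intros holomorphic_several_continuous_on) auto
    from borel_measurable_continuous_on_indicator[OF _ this]
    have [measurable]: "(\<lambda>x. indicator \<Omega> x *\<^sub>R midpoint_deficit p (f x) (h x)) \<in> borel_measurable borel"
      using \<open>open \<Omega>\<close> by simp
    have "(\<lambda>x. ennreal (indicator \<Omega> x *\<^sub>R midpoint_deficit p (f x) (h x))) \<in> borel_measurable borel"
      by measurable
    then show ?thesis by (rule measurable_cong[THEN iffD1, rotated]) (auto simp: indicator_def)
  qed
  define A where "A = (1 + K / V) * \<epsilon>"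
  have "A > 0" using \<open>V > 0\<close> \<open>K \<ge> 0\<close> \<open>0 < \<epsilon>\<close> by (simp add: A_def add_pos_nonneg)
  have ImA: "\<bar>Im (q u)\<bar> \<le> A" if u: "u \<in> ball y s" for u
  proof -
    have sub': "ball u s \<subseteq> ball y (2 * s)" using u \<open>0 < s\<close> by (simp add: ball_subset_ball_iff dist_commute)
    have V: "emeasure lborel (ball u s) = ennreal V"
      unfolding V_def emeasure_lborel_ball_translate[of u]
      using emeasure_lborel_ball_finite[of "0 :: complex ^ 'n" s] by (intro emeasure_eq_ennreal_measure) auto
    have "ennreal \<bar>Im (q u)\<bar> * ennreal V \<le> (\<integral>\<^sup>+x\<in>ball u s. ennreal \<bar>Im (q x)\<bar> \<partial>lborel)"
      using abs_Im_ball_submean[OF holomorphic_several_subset[OF holq sub']] V by simp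
    also have "\<dots> \<le> (\<integral>\<^sup>+x. ennreal \<epsilon> * indicator (ball u s) x
        + ennreal (K / \<epsilon>) * (ennreal (midpoint_deficit p (f x) (h x)) * indicator \<Omega> x) \<partial>lborel)"
    proof (rule nn_integral_mono)
      fix x
      show "ennreal \<bar>Im (q x)\<bar> * indicator (ball u s) x \<le> ennreal \<epsilon> * indicator (ball u s) x
        + ennreal (K / \<epsilon>) * (ennreal (midpoint_deficit p (f x) (h x)) * indicator \<Omega> x)"
      proof (cases "x \<in> ball u s")
        case True
        then have x: "x \<in> ball y (2 * s)" "x \<in> \<Omega>" using sub sub' by blast+
        define d where "d = midpoint_deficit p (f x) (h x)"
        have d: "d \<ge> 0" using midpoint_deficit_nonneg[OF \<open>1 \<le> p\<close>] by (simp add: d_def)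
        \<comment> \<open>this pointwise inequality takes the place of the Cauchy-Schwarz inequality for the integrals\<close>
        have "\<bar>Im (q x)\<bar> \<le> \<epsilon> + (Im (q x))\<^sup>2 / \<epsilon>"
        proof (cases "\<bar>Im (q x)\<bar> \<le> \<epsilon>")
          case True
          then show ?thesis using \<open>0 < \<epsilon>\<close> by (simp add: add_increasing2)
        next
          case False
          then have "\<bar>Im (q x)\<bar> * \<epsilon> \<le> \<bar>Im (q x)\<bar> * \<bar>Im (q x)\<bar>" by (intro mult_left_mono) auto
          also have "\<dots> = (Im (q x))\<^sup>2" by (simp add: power2_eq_square flip: abs_mult)
          finally have "\<bar>Im (q x)\<bar> \<le> (Im (q x))\<^sup>2 / \<epsilon>" using \<open>0 < \<epsilon>\<close> by (simp add: pos_le_divide_eq)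
          then show ?thesis using \<open>0 < \<epsilon>\<close> by linarith
        qed
        also have "(Im (q x))\<^sup>2 / \<epsilon> \<le> K * d / \<epsilon>"
          using Im_quotient_le_midpoint_deficit[OF \<open>1 \<le> p\<close> \<open>0 < c\<close>, of "f x" M "h x"] bd[OF x(1)] \<open>0 < \<epsilon>\<close>
          by (intro divide_right_mono) (auto simp: q_def K_def d_def)
        finally have "\<bar>Im (q x)\<bar> \<le> \<epsilon> + K / \<epsilon> * d" by simp
        then have "ennreal \<bar>Im (q x)\<bar> \<le> ennreal (\<epsilon> + K / \<epsilon> * d)" by (rule ennreal_leI)
        also have "\<dots> = ennreal \<epsilon> + ennreal (K / \<epsilon> * d)"
          using \<open>0 < \<epsilon>\<close> \<open>K \<ge> 0\<close> d by (intro ennreal_plus mult_nonneg_nonneg) auto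
        also have "ennreal (K / \<epsilon> * d) = ennreal (K / \<epsilon>) * ennreal d"
          using \<open>0 < \<epsilon>\<close> \<open>K \<ge> 0\<close> d by (intro ennreal_mult) auto
        finally show ?thesis using True x by (simp add: d_def)
      qed simp
    qed
    also have "\<dots> = ennreal \<epsilon> * ennreal V + ennreal (K / \<epsilon>) *
        (\<integral>\<^sup>+x\<in>\<Omega>. ennreal (midpoint_deficit p (f x) (h x)) \<partial>lborel)"
    proof -
      have [measurable]: "ball u s \<in> sets borel" by simp
      have "(\<lambda>x. ennreal \<epsilon> * indicator (ball u s) x) \<in> borel_measurable borel" by measurable
      then show ?thesis using meas V
        by (subst nn_integral_add) (auto simp: nn_integral_cmult nn_integral_cmult_indicator)
    qed
    also have "\<dots> \<le> ennreal \<epsilon> * ennreal V + ennreal (K / \<epsilon>) * ennreal (\<epsilon>\<^sup>2)"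
      unfolding nn_integral_midpoint_deficit[OF \<open>open \<Omega>\<close> \<open>1 \<le> p\<close> f h]
      using deficit by (intro add_left_mono mult_left_mono ennreal_leI) auto
    also have "\<dots> = ennreal (\<epsilon> * V + K / \<epsilon> * \<epsilon>\<^sup>2)"
    proof -
      have "ennreal \<epsilon> * ennreal V = ennreal (\<epsilon> * V)"
        using \<open>0 < \<epsilon>\<close> \<open>V > 0\<close> by (intro ennreal_mult[symmetric]) auto
      moreover have "ennreal (K / \<epsilon>) * ennreal (\<epsilon>\<^sup>2) = ennreal (K / \<epsilon> * \<epsilon>\<^sup>2)"
        using \<open>0 < \<epsilon>\<close> \<open>K \<ge> 0\<close> by (intro ennreal_mult[symmetric]) auto
      moreover have "ennreal (\<epsilon> * V + K / \<epsilon> * \<epsilon>\<^sup>2) = ennreal (\<epsilon> * V) + ennreal (K / \<epsilon> * \<epsilon>\<^sup>2)"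
        using \<open>0 < \<epsilon>\<close> \<open>V > 0\<close> \<open>K \<ge> 0\<close> by (intro ennreal_plus mult_nonneg_nonneg) auto
      ultimately show ?thesis by simp
    qed
    finally have "ennreal (\<bar>Im (q u)\<bar> * V) \<le> ennreal (\<epsilon> * V + K / \<epsilon> * \<epsilon>\<^sup>2)"
      using \<open>V > 0\<close> by (simp add: ennreal_mult)
    then have "\<bar>Im (q u)\<bar> * V \<le> \<epsilon> * V + K / \<epsilon> * \<epsilon>\<^sup>2"
      using \<open>V > 0\<close> \<open>0 < \<epsilon>\<close> \<open>K \<ge> 0\<close> by (subst (asm) ennreal_le_iff) auto
    also have "\<dots> = A * V" using \<open>V > 0\<close> \<open>0 < \<epsilon>\<close> by (simp add: A_def field_simps power2_eq_square)
    finally show ?thesis using \<open>V > 0\<close> by simp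
  qed
  have "holomorphic_several (ball y s) q"
    using holq by (rule holomorphic_several_subset) (use \<open>0 < s\<close> in auto)
  from Im_bounded_holomorphic_several_increment[OF this \<open>A > 0\<close> ImA x]
  have "norm (q x - q y) \<le> 10 * A / s * norm (x - y)" .
  also have "\<dots> \<le> 10 * A / s * (s / 2)"
    using x \<open>A > 0\<close> \<open>0 < s\<close> by (intro mult_left_mono) (auto simp: dist_norm norm_minus_commute)
  also have "\<dots> = 5 * A" using \<open>0 < s\<close> by simp
  finally show ?thesis unfolding q_def A_def V_def by (simp only: mult.assoc)
qed

lemma locally_uniform_limit_along_sequence:
  assumes lim: "locally_uniform_limit \<Omega> F g" and cont: "continuous_on \<Omega> g" and "w\<^sub>0 \<in> \<Omega>" "open \<Omega>"
    and w: "w \<longlonglongrightarrow> w\<^sub>0"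
  shows "(\<lambda>k. F k (w k)) \<longlonglongrightarrow> g w\<^sub>0"
proof -
  obtain s where s: "s > 0" "uniform_limit (cball w\<^sub>0 s) F g sequentially"
    using lim \<open>w\<^sub>0 \<in> \<Omega>\<close> unfolding locally_uniform_limit_def by blast
  have "isCont g w\<^sub>0" using cont \<open>open \<Omega>\<close> \<open>w\<^sub>0 \<in> \<Omega>\<close> by (simp add: continuous_on_eq_continuous_at)
  then have g: "(\<lambda>k. g (w k)) \<longlonglongrightarrow> g w\<^sub>0" using w by (rule isCont_tendsto_compose)
  show ?thesis
  proof (rule tendstoI)
    fix e :: real assume "0 < e"
    then have "\<forall>\<^sub>F k in sequentially. \<forall>x\<in>cball w\<^sub>0 s. dist (F k x) (g x) < e / 2"
      using s(2) by (intro uniform_limitD) auto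
    moreover have "\<forall>\<^sub>F k in sequentially. dist (g (w k)) (g w\<^sub>0) < e / 2"
      using tendstoD[OF g, of "e / 2"] \<open>0 < e\<close> by simp
    moreover have "\<forall>\<^sub>F k in sequentially. dist (w k) w\<^sub>0 < s" using tendstoD[OF w s(1)] .
    ultimately show "\<forall>\<^sub>F k in sequentially. dist (F k (w k)) (g w\<^sub>0) < e"
    proof eventually_elim
      case (elim k)
      have "w k \<in> cball w\<^sub>0 s" using elim(3) by (simp add: dist_commute)
      then have "dist (F k (w k)) (g (w k)) < e / 2" using elim(1) by blast
      then show ?case using elim(2) dist_triangle[of "F k (w k)" "g w\<^sub>0" "g (w k)"] by linarith
    qed
  qed
qed

text \<open>
  The heart of the proof. A subsequence of \<open>f\<^sub>k\<close> converges to some \<open>g\<close> with \<open>g(w\<^sub>0) = 1\<close>; around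
  points where \<open>g\<close> does not vanish the ratios \<open>h\<^sub>k / f\<^sub>k\<close> have oscillation \<open>O(\<epsilon>\<^sub>k)\<close>, and at \<open>w\<^sub>0\<close> they
  are \<open>1 + O(\<epsilon>\<^sub>k)\<close>. Stating it for sequences gives uniformity in the point, and it covers uniqueness
  of minimizers as well (constant sequences and an arbitrary null sequence \<open>\<epsilon>\<^sub>k\<close>).
\<close>

lemma p_bergman_stability:
  fixes \<Omega> :: "(complex ^ 'n) set" and f h :: "nat \<Rightarrow> complex ^ 'n \<Rightarrow> complex" and \<epsilon> :: "nat \<Rightarrow> real"
  assumes "open \<Omega>" "connected \<Omega>" "1 \<le> p"
    and f: "\<And>k. f k \<in> p_bergman_space p \<Omega>" and h: "\<And>k. h k \<in> p_bergman_space p \<Omega>"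
    and Bf: "\<And>k. p_energy p \<Omega> (f k) \<le> B" and Bh: "\<And>k. p_energy p \<Omega> (h k) \<le> B"
    and w: "w \<longlonglongrightarrow> w\<^sub>0" "w\<^sub>0 \<in> \<Omega>" and one: "\<And>k. f k (w k) = 1"
    and \<epsilon>: "\<And>k. 0 < \<epsilon> k" and h1: "\<And>k. norm (h k (w k) - 1) \<le> \<epsilon> k"
    and deficit: "\<And>k. (p_energy p \<Omega> (f k) + p_energy p \<Omega> (h k)) / 2
        - p_energy p \<Omega> (midpoint_fun \<Omega> (f k) (h k)) \<le> (\<epsilon> k)\<^sup>2"
  obtains r where "strict_mono (r :: nat \<Rightarrow> nat)"
    "\<And>z. z \<in> \<Omega> \<Longrightarrow> \<exists>s>0. \<exists>C. \<forall>\<^sub>F k in sequentially. \<forall>x\<in>ball z s.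
        norm (f (r k) x - h (r k) x) \<le> C * \<epsilon> (r k)"
proof -
  obtain r g where r: "strict_mono (r :: nat \<Rightarrow> nat)" and g: "holomorphic_several \<Omega> g"
    and "\<And>z. z \<in> \<Omega> \<Longrightarrow> \<exists>s>0. cball z s \<subseteq> \<Omega> \<and> uniform_limit (cball z s) (\<lambda>k. f (r k)) g sequentially"
    by (rule p_bergman_Montel[of \<Omega> p f B, OF \<open>open \<Omega>\<close> \<open>1 \<le> p\<close> f Bf]) blast
  then have lim: "locally_uniform_limit \<Omega> (\<lambda>k. f (r k)) g" unfolding locally_uniform_limit_def by blast
  have cont: "continuous_on \<Omega> g" using g by (rule holomorphic_several_continuous_on)
  have wr: "(\<lambda>k. w (r k)) \<longlonglongrightarrow> w\<^sub>0" using LIMSEQ_subseq_LIMSEQ[OF w(1) r] by (simp add: o_def)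
  have "(\<lambda>k. f (r k) (w (r k))) \<longlonglongrightarrow> g w\<^sub>0"
    by (rule locally_uniform_limit_along_sequence[OF lim cont w(2) \<open>open \<Omega>\<close> wr])
  then have "g w\<^sub>0 = 1" using one LIMSEQ_unique[OF _ tendsto_const] by simp
  have osc: "\<exists>s>0. \<exists>C. \<forall>\<^sub>F k in sequentially. \<forall>x\<in>ball y s.
      norm (h (r k) x / f (r k) x - h (r k) y / f (r k) y) \<le> C * \<epsilon> (r k)"
    if y: "y \<in> \<Omega>" "g y \<noteq> 0" for y
  proof -
    obtain s1 where s1: "s1 > 0" "ball y s1 \<subseteq> \<Omega>" "\<forall>\<^sub>F k in sequentially. \<forall>x\<in>ball y s1.
        norm (g y) / 4 \<le> norm (f (r k) x) \<and> norm (f (r k) x) \<le> 2 * norm (g y)"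
      by (rule locally_uniform_limit_nonzero[OF lim cont y])
    define s where "s = s1 / 4"
    define c where "c = norm (g y) / 4"
    define M where "M = max (2 * norm (g y)) (1 + B / measure lborel (ball (0 :: complex ^ 'n) (s1 / 2)))"
    have s: "0 < s" "ball y (2 * s) \<subseteq> \<Omega>" "ball y (2 * s) \<subseteq> ball y s1"
    proof -
      show "0 < s" using s1(1) by (simp add: s_def)
      show *: "ball y (2 * s) \<subseteq> ball y s1" using s1(1) by (intro subset_ball) (simp add: s_def)
      show "ball y (2 * s) \<subseteq> \<Omega>" using * s1(2) by blast
    qed
    have "c > 0" using y by (simp add: c_def)
    have hM: "norm (h k x) \<le> M" if "x \<in> ball y (2 * s)" for k x
    proof -
      have "ball x (s1 / 2) \<subseteq> ball y s1" using that by (simp add: s_def ball_subset_ball_iff dist_commute)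
      then have "norm (h k x) \<le> 1 + B / measure lborel (ball (0 :: complex ^ 'n) (s1 / 2))"
        using s1 by (intro p_bergman_bounded[OF h _ \<open>1 \<le> p\<close> _ Bh]) auto
      then show ?thesis by (simp add: M_def)
    qed
    define C where "C = 5 * (1 + 8 * M\<^sup>2 / c ^ 3 * (c / 2) powr (1 - p) / measure lborel (ball (0 :: complex ^ 'n) s))"
    have "\<forall>\<^sub>F k in sequentially. \<forall>x\<in>ball y (s / 2).
      norm (h (r k) x / f (r k) x - h (r k) y / f (r k) y) \<le> C * \<epsilon> (r k)"
      using s1(3)
    proof eventually_elim
      case (elim k)
      show ?case
      proof
        fix x assume x: "x \<in> ball y (s / 2)"
        have bd: "c \<le> norm (f (r k) u) \<and> norm (f (r k) u) \<le> M \<and> norm (h (r k) u) \<le> M"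
          if u: "u \<in> ball y (2 * s)" for u
        proof -
          have "u \<in> ball y s1" using s(3) u by blast
          with elim have "norm (g y) / 4 \<le> norm (f (r k) u) \<and> norm (f (r k) u) \<le> 2 * norm (g y)" by blast
          moreover have "2 * norm (g y) \<le> M" by (simp add: M_def)
          ultimately show ?thesis using hM[OF u, of "r k"] unfolding c_def by linarith
        qed
        show "norm (h (r k) x / f (r k) x - h (r k) y / f (r k) y) \<le> C * \<epsilon> (r k)"
          unfolding C_def
          by (rule quotient_oscillation_bound[OF \<open>open \<Omega>\<close> \<open>1 \<le> p\<close> f h s(2,1) \<open>c > 0\<close> \<epsilon> bd deficit x])
      qed
    qed
    moreover have "s / 2 > 0" using s(1) by simp
    ultimately show ?thesis by blast
  qed
  have w0: "g w\<^sub>0 \<noteq> 0" using \<open>g w\<^sub>0 = 1\<close> by simp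
  obtain s C where s: "s > 0" and ev: "\<forall>\<^sub>F k in sequentially. \<forall>x\<in>ball w\<^sub>0 s.
      norm (h (r k) x / f (r k) x - h (r k) w\<^sub>0 / f (r k) w\<^sub>0) \<le> C * \<epsilon> (r k)"
    using osc[OF w(2) w0] by blast
  have base: "\<forall>\<^sub>F k in sequentially. norm (h (r k) w\<^sub>0 / f (r k) w\<^sub>0 - 1) \<le> (C + 1) * \<epsilon> (r k)"
    using ev tendstoD[OF wr s]
  proof eventually_elim
    case (elim k)
    define u where "u = w (r k)"
    define Q where "Q = h (r k) w\<^sub>0 / f (r k) w\<^sub>0"
    have "u \<in> ball w\<^sub>0 s" using elim(2) by (simp add: u_def dist_commute)
    with elim(1) have "norm (h (r k) u / f (r k) u - Q) \<le> C * \<epsilon> (r k)" unfolding Q_def by blast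
    then have "norm (h (r k) u - Q) \<le> C * \<epsilon> (r k)" using one[of "r k"] by (simp add: u_def)
    moreover have "norm (h (r k) u - 1) \<le> \<epsilon> (r k)" using h1[of "r k"] by (simp add: u_def)
    moreover have "norm (Q - 1) \<le> norm (h (r k) u - 1) + norm (h (r k) u - Q)"
      using norm_triangle_ineq4[of "h (r k) u - 1" "h (r k) u - Q"] by simp
    ultimately show ?case by (simp add: Q_def distrib_right)
  qed
  show ?thesis
  proof (rule that[OF r])
    fix z assume z: "z \<in> \<Omega>"
    show "\<exists>s>0. \<exists>C. \<forall>\<^sub>F k in sequentially. \<forall>x\<in>ball z s. norm (f (r k) x - h (r k) x) \<le> C * \<epsilon> (r k)"
      by (rule locally_uniform_bound_propagates[OF \<open>open \<Omega>\<close> \<open>connected \<Omega>\<close> p_bergman_spaceD(1)[OF f]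
          p_bergman_spaceD(1)[OF h] lim g osc w(2) w0 base \<epsilon> z])
  qed
qed

section \<open>Existence, uniqueness and comparison of minimizers\<close>

definition is_p_minimizer ::
    "real \<Rightarrow> (complex ^ 'n) set \<Rightarrow> complex ^ 'n \<Rightarrow> (complex ^ 'n \<Rightarrow> complex) \<Rightarrow> bool" where
  "is_p_minimizer p \<Omega> w f \<longleftrightarrow> f \<in> p_bergman_space p \<Omega> \<and> f w = 1 \<and>
     (\<forall>g\<in>p_bergman_space p \<Omega>. g w = 1 \<longrightarrow> p_energy p \<Omega> f \<le> p_energy p \<Omega> g)"

lemma is_p_minimizerD:
  assumes "is_p_minimizer p \<Omega> w f"
  shows "f \<in> p_bergman_space p \<Omega>" "f w = 1"
    "\<And>g. g \<in> p_bergman_space p \<Omega> \<Longrightarrow> g w = 1 \<Longrightarrow> p_energy p \<Omega> f \<le> p_energy p \<Omega> g"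
  using assms unfolding is_p_minimizer_def by blast+

lemma p_minimizer_scaled:
  assumes "open \<Omega>" "1 \<le> p" "w \<in> \<Omega>" and f: "is_p_minimizer p \<Omega> w f" and g: "g \<in> p_bergman_space p \<Omega>"
  shows "norm (g w) powr p * p_energy p \<Omega> f \<le> p_energy p \<Omega> g"
proof (cases "g w = 0")
  case True
  then show ?thesis using p_energy_nonneg[of p \<Omega> g] by simp
next
  case False
  define c where "c = norm (g w) powr p"
  have "c > 0" using False by (simp add: c_def)
  define G where "G = restrict (\<lambda>x. g x / g w) \<Omega>"
  have eq: "norm (g x / g w) powr p = norm (g x) powr p / c" for x
    using False by (simp add: norm_divide powr_divide c_def)
  have int: "integrable lborel (\<lambda>x. indicator \<Omega> x *\<^sub>R norm (g x) powr p)"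
    using p_bergman_spaceD(3)[OF g] unfolding set_integrable_def .
  have "G \<in> p_bergman_space p \<Omega>"
    unfolding G_def
  proof (rule p_bergman_spaceI[OF \<open>open \<Omega>\<close> \<open>1 \<le> p\<close>, where u = "\<lambda>x. norm (g x) powr p / c"])
    show "holomorphic_several \<Omega> (\<lambda>x. g x / g w)"
      by (intro holomorphic_several_divide holomorphic_several_const p_bergman_spaceD(1)[OF g]) (use False in auto)
    show "integrable lborel (\<lambda>x. indicator \<Omega> x *\<^sub>R (norm (g x) powr p / c))"
      using Bochner_Integration.integrable_divide[OF int, of c] by simp
    show "norm (g x / g w) powr p \<le> norm (g x) powr p / c" for x by (simp only: eq order_refl)
  qed
  moreover have "G w = 1" using False \<open>w \<in> \<Omega>\<close> by (simp add: G_def)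
  ultimately have "p_energy p \<Omega> f \<le> p_energy p \<Omega> G" by (rule is_p_minimizerD(3)[OF f])
  also have "p_energy p \<Omega> G = (\<integral>x. (indicator \<Omega> x *\<^sub>R norm (g x) powr p) / c \<partial>lborel)"
    unfolding p_energy_def set_lebesgue_integral_def
    by (intro Bochner_Integration.integral_cong) (auto simp: G_def eq indicator_def)
  also have "\<dots> = p_energy p \<Omega> g / c"
    unfolding p_energy_def set_lebesgue_integral_def by (rule Bochner_Integration.integral_divide_zero)
  finally show ?thesis using \<open>c > 0\<close> by (simp add: c_def pos_le_divide_eq mult.commute)
qed

text \<open>
  Bernoulli's inequality, applied with the least integer exponent that is at least \<open>p\<close>. For
  \<open>x \<ge> 1\<close> the left-hand side is not positive.
\<close>

lemma one_minus_le_powr: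
  fixes p x t :: real
  assumes "1 \<le> p" "0 \<le> x" "1 - x \<le> t" "0 \<le> t"
  shows "1 - real (nat \<lceil>p\<rceil>) * x \<le> t powr p"
proof -
  define N where "N = nat \<lceil>p\<rceil>"
  have N: "p \<le> real N" "1 \<le> real N" using assms(1) by (auto simp: N_def intro: order_trans)
  consider "x > 1" | "x = 1" | "x < 1" by linarith
  then have "1 - real N * x \<le> t powr p"
  proof cases
    case 3
    have "1 + real N * (- x) \<le> (1 + (- x)) ^ N" by (rule Bernoulli_inequality) (use 3 in simp)
    also have "\<dots> = (1 - x) powr real N" using 3 by (simp add: powr_realpow)
    also have "\<dots> \<le> (1 - x) powr p" using N 3 assms by (intro powr_mono') auto
    also have "\<dots> \<le> t powr p" using 3 assms by (intro powr_mono2) auto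
    finally show ?thesis by simp
  next
    case 1
    then have "1 * 1 \<le> real N * x" using N by (intro mult_mono) auto
    moreover have "0 \<le> t powr p" by simp
    ultimately show ?thesis by linarith
  next
    case 2
    then have "1 - real N * x \<le> 0" using N by simp
    also have "0 \<le> t powr p" by simp
    finally show ?thesis .
  qed
  then show ?thesis by (simp add: N_def)
qed

lemma p_minimizers_compare:
  assumes "open \<Omega>" "1 \<le> p" "w \<in> \<Omega>" and f: "is_p_minimizer p \<Omega> w f" and g: "g \<in> p_bergman_space p \<Omega>"
    and "0 \<le> x" "norm (g w - 1) \<le> x"
  shows "(1 - real (nat \<lceil>p\<rceil>) * x) * p_energy p \<Omega> f \<le> p_energy p \<Omega> g"
proof -
  have "1 - x \<le> norm (g w)" using norm_triangle_ineq2[of 1 "1 - g w"] assms(7) by (simp add: norm_minus_commute)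
  then have "1 - real (nat \<lceil>p\<rceil>) * x \<le> norm (g w) powr p"
    using assms by (intro one_minus_le_powr) auto
  then have "(1 - real (nat \<lceil>p\<rceil>) * x) * p_energy p \<Omega> f \<le> norm (g w) powr p * p_energy p \<Omega> f"
    by (intro mult_right_mono p_energy_nonneg)
  also have "\<dots> \<le> p_energy p \<Omega> g" by (rule p_minimizer_scaled[OF assms(1-5)])
  finally show ?thesis .
qed

text \<open>
  The midpoint of two minimizers is almost admissible at \<open>w\<close>, and \<open>f\<close> is almost admissible at
  \<open>w'\<close>; both defects are of first order in \<open>x\<close>. The deficit is therefore of first order, and its
  square root is the source of the exponent \<open>1/2\<close>.
\<close>

lemma p_minimizers_deficit:
  assumes "open \<Omega>" "1 \<le> p" "w \<in> \<Omega>" "w' \<in> \<Omega>" and f: "is_p_minimizer p \<Omega> w f" and h: "is_p_minimizer p \<Omega> w' h"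
    and "0 \<le> x" "norm (h w - 1) \<le> x" "norm (f w' - 1) \<le> x" "p_energy p \<Omega> f \<le> B" "p_energy p \<Omega> h \<le> B"
  shows "(p_energy p \<Omega> f + p_energy p \<Omega> h) / 2 - p_energy p \<Omega> (midpoint_fun \<Omega> f h) \<le> 2 * real (nat \<lceil>p\<rceil>) * B * x"
proof -
  define N where "N = real (nat \<lceil>p\<rceil>)"
  let ?E = "p_energy p \<Omega>" and ?m = "midpoint_fun \<Omega> f h"
  note F = is_p_minimizerD[OF f] and H = is_p_minimizerD[OF h]
  have "?m w - 1 = (h w - 1) / 2" using F(2) \<open>w \<in> \<Omega>\<close> by (simp add: midpoint_fun_def field_simps)
  then have "norm (?m w - 1) = norm (h w - 1) / 2" by (simp only: norm_divide norm_numeral)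
  then have "norm (?m w - 1) \<le> x" using assms(7,8) by linarith
  from p_minimizers_compare[OF assms(1-3) f midpoint_fun_in_p_bergman_space[OF assms(1,2) F(1) H(1)] \<open>0 \<le> x\<close> this]
  have 1: "?E f - N * x * ?E f \<le> ?E ?m" by (simp add: N_def left_diff_distrib)
  from p_minimizers_compare[OF assms(1,2,4) h F(1) \<open>0 \<le> x\<close> assms(9)]
  have 2: "?E h - N * x * ?E h \<le> ?E f" by (simp add: N_def left_diff_distrib)
  have "N * x * ?E f \<le> N * x * B" "N * x * ?E h \<le> N * x * B"
    using assms by (auto intro!: mult_left_mono simp: N_def)
  moreover have "0 \<le> N * x * B"
    using assms p_energy_nonneg[of p \<Omega> f] by (intro mult_nonneg_nonneg) (auto simp: N_def)
  moreover have "(F + H) / 2 - m \<le> 2 * c" if "a \<le> c" "b \<le> c" "0 \<le> c" "F - a \<le> m" "H - b \<le> F"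
    for F H m a b c :: real using that by argo
  ultimately have "(?E f + ?E h) / 2 - ?E ?m \<le> 2 * (N * x * B)" using 1 2 by blast
  then show ?thesis by (simp add: N_def mult_ac)
qed

text \<open>
  Two minimizers at the same point have deficit at most \<open>0\<close>, because their midpoint is admissible.
\<close>

lemma p_minimizer_unique:
  fixes \<Omega> :: "(complex ^ 'n) set"
  assumes "open \<Omega>" "connected \<Omega>" "1 \<le> p" "w \<in> \<Omega>" and f: "is_p_minimizer p \<Omega> w f" and h: "is_p_minimizer p \<Omega> w h"
  shows "f = h"
proof (rule extensionalityI[of _ \<Omega>])
  note F = is_p_minimizerD[OF f] and H = is_p_minimizerD[OF h]
  show "f \<in> extensional \<Omega>" "h \<in> extensional \<Omega>" using F(1) H(1) by (auto simp: p_bergman_space_def)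
  define \<epsilon> where "\<epsilon> k = inverse (real (Suc k))" for k
  define B where "B = p_energy p \<Omega> f"
  have B: "p_energy p \<Omega> h \<le> B" using H(3)[OF F(1,2)] by (simp add: B_def)
  have deficit: "(p_energy p \<Omega> f + p_energy p \<Omega> h) / 2 - p_energy p \<Omega> (midpoint_fun \<Omega> f h) \<le> (\<epsilon> k)\<^sup>2" for k
  proof -
    have "(p_energy p \<Omega> f + p_energy p \<Omega> h) / 2 - p_energy p \<Omega> (midpoint_fun \<Omega> f h) \<le> 2 * real (nat \<lceil>p\<rceil>) * B * 0"
      by (rule p_minimizers_deficit[OF assms(1,3,4,4) f h]) (use F(2) H(2) B in \<open>auto simp: B_def\<close>)
    then show ?thesis using zero_le_power2[of "\<epsilon> k"] by linarith
  qed
  obtain r where r: "strict_mono (r :: nat \<Rightarrow> nat)" and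
    bound: "\<And>z. z \<in> \<Omega> \<Longrightarrow> \<exists>s>0. \<exists>C. \<forall>\<^sub>F k in sequentially. \<forall>x\<in>ball z s. norm (f x - h x) \<le> C * \<epsilon> (r k)"
  proof (rule p_bergman_stability[OF assms(1-3), of "\<lambda>_. f" "\<lambda>_. h" B "\<lambda>_. w" w \<epsilon>])
    show "norm (h w - 1) \<le> \<epsilon> k" for k using H(2) by (simp add: \<epsilon>_def)
    show "0 < \<epsilon> k" for k by (simp add: \<epsilon>_def)
  qed (use F H B deficit \<open>w \<in> \<Omega>\<close> in \<open>auto simp: B_def\<close>)
  fix z assume "z \<in> \<Omega>"
  from bound[OF this] obtain s C where "s > 0" and
    "\<forall>\<^sub>F k in sequentially. \<forall>x\<in>ball z s. norm (f x - h x) \<le> C * \<epsilon> (r k)" by blast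
  then have ev: "\<forall>\<^sub>F k in sequentially. norm (f z - h z) \<le> C * \<epsilon> (r k)"
    by (elim eventually_mono) (simp add: \<open>s > 0\<close>)
  have "\<epsilon> \<longlonglongrightarrow> 0" unfolding \<epsilon>_def by (rule LIMSEQ_inverse_real_of_nat)
  then have "(\<lambda>k. \<epsilon> (r k)) \<longlonglongrightarrow> 0" using LIMSEQ_subseq_LIMSEQ[OF _ r] by (simp add: o_def)
  then have "(\<lambda>k. C * \<epsilon> (r k)) \<longlonglongrightarrow> 0" by (rule tendsto_mult_right_zero)
  from tendsto_lowerbound[OF this ev] show "f z = h z" by simp
qed

lemma constant_one_energy:
  assumes "open \<Omega>" "bounded \<Omega>" "1 \<le> p"
  shows "restrict (\<lambda>_. 1) \<Omega> \<in> p_bergman_space p \<Omega>"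
    "p_energy p \<Omega> (restrict (\<lambda>_. 1) \<Omega>) = measure lborel \<Omega>"
proof -
  have fin: "emeasure lborel \<Omega> < \<infinity>" using emeasure_bounded_finite[OF \<open>bounded \<Omega>\<close>] .
  then have int: "integrable lborel (\<lambda>x. indicator \<Omega> x :: real)"
    using \<open>open \<Omega>\<close> by (intro integrable_real_indicator) auto
  show "restrict (\<lambda>_. 1) \<Omega> \<in> p_bergman_space p \<Omega>"
    by (rule p_bergman_spaceI[OF assms(1,3) holomorphic_several_const, of "\<lambda>_. 1"]) (use int in auto)
  have "p_energy p \<Omega> (restrict (\<lambda>_. 1) \<Omega>) = (\<integral>x. indicator \<Omega> x \<partial>lborel)"
    unfolding p_energy_def set_lebesgue_integral_def
    by (intro Bochner_Integration.integral_cong) (auto simp: indicator_def)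
  then show "p_energy p \<Omega> (restrict (\<lambda>_. 1) \<Omega>) = measure lborel \<Omega>"
    using \<open>open \<Omega>\<close> by simp
qed

lemma p_minimizer_energy_le:
  assumes "open \<Omega>" "bounded \<Omega>" "1 \<le> p" "w \<in> \<Omega>" "is_p_minimizer p \<Omega> w f"
  shows "p_energy p \<Omega> f \<le> measure lborel \<Omega>"
  using is_p_minimizerD(3)[OF assms(5) constant_one_energy(1)[OF assms(1-3)]]
    constant_one_energy(2)[OF assms(1-3)] assms(4) by simp

text \<open>
  A minimizing sequence has a locally uniform limit along a subsequence, and Fatou's lemma shows
  that the limit is a minimizer.
\<close>

lemma p_minimizer_exists:
  fixes \<Omega> :: "(complex ^ 'n) set"
  assumes "open \<Omega>" "bounded \<Omega>" "1 \<le> p" "w \<in> \<Omega>"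
  obtains f where "is_p_minimizer p \<Omega> w f"
proof -
  define S where "S = p_energy p \<Omega> ` {g \<in> p_bergman_space p \<Omega>. g w = 1}"
  have "restrict (\<lambda>_. 1) \<Omega> \<in> {g \<in> p_bergman_space p \<Omega>. g w = 1}"
    using constant_one_energy(1)[OF assms(1-3)] \<open>w \<in> \<Omega>\<close> by simp
  then have "S \<noteq> {}" unfolding S_def by blast
  have bdd: "bdd_below S" unfolding S_def by (rule bdd_belowI2[where m = 0]) (rule p_energy_nonneg)
  have "\<exists>g. g \<in> p_bergman_space p \<Omega> \<and> g w = 1 \<and> p_energy p \<Omega> g < Inf S + inverse (real (Suc k))" for k
  proof -
    have "\<exists>x\<in>S. x < Inf S + inverse (real (Suc k))"
      using \<open>S \<noteq> {}\<close> bdd by (subst cInf_less_iff[symmetric]) auto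
    then show ?thesis unfolding S_def by blast
  qed
  then obtain g where g: "\<And>k. g k \<in> p_bergman_space p \<Omega>" "\<And>k. g k w = 1"
    "\<And>k. p_energy p \<Omega> (g k) < Inf S + inverse (real (Suc k))" by metis
  have lower: "Inf S \<le> p_energy p \<Omega> u" if "u \<in> p_bergman_space p \<Omega>" "u w = 1" for u
    using that bdd by (intro cInf_lower) (auto simp: S_def)
  have B: "p_energy p \<Omega> (g k) \<le> Inf S + 1" for k
  proof -
    have "inverse (real (Suc k)) \<le> 1" by (simp add: inverse_le_1_iff)
    then show ?thesis using g(3)[of k] by linarith
  qed
  obtain r G where r: "strict_mono (r :: nat \<Rightarrow> nat)" and G: "holomorphic_several \<Omega> G"
    and unif: "\<And>z. z \<in> \<Omega> \<Longrightarrow> \<exists>s>0. cball z s \<subseteq> \<Omega> \<and> uniform_limit (cball z s) (\<lambda>k. g (r k)) G sequentially"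
    by (rule p_bergman_Montel[of \<Omega> p g "Inf S + 1", OF assms(1,3) g(1) B]) blast
  have lim: "(\<lambda>k. g (r k) z) \<longlonglongrightarrow> G z" if z: "z \<in> \<Omega>" for z
  proof -
    obtain s where "s > 0" "uniform_limit (cball z s) (\<lambda>k. g (r k)) G sequentially" using unif[OF z] by blast
    then show ?thesis by (intro tendsto_uniform_limitI[where x = z and S = "cball z s"]) auto
  qed
  have "(\<lambda>k. p_energy p \<Omega> (g k)) \<longlonglongrightarrow> Inf S"
  proof (rule tendsto_sandwich)
    show "\<forall>\<^sub>F k in sequentially. Inf S \<le> p_energy p \<Omega> (g k)"
      using lower[OF g(1,2)] by (intro always_eventually allI)
    show "\<forall>\<^sub>F k in sequentially. p_energy p \<Omega> (g k) \<le> Inf S + inverse (real (Suc k))"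
      using g(3) by (intro always_eventually allI less_imp_le)
    show "(\<lambda>k. Inf S + inverse (real (Suc k))) \<longlonglongrightarrow> Inf S"
      using tendsto_add[OF tendsto_const LIMSEQ_inverse_real_of_nat, of "Inf S"] by simp
  qed simp
  from LIMSEQ_subseq_LIMSEQ[OF this r]
  have "(\<lambda>k. p_energy p \<Omega> (g (r k))) \<longlonglongrightarrow> Inf S" by (simp add: o_def)
  note Fatou = p_bergman_Fatou[OF assms(1,3) g(1) this G lim]
  have "G w = 1" using lim[OF \<open>w \<in> \<Omega>\<close>] g(2) LIMSEQ_unique[OF _ tendsto_const] by simp
  have "is_p_minimizer p \<Omega> w (restrict G \<Omega>)"
    unfolding is_p_minimizer_def
    using Fatou lower \<open>G w = 1\<close> \<open>w \<in> \<Omega>\<close> by (auto intro: order_trans)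
  then show ?thesis by (rule that)
qed

lemma m_diag_eq_iff_p_minimizer:
  assumes "open \<Omega>" "bounded \<Omega>" "1 \<le> p" "w \<in> \<Omega>"
  shows "f \<in> p_bergman_space p \<Omega> \<and> f w = 1 \<and> p_norm p \<Omega> f = m_diag p \<Omega> w \<longleftrightarrow> is_p_minimizer p \<Omega> w f"
proof -
  obtain f0 where f0: "is_p_minimizer p \<Omega> w f0" using p_minimizer_exists[OF assms] .
  note F = is_p_minimizerD[OF f0]
  have mono: "p_energy p \<Omega> u \<le> p_energy p \<Omega> v \<longleftrightarrow> p_norm p \<Omega> u \<le> p_norm p \<Omega> v" for u v
  proof
    assume "p_energy p \<Omega> u \<le> p_energy p \<Omega> v"
    then show "p_norm p \<Omega> u \<le> p_norm p \<Omega> v"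
      unfolding p_norm_eq using \<open>1 \<le> p\<close> by (intro powr_mono2 p_energy_nonneg) auto
  next
    assume le: "p_norm p \<Omega> u \<le> p_norm p \<Omega> v"
    show "p_energy p \<Omega> u \<le> p_energy p \<Omega> v"
    proof (rule ccontr)
      assume "\<not> ?thesis"
      then have "p_norm p \<Omega> v < p_norm p \<Omega> u"
        unfolding p_norm_eq using \<open>1 \<le> p\<close> by (intro powr_less_mono2 p_energy_nonneg) auto
      with le show False by simp
    qed
  qed
  have diag: "m_diag p \<Omega> w = p_norm p \<Omega> f0"
    unfolding m_diag_def
  proof (rule cInf_eq_minimum)
    show "p_norm p \<Omega> f0 \<in> {p_norm p \<Omega> f |f. f \<in> p_bergman_space p \<Omega> \<and> f w = 1}" using F(1,2) by blast
    show "p_norm p \<Omega> f0 \<le> x" if "x \<in> {p_norm p \<Omega> f |f. f \<in> p_bergman_space p \<Omega> \<and> f w = 1}" for x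
      using that F(3) mono by blast
  qed
  show ?thesis
  proof
    assume f: "f \<in> p_bergman_space p \<Omega> \<and> f w = 1 \<and> p_norm p \<Omega> f = m_diag p \<Omega> w"
    then have "p_energy p \<Omega> f \<le> p_energy p \<Omega> f0" using mono diag by simp
    then show "is_p_minimizer p \<Omega> w f" unfolding is_p_minimizer_def using f F(3) order_trans by blast
  next
    assume "is_p_minimizer p \<Omega> w f"
    note F' = is_p_minimizerD[OF this]
    have "p_norm p \<Omega> f \<le> p_norm p \<Omega> f0" "p_norm p \<Omega> f0 \<le> p_norm p \<Omega> f"
      using F(3)[OF F'(1,2)] F'(3)[OF F(1,2)] mono by blast+
    then show "f \<in> p_bergman_space p \<Omega> \<and> f w = 1 \<and> p_norm p \<Omega> f = m_diag p \<Omega> w"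
      using F'(1,2) diag by simp
  qed
qed

lemma m_minimizer_is_p_minimizer:
  assumes "open \<Omega>" "connected \<Omega>" "bounded \<Omega>" "1 \<le> p" "w \<in> \<Omega>"
  shows "is_p_minimizer p \<Omega> w (m_minimizer p \<Omega> w)"
proof -
  obtain f where f: "is_p_minimizer p \<Omega> w f" using p_minimizer_exists[OF assms(1,3,4,5)] .
  have "m_minimizer p \<Omega> w = (THE f. is_p_minimizer p \<Omega> w f)"
    unfolding m_minimizer_def m_diag_eq_iff_p_minimizer[OF assms(1,3,4,5)] ..
  also have "\<dots> = f"
    by (rule the_equality[of "is_p_minimizer p \<Omega> w", OF f]) (rule p_minimizer_unique[OF assms(1,2,4,5) _ f])
  finally show ?thesis using f by simp
qed

lemma K_diag_eq:
  assumes "open \<Omega>" "connected \<Omega>" "bounded \<Omega>" "1 \<le> p" "w \<in> \<Omega>"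
  shows "K_diag p \<Omega> w = 1 / p_energy p \<Omega> (m_minimizer p \<Omega> w)"
proof -
  have "m_diag p \<Omega> w = p_norm p \<Omega> (m_minimizer p \<Omega> w)"
    using m_minimizer_is_p_minimizer[OF assms]
    unfolding m_diag_eq_iff_p_minimizer[OF assms(1,3,4,5), symmetric] by simp
  then show ?thesis
    using \<open>1 \<le> p\<close> p_energy_nonneg[of p \<Omega> "m_minimizer p \<Omega> w"]
    unfolding K_diag_def p_norm_eq by (simp add: powr_powr powr_minus_divide)
qed

section \<open>Hoelder continuity\<close>

lemma p_bergman_uniform_on_compact:
  fixes \<Omega> :: "(complex ^ 'n) set"
  assumes "open \<Omega>" "1 \<le> p" "compact K" "K \<subseteq> \<Omega>" "0 \<le> B"
  obtains M L e where "0 < M" "0 < L" "0 < e"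
    "\<And>f x. f \<in> p_bergman_space p \<Omega> \<Longrightarrow> p_energy p \<Omega> f \<le> B \<Longrightarrow> x \<in> K \<Longrightarrow> norm (f x) \<le> M"
    "\<And>f x y. f \<in> p_bergman_space p \<Omega> \<Longrightarrow> p_energy p \<Omega> f \<le> B \<Longrightarrow> x \<in> K \<Longrightarrow> y \<in> K \<Longrightarrow>
       norm (f x - f y) \<le> L * norm (x - y)"
    "\<And>f x. f \<in> p_bergman_space p \<Omega> \<Longrightarrow> x \<in> K \<Longrightarrow> f x = 1 \<Longrightarrow> e \<le> p_energy p \<Omega> f"
proof -
  obtain \<rho> where \<rho>: "\<rho> > 0" "(\<Union>x\<in>K. ball x \<rho>) \<subseteq> \<Omega>"
    using compact_subset_open_imp_ball_epsilon_subset[OF assms(3,1,4)] by blast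
  then have sub: "ball x \<rho> \<subseteq> \<Omega>" if "x \<in> K" for x using that by blast
  define V where "V r = measure lborel (ball (0 :: complex ^ 'n) r)" for r
  have V: "V r > 0" if "r > 0" for r using measure_ball_0_pos[OF that] by (simp add: V_def)
  define M where "M = 1 + B / V \<rho>"
  define L0 where "L0 = 20 * (1 + B / V (\<rho> / 2)) / \<rho>"
  define L where "L = L0 + 8 * M / \<rho>"
  have "M > 0" using V[of \<rho>] \<rho>(1) \<open>0 \<le> B\<close> by (simp add: M_def add_pos_nonneg)
  have "L0 \<ge> 0" using V[of "\<rho> / 2"] \<rho>(1) \<open>0 \<le> B\<close> by (simp add: L0_def)
  have M: "norm (f x) \<le> M" if "f \<in> p_bergman_space p \<Omega>" "p_energy p \<Omega> f \<le> B" "x \<in> K" for f x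
    using p_bergman_bounded[OF that(1) sub[OF that(3)] assms(2) \<rho>(1) that(2)] by (simp add: M_def V_def)
  have L: "norm (f x - f y) \<le> L * norm (x - y)"
    if f: "f \<in> p_bergman_space p \<Omega>" "p_energy p \<Omega> f \<le> B" and x: "x \<in> K" and y: "y \<in> K" for f x y
  proof (cases "x \<in> ball y (\<rho> / 4)")
    case True
    have "norm (f x - f y) \<le> L0 * norm (x - y)"
      using p_bergman_Lipschitz[OF f(1) sub[OF y] assms(2) \<rho>(1) f(2) True] by (simp add: L0_def V_def)
    also have "\<dots> \<le> L * norm (x - y)"
      using \<open>M > 0\<close> \<rho>(1) by (intro mult_right_mono) (auto simp: L_def)
    finally show ?thesis .
  next
    case False
    then have "\<rho> / 4 \<le> norm (x - y)" by (simp add: dist_norm norm_minus_commute)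
    have "norm (f x - f y) \<le> M + M"
      using norm_triangle_ineq4[of "f x" "f y"] M[OF f x] M[OF f y] by linarith
    also have "\<dots> = 8 * M / \<rho> * (\<rho> / 4)" using \<rho>(1) by simp
    also have "\<dots> \<le> 8 * M / \<rho> * norm (x - y)"
      using \<open>\<rho> / 4 \<le> norm (x - y)\<close> \<open>M > 0\<close> \<rho>(1) by (intro mult_left_mono) auto
    also have "\<dots> \<le> L * norm (x - y)"
      using \<open>L0 \<ge> 0\<close> by (intro mult_right_mono) (auto simp: L_def)
    finally show ?thesis .
  qed
  show ?thesis
  proof (rule that[of M L "V \<rho> / 2 powr p"])
    show "0 < L" using \<open>L0 \<ge> 0\<close> \<open>M > 0\<close> \<rho>(1) by (simp add: L_def add_nonneg_pos)
    show "0 < V \<rho> / 2 powr p" using V[OF \<rho>(1)] by simp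
    show "V \<rho> / 2 powr p \<le> p_energy p \<Omega> f"
      if "f \<in> p_bergman_space p \<Omega>" "x \<in> K" "f x = 1" for f x
      using p_energy_lower_bound[OF that(1) sub[OF that(2)] assms(2) that(3)] by (simp add: V_def)
  qed (use \<open>M > 0\<close> M L in auto)
qed

text \<open>
  Otherwise there are points \<open>z\<^sub>k, w\<^sub>k, w'\<^sub>k\<close> at which the constant \<open>k + 1\<close> fails. With \<open>\<delta>\<^sub>k\<close> the distance
  of \<open>w\<^sub>k\<close> and \<open>w'\<^sub>k\<close>, the deficit of the two minimizers is \<open>O(\<delta>\<^sub>k)\<close>, and by stability, after passing
  to convergent subsequences of \<open>z\<^sub>k\<close> and \<open>w\<^sub>k\<close>, their difference at \<open>z\<^sub>k\<close> is \<open>O(\<delta>\<^sub>k\<^sup>1\<^sup>/\<^sup>2)\<close>.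
\<close>

lemma m_off_Hoelder:
  fixes \<Omega> :: "(complex ^ 'n) set"
  assumes "open \<Omega>" "connected \<Omega>" "bounded \<Omega>" "1 \<le> p" "compact K" "K \<subseteq> \<Omega>"
  shows "\<exists>C>0. \<forall>z\<in>K. \<forall>w\<in>K. \<forall>w'\<in>K. norm (m_off p \<Omega> z w - m_off p \<Omega> z w') \<le> C * sqrt (norm (w - w'))"
proof (rule ccontr)
  assume no: "\<not> ?thesis"
  define f where "f w = m_minimizer p \<Omega> w" for w
  define B where "B = measure lborel \<Omega>"
  have "B \<ge> 0" by (simp add: B_def)
  have f: "is_p_minimizer p \<Omega> w (f w)" if "w \<in> K" for w
    using that assms(6) unfolding f_def by (intro m_minimizer_is_p_minimizer assms(1-4)) auto
  note fA = is_p_minimizerD(1)[OF f]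
  have fB: "p_energy p \<Omega> (f w) \<le> B" if "w \<in> K" for w
    using that assms(6) unfolding B_def by (intro p_minimizer_energy_le[OF assms(1,3,4) _ f]) auto
  obtain M L where "0 < L" and L: "\<And>f x y. f \<in> p_bergman_space p \<Omega> \<Longrightarrow> p_energy p \<Omega> f \<le> B \<Longrightarrow>
      x \<in> K \<Longrightarrow> y \<in> K \<Longrightarrow> norm (f x - f y) \<le> L * norm (x - y)"
    by (rule p_bergman_uniform_on_compact[OF assms(1,4,5,6) \<open>0 \<le> B\<close>]) blast
  obtain D where D: "\<And>x y. x \<in> K \<Longrightarrow> y \<in> K \<Longrightarrow> norm (x - y) \<le> D"
    using diameter_bounded_bound[OF compact_imp_bounded[OF assms(5)]] by (metis dist_norm)
  have "\<exists>z w w'. z \<in> K \<and> w \<in> K \<and> w' \<in> K \<and> real (Suc k) * sqrt (norm (w - w')) < norm (f w z - f w' z)" for k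
  proof (rule ccontr)
    assume "\<not> ?thesis"
    then have "\<forall>z\<in>K. \<forall>w\<in>K. \<forall>w'\<in>K. norm (m_off p \<Omega> z w - m_off p \<Omega> z w') \<le> real (Suc k) * sqrt (norm (w - w'))"
      unfolding m_off_def f_def not_ex de_Morgan_conj not_less by blast
    moreover have "real (Suc k) > 0" by simp
    ultimately show False using no by blast
  qed
  then obtain z w w' where K: "\<And>k. z k \<in> K" "\<And>k. w k \<in> K" "\<And>k. w' k \<in> K"
    and big: "\<And>k. real (Suc k) * sqrt (norm (w k - w' k)) < norm (f (w k) (z k) - f (w' k) (z k))"
    by metis
  define \<delta> where "\<delta> k = norm (w k - w' k)" for k
  have \<delta>: "0 < \<delta> k" for k
  proof -
    have "w k \<noteq> w' k" using big[of k] by auto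
    then show ?thesis by (simp add: \<delta>_def)
  qed
  define N where "N = real (nat \<lceil>p\<rceil>)"
  \<comment> \<open>the first summand serves for the values at \<open>w\<close>, the second for the deficit, the third makes \<open>C0\<close> positive\<close>
  define C0 where "C0 = L * sqrt D + sqrt (2 * N * B * L) + 1"
  have "0 \<le> D" using D[OF K(1) K(1), of 0 0] by simp
  have pos: "0 \<le> L * sqrt D" "0 \<le> 2 * N * B * L"
    using \<open>0 < L\<close> \<open>0 \<le> D\<close> \<open>0 \<le> B\<close> by (auto simp: N_def)
  then have "C0 > 0" unfolding C0_def by (intro add_nonneg_pos add_nonneg_nonneg) auto
  define \<epsilon> where "\<epsilon> k = C0 * sqrt (\<delta> k)" for k
  have \<epsilon>: "0 < \<epsilon> k" for k using \<open>C0 > 0\<close> \<delta> by (simp add: \<epsilon>_def)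
  have near: "norm (f (w' k) (w k) - 1) \<le> L * \<delta> k" "norm (f (w k) (w' k) - 1) \<le> L * \<delta> k" for k
    using L[OF fA[OF K(3)[of k]] fB[OF K(3)[of k]] K(2)[of k] K(3)[of k]]
      L[OF fA[OF K(2)[of k]] fB[OF K(2)[of k]] K(3)[of k] K(2)[of k]]
      is_p_minimizerD(2)[OF f[OF K(2)], of k] is_p_minimizerD(2)[OF f[OF K(3)], of k]
    by (simp_all add: \<delta>_def norm_minus_commute)
  have h1: "norm (f (w' k) (w k) - 1) \<le> \<epsilon> k" for k
  proof -
    have "\<delta> k = sqrt (\<delta> k) * sqrt (\<delta> k)" using \<delta>[of k] by simp
    also have "\<dots> \<le> sqrt D * sqrt (\<delta> k)"
      using D[OF K(2,3), of k k] \<delta>[of k] by (intro mult_right_mono) (auto simp: \<delta>_def)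
    finally have "L * \<delta> k \<le> L * (sqrt D * sqrt (\<delta> k))" using \<open>0 < L\<close> by (intro mult_left_mono) auto
    also have "\<dots> = (L * sqrt D) * sqrt (\<delta> k)" by (simp only: mult.assoc)
    also have "\<dots> \<le> C0 * sqrt (\<delta> k)"
      using pos \<delta>[of k] by (intro mult_right_mono) (auto simp: C0_def)
    finally show ?thesis using near(1)[of k] by (simp add: \<epsilon>_def)
  qed
  have deficit: "(p_energy p \<Omega> (f (w k)) + p_energy p \<Omega> (f (w' k))) / 2
      - p_energy p \<Omega> (midpoint_fun \<Omega> (f (w k)) (f (w' k))) \<le> (\<epsilon> k)\<^sup>2" for k
  proof -
    have "(p_energy p \<Omega> (f (w k)) + p_energy p \<Omega> (f (w' k))) / 2
      - p_energy p \<Omega> (midpoint_fun \<Omega> (f (w k)) (f (w' k))) \<le> 2 * real (nat \<lceil>p\<rceil>) * B * (L * \<delta> k)"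
      using K assms(6) \<open>0 < L\<close> \<delta>[of k]
      by (intro p_minimizers_deficit[OF assms(1,4) _ _ f f _ near fB fB]) auto
    also have "\<dots> = (sqrt (2 * N * B * L))\<^sup>2 * \<delta> k" using pos by (simp add: N_def mult_ac)
    also have "\<dots> \<le> C0\<^sup>2 * \<delta> k"
      using pos \<delta>[of k] by (intro mult_right_mono power_mono) (auto simp: C0_def)
    also have "\<dots> = (\<epsilon> k)\<^sup>2" using \<delta>[of k] by (simp add: \<epsilon>_def power_mult_distrib)
    finally show ?thesis .
  qed
  have "\<forall>k. (z k, w k) \<in> K \<times> K" using K(1,2) by simp
  have "seq_compact (K \<times> K)" using assms(5) by (intro compact_imp_seq_compact compact_Times)
  from this obtain l a where l: "l \<in> K \<times> K" and a: "strict_mono (a :: nat \<Rightarrow> nat)" "((\<lambda>k. (z k, w k)) \<circ> a) \<longlonglongrightarrow> l"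
    by (rule seq_compactE[OF _ \<open>\<forall>k. (z k, w k) \<in> K \<times> K\<close>])
  obtain z0 w0 where l': "l = (z0, w0)" "z0 \<in> K" "w0 \<in> K" using l by auto
  have za: "(\<lambda>k. z (a k)) \<longlonglongrightarrow> z0" and wa: "(\<lambda>k. w (a k)) \<longlonglongrightarrow> w0"
    using tendsto_fst[OF a(2)] tendsto_snd[OF a(2)] by (simp_all add: l' o_def)
  have "w0 \<in> \<Omega>" "z0 \<in> \<Omega>" using l' assms(6) by auto
  obtain r where r: "strict_mono (r :: nat \<Rightarrow> nat)" and bound: "\<And>z. z \<in> \<Omega> \<Longrightarrow> \<exists>s>0. \<exists>C. \<forall>\<^sub>F k in sequentially.
      \<forall>x\<in>ball z s. norm (f (w (a (r k))) x - f (w' (a (r k))) x) \<le> C * \<epsilon> (a (r k))"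
  proof (rule p_bergman_stability[OF assms(1,2,4), of "\<lambda>k. f (w (a k))" "\<lambda>k. f (w' (a k))" B "\<lambda>k. w (a k)" w0 "\<lambda>k. \<epsilon> (a k)"])
    show "f (w (a k)) (w (a k)) = 1" for k by (rule is_p_minimizerD(2)[OF f[OF K(2)]])
    show "f (w (a k)) \<in> p_bergman_space p \<Omega>" "p_energy p \<Omega> (f (w (a k))) \<le> B" for k
      by (rule fA[OF K(2)], rule fB[OF K(2)])
    show "f (w' (a k)) \<in> p_bergman_space p \<Omega>" "p_energy p \<Omega> (f (w' (a k))) \<le> B" for k
      by (rule fA[OF K(3)], rule fB[OF K(3)])
    show "(\<lambda>k. w (a k)) \<longlonglongrightarrow> w0" "w0 \<in> \<Omega>" by fact+
    show "0 < \<epsilon> (a k)" for k by (rule \<epsilon>)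
    show "norm (f (w' (a k)) (w (a k)) - 1) \<le> \<epsilon> (a k)" for k by (rule h1)
    show "(p_energy p \<Omega> (f (w (a k))) + p_energy p \<Omega> (f (w' (a k)))) / 2
      - p_energy p \<Omega> (midpoint_fun \<Omega> (f (w (a k))) (f (w' (a k)))) \<le> (\<epsilon> (a k))\<^sup>2" for k by (rule deficit)
  qed blast
  obtain s C where s: "s > 0" and ev: "\<forall>\<^sub>F k in sequentially.
      \<forall>x\<in>ball z0 s. norm (f (w (a (r k))) x - f (w' (a (r k))) x) \<le> C * \<epsilon> (a (r k))"
    using bound[OF \<open>z0 \<in> \<Omega>\<close>] by blast
  have "(\<lambda>k. z (a (r k))) \<longlonglongrightarrow> z0" using LIMSEQ_subseq_LIMSEQ[OF za r] by (simp add: o_def)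
  note ev2 = tendstoD[OF this s]
  obtain n where n: "C * C0 < real n" using reals_Archimedean2 by blast
  have "\<forall>\<^sub>F k in sequentially. False"
    using ev ev2 eventually_ge_at_top[of n]
  proof eventually_elim
    case (elim k)
    define j where "j = a (r k)"
    have "k \<le> j"
      unfolding j_def using seq_suble[OF r, of k] seq_suble[OF a(1), of "r k"] by linarith
    have "z j \<in> ball z0 s" using elim(2) by (simp add: j_def dist_commute)
    with elim(1) have "norm (f (w j) (z j) - f (w' j) (z j)) \<le> C * \<epsilon> j" unfolding j_def by blast
    with big[of j] have "real (Suc j) * sqrt (\<delta> j) < C * C0 * sqrt (\<delta> j)"
      by (simp add: \<epsilon>_def \<delta>_def mult.assoc)
    then have "real (Suc j) < C * C0" using \<delta>[of j] by (simp add: mult_less_cancel_right)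
    with n elim(3) \<open>k \<le> j\<close> show False by linarith
  qed
  then show False by simp
qed

text \<open>
  The kernel is the minimizer divided by its energy. Comparing energies of minimizers shows that the
  energy is Lipschitz in \<open>w\<close>, and it is bounded below on compact sets by the mean value inequality.
\<close>

lemma K_off_Hoelder:
  fixes \<Omega> :: "(complex ^ 'n) set"
  assumes "open \<Omega>" "connected \<Omega>" "bounded \<Omega>" "1 \<le> p" "compact K" "K \<subseteq> \<Omega>"
  shows "\<exists>C>0. \<forall>z\<in>K. \<forall>w\<in>K. \<forall>w'\<in>K. norm (K_off p \<Omega> z w - K_off p \<Omega> z w') \<le> C * sqrt (norm (w - w'))"
proof -
  define f where "f w = m_minimizer p \<Omega> w" for w
  define E where "E w = p_energy p \<Omega> (f w)" for w
  define B where "B = measure lborel \<Omega>"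
  have "B \<ge> 0" by (simp add: B_def)
  have f: "is_p_minimizer p \<Omega> w (f w)" if "w \<in> K" for w
    using that assms(6) unfolding f_def by (intro m_minimizer_is_p_minimizer assms(1-4)) auto
  note fA = is_p_minimizerD(1)[OF f]
  have fB: "p_energy p \<Omega> (f w) \<le> B" if "w \<in> K" for w
    using that assms(6) unfolding B_def by (intro p_minimizer_energy_le[OF assms(1,3,4) _ f]) auto
  obtain M L e where "0 < M" "0 < L" "0 < e"
    and M: "\<And>f x. f \<in> p_bergman_space p \<Omega> \<Longrightarrow> p_energy p \<Omega> f \<le> B \<Longrightarrow> x \<in> K \<Longrightarrow> norm (f x) \<le> M"
    and L: "\<And>f x y. f \<in> p_bergman_space p \<Omega> \<Longrightarrow> p_energy p \<Omega> f \<le> B \<Longrightarrow>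
      x \<in> K \<Longrightarrow> y \<in> K \<Longrightarrow> norm (f x - f y) \<le> L * norm (x - y)"
    and e: "\<And>f x. f \<in> p_bergman_space p \<Omega> \<Longrightarrow> x \<in> K \<Longrightarrow> f x = 1 \<Longrightarrow> e \<le> p_energy p \<Omega> f"
    by (rule p_bergman_uniform_on_compact[OF assms(1,4,5,6) \<open>0 \<le> B\<close>]) blast
  obtain D where D: "\<And>x y. x \<in> K \<Longrightarrow> y \<in> K \<Longrightarrow> norm (x - y) \<le> D"
    using diameter_bounded_bound[OF compact_imp_bounded[OF assms(5)]] by (metis dist_norm)
  obtain C where "0 < C" and C: "\<And>z w w'. z \<in> K \<Longrightarrow> w \<in> K \<Longrightarrow> w' \<in> K \<Longrightarrow>
      norm (f w z - f w' z) \<le> C * sqrt (norm (w - w'))"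
    using m_off_Hoelder[OF assms] unfolding m_off_def f_def by blast
  define N where "N = real (nat \<lceil>p\<rceil>)"
  have E_e: "e \<le> E w" if "w \<in> K" for w
    using e[OF fA[OF that] that is_p_minimizerD(2)[OF f[OF that]]] by (simp add: E_def)
  have E_diff: "E w - E w' \<le> N * B * L * norm (w - w')" if w: "w \<in> K" and w': "w' \<in> K" for w w'
  proof -
    have "norm (f w' w - 1) \<le> L * norm (w - w')"
      using L[OF fA[OF w'] fB[OF w'] w w'] is_p_minimizerD(2)[OF f[OF w']] by simp
    then have "(1 - N * (L * norm (w - w'))) * E w \<le> E w'"
      unfolding E_def N_def using assms(6) w \<open>0 < L\<close>
      by (intro p_minimizers_compare[OF assms(1,4) _ f fA] w w') auto
    moreover have "N * (L * norm (w - w')) * E w \<le> N * (L * norm (w - w')) * B"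
      using fB[OF w] \<open>0 < L\<close> by (intro mult_left_mono) (auto simp: E_def N_def)
    moreover have "(1 - N * (L * norm (w - w'))) * E w = E w - N * (L * norm (w - w')) * E w"
      by (simp add: left_diff_distrib)
    ultimately have "E w - E w' \<le> N * (L * norm (w - w')) * B" by linarith
    then show ?thesis by (simp add: mult_ac)
  qed
  define A where "A = N * B * L"
  have "A \<ge> 0" using \<open>B \<ge> 0\<close> \<open>0 < L\<close> by (simp add: A_def N_def)
  define C' where "C' = C / e + M * (A * sqrt \<bar>D\<bar> / e\<^sup>2)"
  have "C' > 0" using \<open>0 < C\<close> \<open>0 < e\<close> \<open>0 < M\<close> \<open>A \<ge> 0\<close> by (simp add: C'_def add_pos_nonneg)
  have "norm (K_off p \<Omega> z w - K_off p \<Omega> z w') \<le> C' * sqrt (norm (w - w'))"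
    if z: "z \<in> K" and w: "w \<in> K" and w': "w' \<in> K" for z w w'
  proof -
    define \<delta> where "\<delta> = norm (w - w')"
    have K: "K_off p \<Omega> z u = f u z * of_real (1 / E u)" if "u \<in> K" for u
      using K_diag_eq[OF assms(1-4), of u] that assms(6) by (auto simp: K_off_def m_off_def f_def E_def)
    have Ew: "0 < E w" "0 < E w'" "e \<le> E w" "e \<le> E w'" using E_e[OF w] E_e[OF w'] \<open>0 < e\<close> by auto
    have "\<bar>1 / E w - 1 / E w'\<bar> = \<bar>E w' - E w\<bar> / (E w * E w')"
      using Ew by (simp add: diff_frac_eq abs_mult)
    also have "\<dots> \<le> A * \<delta> / (e * e)"
    proof (rule frac_le)
      show "\<bar>E w' - E w\<bar> \<le> A * \<delta>"
        using E_diff[OF w w'] E_diff[OF w' w] by (simp add: A_def \<delta>_def norm_minus_commute abs_le_iff)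
      show "e * e \<le> E w * E w'" using Ew \<open>0 < e\<close> by (intro mult_mono) auto
    qed (use \<open>A \<ge> 0\<close> \<open>0 < e\<close> in \<open>auto simp: \<delta>_def\<close>)
    also have "\<dots> \<le> A * (sqrt \<bar>D\<bar> * sqrt \<delta>) / (e * e)"
    proof (intro divide_right_mono mult_left_mono \<open>A \<ge> 0\<close>)
      have "\<delta> = sqrt \<delta> * sqrt \<delta>" by (simp add: \<delta>_def)
      also have "\<dots> \<le> sqrt \<bar>D\<bar> * sqrt \<delta>"
        using D[OF w w'] by (intro mult_right_mono) (auto simp: \<delta>_def)
      finally show "\<delta> \<le> sqrt \<bar>D\<bar> * sqrt \<delta>" .
    qed (use \<open>0 < e\<close> in simp)
    finally have inv: "\<bar>1 / E w - 1 / E w'\<bar> \<le> A * sqrt \<bar>D\<bar> / e\<^sup>2 * sqrt \<delta>"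
      by (simp add: power2_eq_square mult.assoc)
    have "K_off p \<Omega> z w - K_off p \<Omega> z w' = (f w z - f w' z) * of_real (1 / E w) + f w' z * of_real (1 / E w - 1 / E w')"
      unfolding K[OF w] K[OF w'] by (simp add: algebra_simps)
    also have "norm \<dots> \<le> norm (f w z - f w' z) * \<bar>1 / E w\<bar> + norm (f w' z) * \<bar>1 / E w - 1 / E w'\<bar>"
      by (rule order_trans[OF norm_triangle_ineq]) (simp only: norm_mult norm_of_real order_refl)
    also have "\<dots> \<le> (C * sqrt \<delta>) * (1 / e) + M * (A * sqrt \<bar>D\<bar> / e\<^sup>2 * sqrt \<delta>)"
    proof (intro add_mono mult_mono inv)
      show "norm (f w z - f w' z) \<le> C * sqrt \<delta>" using C[OF z w w'] by (simp add: \<delta>_def)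
      show "\<bar>1 / E w\<bar> \<le> 1 / e" using Ew \<open>0 < e\<close> by (simp add: frac_le)
      show "norm (f w' z) \<le> M" by (rule M[OF fA[OF w'] fB[OF w'] z])
    qed (use \<open>0 < C\<close> \<open>0 < M\<close> in \<open>auto simp: \<delta>_def\<close>)
    also have "\<dots> = C' * sqrt \<delta>" by (simp add: C'_def distrib_right)
    finally show ?thesis by (simp add: \<delta>_def)
  qed
  with \<open>C' > 0\<close> show ?thesis by blast
qed

lemma Hoelder_exponent_le:
  fixes Q :: "'a \<Rightarrow> 'b :: real_normed_vector \<Rightarrow> complex"
  assumes "\<exists>C>0. \<forall>z\<in>S. \<forall>w\<in>K. \<forall>w'\<in>K. norm (Q z w - Q z w') \<le> C * sqrt (norm (w - w'))"
    and "bounded K" "0 < \<alpha>" "\<alpha> \<le> 1 / 2"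
  shows "\<exists>C>0. \<forall>z\<in>S. \<forall>w\<in>K. \<forall>w'\<in>K. norm (Q z w - Q z w') \<le> C * norm (w - w') powr \<alpha>"
proof -
  obtain C where "0 < C" and C: "\<And>z w w'. z \<in> S \<Longrightarrow> w \<in> K \<Longrightarrow> w' \<in> K \<Longrightarrow>
      norm (Q z w - Q z w') \<le> C * sqrt (norm (w - w'))" using assms(1) by blast
  define D where "D = 1 + diameter K"
  have "D \<ge> 1" using diameter_ge_0[OF \<open>bounded K\<close>] by (simp add: D_def)
  have "norm (Q z w - Q z w') \<le> (C * D) * norm (w - w') powr \<alpha>" if "z \<in> S" "w \<in> K" "w' \<in> K" for z w w'
  proof -
    define \<delta> where "\<delta> = norm (w - w')"
    have "\<delta> \<le> D"
      using diameter_bounded_bound[OF \<open>bounded K\<close> that(2,3)] by (simp add: \<delta>_def D_def dist_norm)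
    have "\<delta> \<ge> 0" by (simp add: \<delta>_def)
    then have "sqrt \<delta> = \<delta> powr (1 / 2 - \<alpha>) * \<delta> powr \<alpha>" by (simp add: powr_half_sqrt flip: powr_add)
    also have "\<dots> \<le> D powr 1 * \<delta> powr \<alpha>"
    proof (rule mult_right_mono)
      have "\<delta> powr (1 / 2 - \<alpha>) \<le> D powr (1 / 2 - \<alpha>)"
        using \<open>\<delta> \<le> D\<close> \<open>\<delta> \<ge> 0\<close> assms(4) by (intro powr_mono2) auto
      also have "\<dots> \<le> D powr 1" using \<open>D \<ge> 1\<close> assms(3) by (intro powr_mono) auto
      finally show "\<delta> powr (1 / 2 - \<alpha>) \<le> D powr 1" .
    qed simp
    finally have "C * sqrt \<delta> \<le> C * (D * \<delta> powr \<alpha>)"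
      using \<open>D \<ge> 1\<close> \<open>0 < C\<close> by (intro mult_left_mono) auto
    then show ?thesis using C[OF that] by (simp add: \<delta>_def mult.assoc)
  qed
  moreover have "0 < C * D" using \<open>0 < C\<close> \<open>D \<ge> 1\<close> by simp
  ultimately show ?thesis by blast
qed

theorem theorem1p2:
  fixes \<Omega> :: "(complex ^ 'n) set"
  assumes "open \<Omega>" and "connected \<Omega>" and "\<Omega> \<noteq> {}" and "bounded \<Omega>"
  shows "(\<forall>p>1. \<forall>U. open U \<and> U \<subset>\<subset> \<Omega> \<longrightarrow>
           (\<exists>C>0. \<forall>z\<in>U. \<forall>w\<in>U. \<forall>w'\<in>U.
              norm (m_off p \<Omega> z w - m_off p \<Omega> z w') \<le> C * norm (w - w') powr (1 / 2))) \<and>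
         (\<forall>U. open U \<and> U \<subset>\<subset> \<Omega> \<longrightarrow>
           (\<exists>C>0. \<forall>z\<in>U. \<forall>w\<in>U. \<forall>w'\<in>U.
              norm (m_off 1 \<Omega> z w - m_off 1 \<Omega> z w')
                \<le> C * norm (w - w') powr (1 / (2 * (real CARD('n) + 2))))) \<and>
         (\<forall>w\<in>\<Omega>. \<forall>U. open U \<and> w \<in> U \<and> U \<subset>\<subset> \<Omega> - zero_set \<Omega> w \<longrightarrow>
           (\<exists>C>0. \<forall>z\<in>U. \<forall>w'\<in>U.
              norm (m_off 1 \<Omega> z w - m_off 1 \<Omega> z w') \<le> C * norm (w - w') powr (1 / 2))) \<and>
         (\<forall>p>1. \<forall>U. open U \<and> U \<subset>\<subset> \<Omega> \<longrightarrow>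
           (\<exists>C>0. \<forall>z\<in>U. \<forall>w\<in>U. \<forall>w'\<in>U.
              norm (K_off p \<Omega> z w - K_off p \<Omega> z w') \<le> C * norm (w - w') powr (1 / 2))) \<and>
         (\<forall>U. open U \<and> U \<subset>\<subset> \<Omega> \<longrightarrow>
           (\<exists>C>0. \<forall>z\<in>U. \<forall>w\<in>U. \<forall>w'\<in>U.
              norm (K_off 1 \<Omega> z w - K_off 1 \<Omega> z w')
                \<le> C * norm (w - w') powr (1 / (2 * (real CARD('n) + 2))))) \<and>
         (\<forall>w\<in>\<Omega>. \<forall>U. open U \<and> w \<in> U \<and> U \<subset>\<subset> \<Omega> - zero_set \<Omega> w \<longrightarrow>
           (\<exists>C>0. \<forall>z\<in>U. \<forall>w'\<in>U.
              norm (K_off 1 \<Omega> z w - K_off 1 \<Omega> z w') \<le> C * norm (w - w') powr (1 / 2)))"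
proof -
  have main_m: "\<exists>C>0. \<forall>z\<in>U. \<forall>w\<in>U. \<forall>w'\<in>U.
      norm (m_off p \<Omega> z w - m_off p \<Omega> z w') \<le> C * norm (w - w') powr \<alpha>"
    if "1 \<le> p" "U \<subset>\<subset> \<Omega>" "0 < \<alpha>" "\<alpha> \<le> 1 / 2" for p U \<alpha>
  proof -
    have "compact (closure U)" "closure U \<subseteq> \<Omega>" using that(2) by (auto simp: relatively_compact_in_def)
    from Hoelder_exponent_le[OF m_off_Hoelder[OF assms(1,2,4) that(1) this] compact_imp_bounded[OF this(1)] that(3,4)]
    show ?thesis using closure_subset[of U] by (meson subsetD)
  qed
  have main_K: "\<exists>C>0. \<forall>z\<in>U. \<forall>w\<in>U. \<forall>w'\<in>U.
      norm (K_off p \<Omega> z w - K_off p \<Omega> z w') \<le> C * norm (w - w') powr \<alpha>"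
    if "1 \<le> p" "U \<subset>\<subset> \<Omega>" "0 < \<alpha>" "\<alpha> \<le> 1 / 2" for p U \<alpha>
  proof -
    have "compact (closure U)" "closure U \<subseteq> \<Omega>" using that(2) by (auto simp: relatively_compact_in_def)
    from Hoelder_exponent_le[OF K_off_Hoelder[OF assms(1,2,4) that(1) this] compact_imp_bounded[OF this(1)] that(3,4)]
    show ?thesis using closure_subset[of U] by (meson subsetD)
  qed
  have \<alpha>: "0 < 1 / (2 * (real CARD('n) + 2))" "1 / (2 * (real CARD('n) + 2)) \<le> 1 / 2" by (auto simp: field_simps)
  have rc: "U \<subset>\<subset> \<Omega>" if "U \<subset>\<subset> \<Omega> - zero_set \<Omega> w" for U w
    using that by (auto simp: relatively_compact_in_def)
  show ?thesis
  proof (intro conjI)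
    show "\<forall>p>1. \<forall>U. open U \<and> U \<subset>\<subset> \<Omega> \<longrightarrow>
           (\<exists>C>0. \<forall>z\<in>U. \<forall>w\<in>U. \<forall>w'\<in>U.
              norm (m_off p \<Omega> z w - m_off p \<Omega> z w') \<le> C * norm (w - w') powr (1 / 2))"
      by (intro allI impI main_m) auto
    show "\<forall>U. open U \<and> U \<subset>\<subset> \<Omega> \<longrightarrow>
           (\<exists>C>0. \<forall>z\<in>U. \<forall>w\<in>U. \<forall>w'\<in>U.
              norm (m_off 1 \<Omega> z w - m_off 1 \<Omega> z w')
                \<le> C * norm (w - w') powr (1 / (2 * (real CARD('n) + 2))))"
      by (intro allI impI main_m \<alpha>) auto
    show "\<forall>w\<in>\<Omega>. \<forall>U. open U \<and> w \<in> U \<and> U \<subset>\<subset> \<Omega> - zero_set \<Omega> w \<longrightarrow>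
           (\<exists>C>0. \<forall>z\<in>U. \<forall>w'\<in>U.
              norm (m_off 1 \<Omega> z w - m_off 1 \<Omega> z w') \<le> C * norm (w - w') powr (1 / 2))"
    proof (intro ballI allI impI)
      fix w U assume U: "open U \<and> w \<in> U \<and> U \<subset>\<subset> \<Omega> - zero_set \<Omega> w"
      with main_m[of 1 U "1 / 2"] rc[of U w] show "\<exists>C>0. \<forall>z\<in>U. \<forall>w'\<in>U.
              norm (m_off 1 \<Omega> z w - m_off 1 \<Omega> z w') \<le> C * norm (w - w') powr (1 / 2)" by auto
    qed
    show "\<forall>p>1. \<forall>U. open U \<and> U \<subset>\<subset> \<Omega> \<longrightarrow>
           (\<exists>C>0. \<forall>z\<in>U. \<forall>w\<in>U. \<forall>w'\<in>U.
              norm (K_off p \<Omega> z w - K_off p \<Omega> z w') \<le> C * norm (w - w') powr (1 / 2))"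
      by (intro allI impI main_K) auto
    show "\<forall>U. open U \<and> U \<subset>\<subset> \<Omega> \<longrightarrow>
           (\<exists>C>0. \<forall>z\<in>U. \<forall>w\<in>U. \<forall>w'\<in>U.
              norm (K_off 1 \<Omega> z w - K_off 1 \<Omega> z w')
                \<le> C * norm (w - w') powr (1 / (2 * (real CARD('n) + 2))))"
      by (intro allI impI main_K \<alpha>) auto
    show "\<forall>w\<in>\<Omega>. \<forall>U. open U \<and> w \<in> U \<and> U \<subset>\<subset> \<Omega> - zero_set \<Omega> w \<longrightarrow>
           (\<exists>C>0. \<forall>z\<in>U. \<forall>w'\<in>U.
              norm (K_off 1 \<Omega> z w - K_off 1 \<Omega> z w') \<le> C * norm (w - w') powr (1 / 2))"
    proof (intro ballI allI impI)
      fix w U assume U: "open U \<and> w \<in> U \<and> U \<subset>\<subset> \<Omega> - zero_set \<Omega> w"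
      with main_K[of 1 U "1 / 2"] rc[of U w] show "\<exists>C>0. \<forall>z\<in>U. \<forall>w'\<in>U.
              norm (K_off 1 \<Omega> z w - K_off 1 \<Omega> z w') \<le> C * norm (w - w') powr (1 / 2)" by auto
    qed
  qed
qed

end
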